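(* Let $K$ be a field of characteristic zero, let $n\ge 1$, and let $\mathbb{X}\subseteq\mathbb{P}^1\times\mathbb{P}^n$ be a nonempty finite set of points over $K$ which has the $(\star)$-property. Put $d_1:=|\mathbb{X}_1|$. Then $\mathbb{X}=CI(d_1,d'_1,\dots,d'_n)$ for some positive integers $d'_1,\dots,d'_n\ge 1$ if and only if $\mathbb{X}$ has the Cayley-Bacharach property and $\operatorname{HF}_{\vartheta_{\mathbb{X}}}(d_1-1,r_{\mathbb{X}_2})\neq 0$.
   Context: $S=K[X_0,X_1,Y_0,\dots,Y_n]$ is $\mathbb{Z}^2$-graded by $\deg X_i=(1,0)$, $\deg Y_j=(0,1)$. Points have coordinates in $K$. $I_{\mathbb{X}}\subseteq S$ is the bihomogeneous vanishing ideal of $\mathbb{X}$, $R_{\mathbb{X}}=S/I_{\mathbb{X}}$, $x_i,y_j$ are the images of $X_i,Y_j$ in $R_{\mathbb{X}}$. For a bigraded module $M$, $\operatorname{HF}_M(i,j)=\dim_K M_{i,j}$; $\operatorname{HF}_{\mathbb{X}}:=\operatorname{HF}_{R_{\mathbb{X}}}$. $\mathbb{X}_1\subseteq\mathbb{P}^1$ and $\mathbb{X}_2\subseteq\mathbb{P}^n$ are the images of $\mathbb{X}$ under the two projections; $r_{\mathbb{X}_2}$ is the regularity index of the Hilbert function of the homogeneous coordinate ring of $\mathbb{X}_2$, i.e. the least $i_0$ with $\operatorname{HF}_{\mathbb{X}_2}(i)=|\mathbb{X}_2|$ for all $i\ge i_0$. $(\star)$-property: whenever $q_1\times q'_1,\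 q_2\times q'_2\in\mathbb{X}$, then also $q_1\times q'_2\in\mathbb{X}$ or $q_2\times q'_1\in\mathbb{X}$. $\mathbb{X}=CI(d_1,d'_1,\dots,d'_n)$ means that $I_{\mathbb{X}}$ is generated by a bihomogeneous regular sequence $F_1,G_1,\dots,G_n$ with $\deg F_1=(d_1,0)$ and $\deg G_j=(0,d'_j)$. $\mathbb{X}$ has the Cayley-Bacharach property if the Hilbert function of $\mathbb{X}\setminus\{p\}$ is independent of the choice of $p\in\mathbb{X}$. A set with the $(\star)$-property is arithmetically Cohen-Macaulay ($R_{\mathbb{X}}$ is Cohen-Macaulay), and coordinates are always assumed chosen so that $x_0,y_0$ is a regular sequence in $R_{\mathbb{X}}$. The Kähler different $\vartheta_{\mathbb{X}}$ is the bihomogeneous ideal of $R_{\mathbb{X}}$ generated by the images of all $(n+1)$-minors of the Jacobian matrix with rows $\left(\frac{\partial F_k}{\partial X_1},\frac{\partial F_k}{\partial Y_1},\dots,\frac{\partial F_k}{\partial Y_n}\right)$, where $\{F_k\}$ is a finite bihomogeneous system of generators of $I_{\mathbb{X}}$ (the initial Fitting ideal of $\Omega^1_{R_{\mathbb{X}}/K[x_0,y_0]}$; independent of the generators). *)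

theory Defs
  imports
    "HOL-Algebra.QuotRing"
    "HOL-Algebra.Embedded_Algebras"
    "HOL-Algebra.Algebraic_Closure_Type"
    "HOL-Analysis.Determinants"
    "HOL-Library.Poly_Mapping"
begin

section \<open>Polynomials\<close>

text \<open>Polynomials with variables indexed by \<open>'v\<close>: finitely supported maps from exponent vectors
  to coefficients. The library's \<open>ring_of_type_algebra\<close> is the polynomial ring as a
  HOL-Algebra structure.\<close>

type_synonym ('v, 'k) mpoly = "('v \<Rightarrow>\<^sub>0 nat) \<Rightarrow>\<^sub>0 'k"

definition const :: "'k \<Rightarrow> ('v, 'k::field) mpoly" where
  "const c = Poly_Mapping.single 0 c"

definition var :: "'v \<Rightarrow> ('v, 'k::field) mpoly" where
  "var v = Poly_Mapping.single (Poly_Mapping.single v 1) 1"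

definition evaluate :: "('v::finite \<Rightarrow> 'k) \<Rightarrow> ('v, 'k::field) mpoly \<Rightarrow> 'k" where
  "evaluate a f = (\<Sum>m\<in>Poly_Mapping.keys f.
     Poly_Mapping.lookup f m * (\<Prod>v\<in>UNIV. a v ^ Poly_Mapping.lookup m v))"

text \<open>The truncated subtraction in the exponent is harmless: a monomial not containing \<open>v\<close>
  gets coefficient zero.\<close>

definition partial_deriv :: "'v \<Rightarrow> ('v, 'k::field) mpoly \<Rightarrow> ('v, 'k) mpoly" where
  "partial_deriv v f = (\<Sum>m\<in>Poly_Mapping.keys f.
     Poly_Mapping.single (m - Poly_Mapping.single v 1)
       (of_nat (Poly_Mapping.lookup m v) * Poly_Mapping.lookup f m))"

section \<open>Regular sequences and Hilbert functions\<close>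

definition regular_sequence :: "('a, 'b) ring_scheme \<Rightarrow> 'a list \<Rightarrow> bool" where
  "regular_sequence A fs \<longleftrightarrow>
     set fs \<subseteq> carrier A \<and>
     (\<forall>i<length fs. \<forall>g\<in>carrier A.
        fs ! i \<otimes>\<^bsub>A\<^esub> g \<in> Idl\<^bsub>A\<^esub> (set (take i fs)) \<longrightarrow> g \<in> Idl\<^bsub>A\<^esub> (set (take i fs))) \<and>
     Idl\<^bsub>A\<^esub> (set fs) \<noteq> carrier A"

definition residue_ring_of :: "('v, 'k::field) mpoly set \<Rightarrow> ('v, 'k) mpoly set ring" where
  "residue_ring_of I = ring_of_type_algebra Quot I"

definition residue_of :: "('v, 'k::field) mpoly set \<Rightarrow> ('v, 'k) mpoly \<Rightarrow> ('v, 'k) mpoly set" where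
  "residue_of I f = I +>\<^bsub>ring_of_type_algebra\<^esub> f"

text \<open>\<open>V\<close> is a graded piece of the polynomial ring and \<open>M\<close> a graded ideal of its quotient by
  the graded ideal \<open>I\<close>; the value is the \<open>K\<close>-dimension of the corresponding piece of \<open>M\<close>, where
  \<open>K\<close> acts through the residue classes of the constants.\<close>

definition piece_dim ::
  "('v, 'k::field) mpoly set \<Rightarrow> ('v, 'k) mpoly set set \<Rightarrow> ('v, 'k) mpoly set \<Rightarrow> nat" where
  "piece_dim I M V =
     ring.dim (residue_ring_of I) (range (\<lambda>c. residue_of I (const c))) (M \<inter> residue_of I ` V)"

section \<open>Projective spaces\<close>

text \<open>\<open>('m, 'k) proj\<close> is projective space of dimension \<open>CARD('m)\<close>. Its homogeneous coordinates are
  indexed by \<open>'m option\<close>, with \<open>None\<close> playing the role of the index 0; \<open>(unit, 'k) proj\<close>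
  is the projective line.\<close>

definition proj_rel :: "('m option \<Rightarrow> 'k::field) \<Rightarrow> ('m option \<Rightarrow> 'k) \<Rightarrow> bool" where
  "proj_rel v w \<longleftrightarrow> v \<noteq> (\<lambda>_. 0) \<and> (\<exists>c. c \<noteq> 0 \<and> w = (\<lambda>i. c * v i))"

lemma part_equivp_proj_rel: "part_equivp (proj_rel :: ('m option \<Rightarrow> 'k::field) \<Rightarrow> _)"
proof (rule part_equivpI)
  show "\<exists>v :: 'm option \<Rightarrow> 'k. proj_rel v v"
    by (rule exI[of _ "\<lambda>_. 1"]) (auto simp: proj_rel_def fun_eq_iff intro!: exI[of _ 1])
  show "symp (proj_rel :: ('m option \<Rightarrow> 'k) \<Rightarrow> _)"
  proof (rule sympI)
    fix v w :: "'m option \<Rightarrow> 'k"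
    assume "proj_rel v w"
    then obtain c where "v \<noteq> (\<lambda>_. 0)" "c \<noteq> 0" "w = (\<lambda>i. c * v i)"
      by (auto simp: proj_rel_def)
    then show "proj_rel w v"
      by (auto simp: proj_rel_def fun_eq_iff intro!: exI[of _ "inverse c"])
  qed
  show "transp (proj_rel :: ('m option \<Rightarrow> 'k) \<Rightarrow> _)"
  proof (rule transpI)
    fix u v w :: "'m option \<Rightarrow> 'k"
    assume "proj_rel u v" "proj_rel v w"
    then obtain c d where "u \<noteq> (\<lambda>_. 0)" "c \<noteq> 0" "v = (\<lambda>i. c * u i)" "d \<noteq> 0" "w = (\<lambda>i. d * v i)"
      by (auto simp: proj_rel_def)
    then show "proj_rel u w"
      by (auto simp: proj_rel_def intro!: exI[of _ "d * c"])
  qed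
qed

quotient_type (overloaded) ('m, 'k) proj = "'m option \<Rightarrow> 'k::field" / partial: proj_rel
  by (rule part_equivp_proj_rel)

lift_definition homog_coords :: "('m, 'k::field) proj \<Rightarrow> ('m option \<Rightarrow> 'k) set"
  is "\<lambda>v. {w. proj_rel v w}"
  using part_equivp_proj_rel by (metis part_equivp_def)

section \<open>Finite sets of points in projective space\<close>

definition hom_piece :: "nat \<Rightarrow> ('m::finite option, 'k::field) mpoly set" where
  "hom_piece i = {f. \<forall>m\<in>Poly_Mapping.keys f. (\<Sum>v\<in>UNIV. Poly_Mapping.lookup m v) = i}"

definition vanishing_ideal :: "('m::finite, 'k::field) proj set \<Rightarrow> ('m option, 'k) mpoly set" where
  "vanishing_ideal Z = Idl\<^bsub>ring_of_type_algebra\<^esub>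
     {f. (\<exists>i. f \<in> hom_piece i) \<and> (\<forall>p\<in>Z. \<forall>v\<in>homog_coords p. evaluate v f = 0)}"

definition HF_proj :: "('m::finite, 'k::field) proj set \<Rightarrow> nat \<Rightarrow> nat" where
  "HF_proj Z i =
     piece_dim (vanishing_ideal Z) (carrier (residue_ring_of (vanishing_ideal Z))) (hom_piece i)"

text \<open>For a nonempty finite \<open>Z\<close> the Hilbert function vanishes in negative degrees, so restricting
  to natural degrees does not change the regularity index.\<close>

definition regularity_index :: "('m::finite, 'k::field) proj set \<Rightarrow> nat" where
  "regularity_index Z = (LEAST i0. \<forall>i\<ge>i0. HF_proj Z i = card Z)"

section \<open>Finite sets of points in the product of a line and a projective space\<close>

text \<open>Variables of the bigraded ring: \<open>Inl None, Inl (Some ())\<close> are \<open>X\<^sub>0, X\<^sub>1\<close>; \<open>Inr None\<close> is \<open>Y\<^sub>0\<close> and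
  \<open>Inr (Some j)\<close>, for \<open>j\<close> in \<open>'n\<close>, are \<open>Y\<^sub>1, \<dots>, Y\<^sub>n\<close>, where \<open>n = CARD('n)\<close>. Bidegrees are natural:
  every graded piece with a negative component is zero.\<close>

type_synonym ('n, 'k) bipoly = "(unit option + 'n option, 'k) mpoly"

type_synonym ('n, 'k) bipoint = "(unit, 'k) proj \<times> ('n, 'k) proj"

definition bihom_piece :: "nat \<Rightarrow> nat \<Rightarrow> ('n::finite, 'k::field) bipoly set" where
  "bihom_piece i j = {f. \<forall>m\<in>Poly_Mapping.keys f.
     (\<Sum>a\<in>UNIV. Poly_Mapping.lookup m (Inl a)) = i \<and>
     (\<Sum>b\<in>UNIV. Poly_Mapping.lookup m (Inr b)) = j}"

definition bihomogeneous :: "('n::finite, 'k::field) bipoly \<Rightarrow> bool" where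
  "bihomogeneous f \<longleftrightarrow> (\<exists>i j. f \<in> bihom_piece i j)"

definition bivanishing_ideal :: "('n::finite, 'k::field) bipoint set \<Rightarrow> ('n, 'k) bipoly set" where
  "bivanishing_ideal \<X> = Idl\<^bsub>ring_of_type_algebra\<^esub>
     {f. bihomogeneous f \<and>
         (\<forall>(p, q)\<in>\<X>. \<forall>v\<in>homog_coords p. \<forall>w\<in>homog_coords q. evaluate (case_sum v w) f = 0)}"

definition coord_ring :: "('n::finite, 'k::field) bipoint set \<Rightarrow> ('n, 'k) bipoly set ring" where
  "coord_ring \<X> = residue_ring_of (bivanishing_ideal \<X>)"

definition HF_module ::
  "('n::finite, 'k::field) bipoint set \<Rightarrow> ('n, 'k) bipoly set set \<Rightarrow> nat \<Rightarrow> nat \<Rightarrow> nat" where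
  "HF_module \<X> M i j = piece_dim (bivanishing_ideal \<X>) M (bihom_piece i j)"

definition HF :: "('n::finite, 'k::field) bipoint set \<Rightarrow> nat \<Rightarrow> nat \<Rightarrow> nat" where
  "HF \<X> = HF_module \<X> (carrier (coord_ring \<X>))"

definition star_property :: "('n::finite, 'k::field) bipoint set \<Rightarrow> bool" where
  "star_property \<X> \<longleftrightarrow> (\<forall>q1 q1' q2 q2'.
     (q1, q1') \<in> \<X> \<and> (q2, q2') \<in> \<X> \<longrightarrow> (q1, q2') \<in> \<X> \<or> (q2, q1') \<in> \<X>)"

definition cayley_bacharach :: "('n::finite, 'k::field) bipoint set \<Rightarrow> bool" where
  "cayley_bacharach \<X> \<longleftrightarrow> (\<forall>p\<in>\<X>. \<forall>q\<in>\<X>. HF (\<X> - {p}) = HF (\<X> - {q}))"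

text \<open>The list \<open>ds\<close> holds \<open>d'\<^sub>1, \<dots>, d'\<^sub>n\<close>.\<close>

definition complete_intersection ::
  "('n::finite, 'k::field) bipoint set \<Rightarrow> nat \<Rightarrow> nat list \<Rightarrow> bool" where
  "complete_intersection \<X> d ds \<longleftrightarrow>
     length ds = CARD('n) \<and>
     (\<exists>F Gs. length Gs = length ds \<and>
        F \<in> bihom_piece d 0 \<and>
        (\<forall>j<length ds. Gs ! j \<in> bihom_piece 0 (ds ! j)) \<and>
        regular_sequence ring_of_type_algebra (F # Gs) \<and>
        bivanishing_ideal \<X> = Idl\<^bsub>ring_of_type_algebra\<^esub> (set (F # Gs)))"

definition coordinates_regular :: "('n::finite, 'k::field) bipoint set \<Rightarrow> bool" where
  "coordinates_regular \<X> \<longleftrightarrow>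
     regular_sequence (coord_ring \<X>)
       [residue_of (bivanishing_ideal \<X>) (var (Inl None)),
        residue_of (bivanishing_ideal \<X>) (var (Inr None))]"

definition bihom_generators ::
  "('n::finite, 'k::field) bipoint set \<Rightarrow> ('n, 'k) bipoly set \<Rightarrow> bool" where
  "bihom_generators \<X> Fs \<longleftrightarrow>
     finite Fs \<and> (\<forall>f\<in>Fs. bihomogeneous f) \<and>
     bivanishing_ideal \<X> = Idl\<^bsub>ring_of_type_algebra\<^esub> Fs"

text \<open>Columns of the Jacobian matrix are indexed by \<open>'n option\<close>: \<open>None\<close> stands for \<open>X\<^sub>1\<close> and
  \<open>Some j\<close> for \<open>Y\<^sub>j\<close>; there is no column for \<open>X\<^sub>0\<close> or \<open>Y\<^sub>0\<close>. An \<open>(n+1)\<close>-minor is given by a choice \<open>r\<close>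
  of \<open>n + 1\<close> rows; choices with repetitions contribute zero and reorderings only change the
  sign.\<close>

definition jacobian_var :: "'n option \<Rightarrow> unit option + 'n option" where
  "jacobian_var c = (case c of None \<Rightarrow> Inl (Some ()) | Some j \<Rightarrow> Inr (Some j))"

definition jacobian_minor ::
  "('n::finite option \<Rightarrow> ('n, 'k::field) bipoly) \<Rightarrow> ('n, 'k) bipoly" where
  "jacobian_minor r = det (\<chi> a c. partial_deriv (jacobian_var c) (r a))"

text \<open>The different is the initial Fitting ideal of the module of differentials, so it does not depend
  on the finite bihomogeneous generating system \<open>Fs\<close> of the vanishing ideal
  (\<open>bihom_generators\<close>), which is an explicit argument here.\<close>

definition kaehler_different ::
  "('n::finite, 'k::field) bipoint set \<Rightarrow> ('n, 'k) bipoly set \<Rightarrow> ('n, 'k) bipoly set set" where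
  "kaehler_different \<X> Fs = Idl\<^bsub>coord_ring \<X>\<^esub>
     {residue_of (bivanishing_ideal \<X>) (jacobian_minor r) | r. range r \<subseteq> Fs}"

end

theory Submission
  imports Defs "HOL-Library.Function_Algebras"
begin

text \<open>
  Let \<open>d\<close> be the number of points of the first projection and \<open>r\<close> the regularity index of the second
  one. Regular coordinates do not vanish at any point of \<open>\<X>\<close> (\<open>coordinates_regular_affine\<close>), so every
  point \<open>P\<close> has a representative with \<open>X\<^sub>0 = Y\<^sub>0 = 1\<close>, and Hilbert functions become dimensions of spaces
  of values at these representatives. The Cayley-Bacharach property then says that all points have
  separators in the same degrees (\<open>cayley_bacharach_iff\<close>; a separator of \<open>P\<close> is a form that does not
  vanish at \<open>P\<close> but vanishes at all other points), and the different is nonzero in degree \<open>(i, j)\<close>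
  exactly if it is represented by a form of this degree that does not vanish at some point
  (\<open>different_nonzero_iff\<close>).

  Both directions rest on \<open>exists_determinant_constant\<close>. Double the variables and write
  \<open>F\<^sub>k(x) - F\<^sub>k(x')\<close>, for \<open>n + 1\<close> forms \<open>F\<^sub>k\<close> vanishing on \<open>\<X>\<close>, as a combination of the differences
  \<open>x\<^sub>v - x'\<^sub>v\<close>. By Cramer's rule the determinant \<open>\<Delta>\<close> of the coefficients satisfies
  \<open>\<Delta> f(x) \<equiv> \<Delta> f(x')\<close> modulo the \<open>F\<^sub>k(x) - F\<^sub>k(x')\<close> (and the differences of the base coordinates), and on
  the diagonal it is the Jacobian determinant \<open>J\<close>. Integrate over \<open>x'\<close> against weights \<open>\<phi>\<close> on the points
  that annihilate all forms of degree less than \<open>D\<^sub>1\<close> in \<open>X\<close> or less than \<open>D\<^sub>2\<close> in \<open>Y\<close>. If \<open>J\<close> has degree at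
  most \<open>(D\<^sub>1, D\<^sub>2)\<close>, then \<open>\<Delta>\<close> becomes a constant \<open>c\<close>, and the congruence becomes \<open>c f \<in> (F\<^sub>0, \<dots>, F\<^sub>n)\<close> for
  every form \<open>f\<close> vanishing on \<open>\<X>\<close>. Moreover \<open>\<phi>(P) J(P) = c\<close> at every point \<open>P\<close>.

  From the different to a complete intersection: the \<open>(\<star>)\<close>-property and the Cayley-Bacharach property
  make \<open>\<X>\<close> a product (\<open>star_cayley_bacharach_product\<close>), and all its points have separators exactly in
  the degrees at least \<open>(d - 1, r)\<close>. Hence there are weights as above for \<open>(D\<^sub>1, D\<^sub>2) = (d - 1, r)\<close> that do
  not vanish at a prescribed point (\<open>functional_killing_low_degrees\<close>). A nonzero element of the
  different in this degree yields forms \<open>F\<^sub>0, \<dots>, F\<^sub>n\<close> among the given generators whose minor is of degree at most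
  \<open>(d - 1, r)\<close> and does not vanish at some point (\<open>nonvanishing_minor\<close>); so \<open>c \<noteq> 0\<close>, these forms
  generate the ideal, and \<open>J\<close> vanishes at no point. The product of the linear forms through the points of
  the line lies in the ideal, which forces one \<open>F\<^sub>k\<close> to have degree \<open>(d, 0)\<close> and then all others to have
  degree \<open>0\<close> in \<open>X\<close>. Finally, generators with linearly independent differentials form a regular
  sequence: every polynomial has a unique expansion in powers of the generators, with coefficients
  in a fixed complement of the ideal (\<open>independent_differentials.regular\<close>).

  From a complete intersection to the different: generators in separated variables make \<open>\<X>\<close> a
  product, and \<open>J\<close> vanishes at no point. With \<open>s = \<Sum> (d'\<^sub>j - 1)\<close>, the Hilbert series of a complete
  intersection shows that some point of the second projection has no separator of degree \<open>s - 1\<close>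
  (\<open>complete_intersection_not_separable\<close>). Weights that annihilate degrees below \<open>s\<close> give a constant
  \<open>c \<noteq> 0\<close>, so they vanish at no point and no point at all has a separator of degree less than \<open>s\<close>;
  weights that annihilate degree \<open>s\<close> too would give \<open>c = 0\<close> and cannot exist, so every point has a
  separator of degree \<open>s\<close>. This is the Cayley-Bacharach property together with \<open>r = s\<close>, and \<open>J\<close> is the
  required element of the different, in degree \<open>(d - 1, s)\<close>.
\<close>

abbreviation "lookup \<equiv> Poly_Mapping.lookup"
abbreviation "keys \<equiv> Poly_Mapping.keys"
abbreviation "single \<equiv> Poly_Mapping.single"

section \<open>Polynomials\<close>

text \<open>Additive maps on polynomials are given by their values on single monomials. Evaluation,
  partial derivatives and the integration functionals below all have this form and share its
  additivity.\<close>

definition extend :: "('m \<Rightarrow> 'k \<Rightarrow> 'a) \<Rightarrow> ('m \<Rightarrow>\<^sub>0 'k::zero) \<Rightarrow> 'a::comm_monoid_add" where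
  "extend h f = (\<Sum>m\<in>keys f. h m (lookup f m))"

lemma extend_zero [simp]: "extend h 0 = 0"
  by (simp add: extend_def)

lemma extend_single: "h m 0 = 0 \<Longrightarrow> extend h (single m c) = h m c"
  by (cases "c = 0") (auto simp: extend_def)

lemma extend_add:
  assumes "\<And>m. h m 0 = 0" "\<And>m a b. h m (a + b) = h m a + h m b"
  shows "extend h (f + g) = extend h f + extend h g"
  unfolding extend_def by (rule setsum_keys_plus_distrib) (use assms in auto)

lemma sum_singles: "f = (\<Sum>m\<in>keys f. single m (lookup f m))"
  by (rule poly_mapping_eqI) (auto simp: lookup_sum lookup_single when_def in_keys_iff)

lemma poly_mapping_add_induct [case_names single add]:
  fixes f :: "'m \<Rightarrow>\<^sub>0 'a::comm_monoid_add"
  assumes "\<And>m c. P (single m c)" "\<And>f g. P f \<Longrightarrow> P g \<Longrightarrow> P (f + g)"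
  shows "P f"
proof -
  have "P (\<Sum>m\<in>A. single m (lookup f m))" if "finite A" for A
    using that
  proof (induction A rule: finite_induct)
    case empty
    then show ?case using assms(1)[of undefined 0] by simp
  qed (use assms in auto)
  from this[of "keys f"] show ?thesis using sum_singles[of f] by simp
qed

definition pmono :: "('v::finite \<Rightarrow> 'a::comm_monoid_mult) \<Rightarrow> ('v \<Rightarrow>\<^sub>0 nat) \<Rightarrow> 'a" where
  "pmono x m = (\<Prod>v\<in>UNIV. x v ^ lookup m v)"

lemma pmono_zero [simp]: "pmono x 0 = 1"
  by (simp add: pmono_def)

lemma pmono_add: "pmono x (m + n) = pmono x m * pmono x n"
  by (simp add: pmono_def lookup_add power_add prod.distrib)

lemma pmono_single: "pmono x (single v n) = x v ^ n"
proof -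
  have "pmono x (single v n) = (\<Prod>w\<in>UNIV. if w = v then x w ^ n else 1)"
    unfolding pmono_def by (rule prod.cong) (auto simp: lookup_single when_def)
  then show ?thesis by simp
qed

text \<open>Evaluation at elements of a commutative ring to which \<open>\<iota>\<close> maps the coefficients.
  For \<open>\<iota> = const\<close> it is the substitution of polynomials for the variables.\<close>

definition peval :: "('k::field \<Rightarrow> 'a::comm_ring_1) \<Rightarrow> ('v::finite \<Rightarrow> 'a) \<Rightarrow> ('v, 'k) mpoly \<Rightarrow> 'a" where
  "peval \<iota> x = extend (\<lambda>m c. \<iota> c * pmono x m)"

locale coeff_hom =
  fixes \<iota> :: "'k::field \<Rightarrow> 'a::comm_ring_1"
  assumes hom_0: "\<iota> 0 = 0" and hom_1: "\<iota> 1 = 1"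
    and hom_add: "\<iota> (a + b) = \<iota> a + \<iota> b" and hom_mult: "\<iota> (a * b) = \<iota> a * \<iota> b"
begin

lemma peval_add: "peval \<iota> x (f + g) = peval \<iota> x f + peval \<iota> x g"
  unfolding peval_def by (rule extend_add) (auto simp: hom_0 hom_add algebra_simps)

lemma peval_single: "peval \<iota> x (single m c) = \<iota> c * pmono x m"
  unfolding peval_def by (rule extend_single) (auto simp: hom_0)

lemma peval_zero: "peval \<iota> x 0 = 0"
  by (simp add: peval_def)

lemma peval_mult: "peval \<iota> x (f * g) = peval \<iota> x f * peval \<iota> x g"
proof (induction f rule: poly_mapping_add_induct)
  case (single m c)
  show ?case
    by (induction g rule: poly_mapping_add_induct)
      (auto simp: mult_single peval_single hom_mult pmono_add distrib_left peval_add algebra_simps)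
qed (auto simp: distrib_right peval_add)

lemma peval_one: "peval \<iota> x 1 = 1"
  using peval_single[of x 0 1] by (simp add: hom_1)

lemma peval_const: "peval \<iota> x (const c) = \<iota> c"
  by (simp add: const_def peval_single)

lemma peval_var: "peval \<iota> x (var v) = x v"
  by (simp add: var_def peval_single hom_1 pmono_single)

lemma peval_uminus: "peval \<iota> x (- f) = - peval \<iota> x f"
proof -
  have "peval \<iota> x f + peval \<iota> x (- f) = 0"
    using peval_add[of x f "- f"] by (simp add: peval_zero)
  then show ?thesis by (simp add: add_eq_0_iff)
qed

lemma peval_diff: "peval \<iota> x (f - g) = peval \<iota> x f - peval \<iota> x g"
  using peval_add[of x f "- g"] by (simp add: peval_uminus)

lemma peval_sum: "peval \<iota> x (\<Sum>i\<in>A. f i) = (\<Sum>i\<in>A. peval \<iota> x (f i))"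
  by (induction A rule: infinite_finite_induct) (auto simp: peval_zero peval_add)

lemma peval_prod: "peval \<iota> x (\<Prod>i\<in>A. f i) = (\<Prod>i\<in>A. peval \<iota> x (f i))"
  by (induction A rule: infinite_finite_induct) (auto simp: peval_one peval_mult)

lemma peval_power: "peval \<iota> x (f ^ n) = peval \<iota> x f ^ n"
  by (induction n) (auto simp: peval_one peval_mult)

lemmas peval_simps = peval_add peval_mult peval_zero peval_one peval_const peval_var
  peval_uminus peval_diff peval_sum peval_prod peval_power

end

interpretation ev: coeff_hom "\<lambda>c. c :: 'k::field"
  by unfold_locales auto

lemma evaluate_eq_peval: "evaluate x f = peval (\<lambda>c. c) x f"
  by (simp add: evaluate_def peval_def extend_def pmono_def)

lemma evaluate_simps [simp]:
  "evaluate x (f + g) = evaluate x f + evaluate x g"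
  "evaluate x (f - g) = evaluate x f - evaluate x g"
  "evaluate x (- f) = - evaluate x f"
  "evaluate x (f * g) = evaluate x f * evaluate x g"
  "evaluate x (f ^ n) = evaluate x f ^ n"
  "evaluate x 0 = 0" "evaluate x 1 = 1"
  "evaluate x (const c) = c" "evaluate x (var v) = x v"
  by (simp_all add: evaluate_eq_peval ev.peval_simps)

lemma evaluate_single: "evaluate x (single m c) = c * pmono x m"
  by (simp add: evaluate_eq_peval ev.peval_single)

lemma evaluate_sum: "evaluate x (\<Sum>i\<in>A. f i) = (\<Sum>i\<in>A. evaluate x (f i))"
  by (simp add: evaluate_eq_peval ev.peval_simps)

lemma evaluate_prod: "evaluate x (\<Prod>i\<in>A. f i) = (\<Prod>i\<in>A. evaluate x (f i))"
  by (simp add: evaluate_eq_peval ev.peval_simps)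

lemma const_simps [simp]:
  "const 0 = 0" "const 1 = 1" "const (a + b) = const a + const b"
  "const (a * b) = const a * const b" "const (a - b) = const a - const b" "const (- a) = - const a"
  by (simp_all add: const_def single_add mult_single single_diff single_uminus)

interpretation cst: coeff_hom "const :: 'k::field \<Rightarrow> ('v, 'k) mpoly"
  by unfold_locales auto

lemma single_eq: "single m c = const c * pmono var m"
proof -
  have "pmono var m = single m (1 :: 'b)"
  proof (induction m rule: poly_mapping_add_induct)
    case (single v n)
    have "var v ^ n = single (single v n) (1 :: 'b)"
      by (induction n) (auto simp: var_def mult_single simp flip: single_add)
    then show ?case by (simp add: pmono_single)
  next
    case (add m n)
    then show ?case by (simp add: pmono_add mult_single)
  qed
  then show ?thesis by (simp add: const_def mult_single)
qed

lemma mpoly_induct [case_names const var add mult]: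
  fixes f :: "('v::finite, 'k::field) mpoly"
  assumes const: "\<And>c. P (const c)" and var: "\<And>v. P (var v)"
    and add: "\<And>f g. P f \<Longrightarrow> P g \<Longrightarrow> P (f + g)" and mult: "\<And>f g. P f \<Longrightarrow> P g \<Longrightarrow> P (f * g)"
  shows "P f"
proof (induction f rule: poly_mapping_add_induct)
  case (single m c)
  have one: "P 1" using const[of 1] by simp
  have "P (var v ^ n)" for v n by (induction n) (auto intro: var mult one)
  then have "P (\<Prod>v\<in>A. var v ^ lookup m v)" for A
    by (induction A rule: infinite_finite_induct) (auto intro: mult one)
  then show ?case by (auto simp: single_eq pmono_def intro: mult const)
qed (rule add)

lemma hom_peval:
  assumes "\<And>a b. h (a + b) = h a + h b" "\<And>a b. h (a * b) = h a * h b" "h 1 = 1" "h 0 = 0"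
  shows "h (peval \<iota> x f) = peval (\<lambda>c. h (\<iota> c)) (\<lambda>v. h (x v)) f"
proof -
  have power: "h (a ^ n) = h a ^ n" for a n
    by (induction n) (auto simp: assms)
  have sum: "h (\<Sum>i\<in>A. g i) = (\<Sum>i\<in>A. h (g i))" for A :: "('d \<Rightarrow>\<^sub>0 nat) set" and g
    by (induction A rule: infinite_finite_induct) (auto simp: assms)
  have prod: "h (\<Prod>i\<in>A. g i) = (\<Prod>i\<in>A. h (g i))" for A :: "'d set" and g
    by (induction A rule: infinite_finite_induct) (auto simp: assms)
  show ?thesis
    by (simp add: peval_def extend_def pmono_def sum prod assms power)
qed

lemma evaluate_peval_const:
  "evaluate a (peval const x f) = evaluate (\<lambda>v. evaluate a (x v)) f"
  by (subst hom_peval) (auto simp: evaluate_eq_peval ev.peval_simps)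

section \<open>Gradings\<close>

text \<open>Total degree, degree in \<open>X\<close> and degree in \<open>Y\<close> are treated at once as
  additive functions on exponent vectors.\<close>

locale grading =
  fixes \<delta> :: "('v \<Rightarrow>\<^sub>0 nat) \<Rightarrow> nat"
  assumes deg_add: "\<delta> (m + n) = \<delta> m + \<delta> n"

definition piece :: "(('v \<Rightarrow>\<^sub>0 nat) \<Rightarrow> nat) \<Rightarrow> nat \<Rightarrow> ('v, 'k::field) mpoly set" where
  "piece \<delta> d = {f. \<forall>m\<in>keys f. \<delta> m = d}"

definition hom_component :: "(('v \<Rightarrow>\<^sub>0 nat) \<Rightarrow> nat) \<Rightarrow> nat \<Rightarrow> ('v, 'k::field) mpoly \<Rightarrow> ('v, 'k) mpoly" where
  "hom_component \<delta> d f = Poly_Mapping.mapp (\<lambda>m c. c when \<delta> m = d) f"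

lemma lookup_hom_component: "lookup (hom_component \<delta> d f) m = (lookup f m when \<delta> m = d)"
  by (auto simp: hom_component_def lookup_mapp when_def in_keys_iff)

lemma hom_component_add: "hom_component \<delta> d (f + g) = hom_component \<delta> d f + hom_component \<delta> d g"
  by (rule poly_mapping_eqI) (auto simp: lookup_hom_component lookup_add when_def)

lemma hom_component_zero [simp]: "hom_component \<delta> d 0 = 0"
  by (rule poly_mapping_eqI) (auto simp: lookup_hom_component)

lemma hom_component_sum: "hom_component \<delta> d (\<Sum>i\<in>A. f i) = (\<Sum>i\<in>A. hom_component \<delta> d (f i))"
  by (induction A rule: infinite_finite_induct) (auto simp: hom_component_add)

lemma hom_component_diff: "hom_component \<delta> d (f - g) = hom_component \<delta> d f - hom_component \<delta> d g"
  by (rule poly_mapping_eqI) (auto simp: lookup_hom_component lookup_minus when_def)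

lemma keys_hom_component: "keys (hom_component \<delta> d f) = {m \<in> keys f. \<delta> m = d}"
  by (auto simp: in_keys_iff lookup_hom_component)

lemma hom_component_in_piece: "hom_component \<delta> d f \<in> piece \<delta> d"
  by (auto simp: piece_def keys_hom_component)

lemma hom_component_other_piece: "f \<in> piece \<delta>' e \<Longrightarrow> hom_component \<delta> d f \<in> piece \<delta>' e"
  by (auto simp: piece_def keys_hom_component)

lemma hom_component_of_piece: "f \<in> piece \<delta> e \<Longrightarrow> hom_component \<delta> d f = (if d = e then f else 0)"
  by (rule poly_mapping_eqI) (auto simp: lookup_hom_component piece_def when_def in_keys_iff)

lemma sum_hom_component: "f = (\<Sum>d\<in>\<delta> ` keys f. hom_component \<delta> d f)"
proof (rule poly_mapping_eqI)
  fix m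
  have "(\<Sum>d\<in>\<delta> ` keys f. lookup f m when \<delta> m = d) = (if \<delta> m \<in> \<delta> ` keys f then lookup f m else 0)"
    by (simp add: when_def)
  also have "\<dots> = lookup f m" by (auto simp: in_keys_iff)
  finally show "lookup f m = lookup (\<Sum>d\<in>\<delta> ` keys f. hom_component \<delta> d f) m"
    by (simp add: lookup_sum lookup_hom_component)
qed

lemma piece_zero [simp]: "0 \<in> piece \<delta> d"
  by (simp add: piece_def)

lemma piece_add: "f \<in> piece \<delta> d \<Longrightarrow> g \<in> piece \<delta> d \<Longrightarrow> f + g \<in> piece \<delta> d"
  using keys_add[of f g] by (auto simp: piece_def)

lemma piece_uminus: "f \<in> piece \<delta> d \<Longrightarrow> - f \<in> piece \<delta> d"
  by (auto simp: piece_def in_keys_iff)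

lemma piece_diff: "f \<in> piece \<delta> d \<Longrightarrow> g \<in> piece \<delta> d \<Longrightarrow> f - g \<in> piece \<delta> d"
  using piece_add[of f \<delta> d "- g"] piece_uminus by auto

lemma piece_sum: "(\<And>i. i \<in> A \<Longrightarrow> f i \<in> piece \<delta> d) \<Longrightarrow> (\<Sum>i\<in>A. f i) \<in> piece \<delta> d"
  by (induction A rule: infinite_finite_induct) (auto simp: piece_add)

lemma piece_single: "c = 0 \<or> \<delta> m = d \<Longrightarrow> single m c \<in> piece \<delta> d"
  by (auto simp: piece_def)

context grading
begin

lemma deg_zero [simp]: "\<delta> 0 = 0"
  using deg_add[of 0 0] by simp

lemma piece_mult: "f \<in> piece \<delta> d \<Longrightarrow> g \<in> piece \<delta> e \<Longrightarrow> f * g \<in> piece \<delta> (d + e)"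
  using keys_mult[of f g] by (auto simp: piece_def deg_add)

lemma piece_const: "const c \<in> piece \<delta> 0"
  by (auto simp: const_def piece_def)

lemma piece_var: "var v \<in> piece \<delta> (\<delta> (single v 1))"
  by (auto simp: var_def piece_def)

lemma piece_one: "1 \<in> piece \<delta> 0"
  using piece_const[of 1] by simp

lemma piece_const_mult: "f \<in> piece \<delta> d \<Longrightarrow> const c * f \<in> piece \<delta> d"
  using piece_mult[OF piece_const] by fastforce

lemma piece_prod:
  assumes "\<And>i. i \<in> A \<Longrightarrow> f i \<in> piece \<delta> (d i)"
  shows "(\<Prod>i\<in>A. f i) \<in> piece \<delta> (\<Sum>i\<in>A. d i)"
  using assms
  by (induction A rule: infinite_finite_induct) (auto simp: piece_one intro!: piece_mult)

lemma piece_power: "f \<in> piece \<delta> d \<Longrightarrow> f ^ n \<in> piece \<delta> (n * d)"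
  by (induction n) (auto simp: piece_one intro!: piece_mult)

lemma hom_component_mult_piece:
  assumes "f \<in> piece \<delta> e"
  shows "hom_component \<delta> d (g * f) = (if e \<le> d then hom_component \<delta> (d - e) g * f else 0)"
proof (induction g rule: poly_mapping_add_induct)
  case (single m c)
  have 1: "single m c * f \<in> piece \<delta> (\<delta> m + e)"
    by (rule piece_mult[OF piece_single assms]) auto
  have 2: "single m c \<in> piece \<delta> (\<delta> m)"
    by (rule piece_single) auto
  show ?case
    by (auto simp: hom_component_of_piece[OF 1] hom_component_of_piece[OF 2])
qed (auto simp: hom_component_add distrib_right)

text \<open>It suffices to take the component of degree \<open>d\<close> on both sides of the equation. A
  summand with \<open>e k > d\<close> does not contribute.\<close>

lemma homogeneous_combination:
  assumes "f \<in> piece \<delta> d" "f = (\<Sum>k\<in>A. u k * F k)" "\<And>k. k \<in> A \<Longrightarrow> F k \<in> piece \<delta> (e k)"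
  shows "f = (\<Sum>k\<in>A. (if e k \<le> d then hom_component \<delta> (d - e k) (u k) else 0) * F k)"
proof -
  have "f = hom_component \<delta> d f" using hom_component_of_piece[OF assms(1), of d] by simp
  also have "\<dots> = (\<Sum>k\<in>A. hom_component \<delta> d (u k * F k))" by (simp add: assms(2) hom_component_sum)
  also have "\<dots> = (\<Sum>k\<in>A. (if e k \<le> d then hom_component \<delta> (d - e k) (u k) else 0) * F k)"
    by (rule sum.cong) (auto simp: hom_component_mult_piece[OF assms(3)])
  finally show ?thesis .
qed

end

text \<open>The gradings of the source and the target are independent, so that the lemma covers the
  embeddings of the two blocks of variables as well as the substitution of constants for one block.\<close>

lemma peval_const_piece:
  fixes \<delta> :: "('v::finite \<Rightarrow>\<^sub>0 nat) \<Rightarrow> nat" and \<delta>' :: "('w \<Rightarrow>\<^sub>0 nat) \<Rightarrow> nat"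
  assumes "grading \<delta>" "grading \<delta>'" "\<And>v. x v \<in> piece \<delta>' (\<delta> (single v 1))" "f \<in> piece \<delta> d"
  shows "peval const x f \<in> piece \<delta>' d"
proof -
  interpret grading \<delta> by fact
  interpret d': grading \<delta>' by fact
  have wt: "\<delta> (single v n) = n * \<delta> (single v 1)" for v n
  proof (induction n)
    case (Suc n)
    have "single v (Suc n) = single v 1 + single v n" by (simp flip: single_add)
    then show ?case using Suc by (simp add: deg_add)
  qed simp
  have "pmono x m \<in> piece \<delta>' (\<delta> m)" for m
  proof (induction m rule: poly_mapping_add_induct)
    case (single v n)
    show ?case using d'.piece_power[OF assms(3), of v n] unfolding pmono_single by (subst wt) simp
  qed (auto simp: pmono_add deg_add intro: d'.piece_mult)
  then show ?thesis
    using assms(4) unfolding peval_def extend_def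
    by (intro piece_sum d'.piece_const_mult) (auto simp: piece_def)
qed

definition tdeg :: "('v::finite \<Rightarrow>\<^sub>0 nat) \<Rightarrow> nat" where "tdeg m = (\<Sum>v\<in>UNIV. lookup m v)"

definition degX :: "('a::finite + 'b \<Rightarrow>\<^sub>0 nat) \<Rightarrow> nat" where "degX m = (\<Sum>a\<in>UNIV. lookup m (Inl a))"

definition degY :: "('a + 'b::finite \<Rightarrow>\<^sub>0 nat) \<Rightarrow> nat" where "degY m = (\<Sum>b\<in>UNIV. lookup m (Inr b))"

interpretation tdeg: grading tdeg by unfold_locales (simp add: tdeg_def lookup_add sum.distrib)
interpretation degX: grading degX by unfold_locales (simp add: degX_def lookup_add sum.distrib)
interpretation degY: grading degY by unfold_locales (simp add: degY_def lookup_add sum.distrib)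

lemma hom_piece_eq: "hom_piece i = piece tdeg i"
  by (simp add: hom_piece_def piece_def tdeg_def)

lemma bihom_piece_eq: "bihom_piece i j = piece degX i \<inter> piece degY j"
  by (auto simp: bihom_piece_def piece_def degX_def degY_def)

lemma deg_single [simp]:
  "tdeg (single v n) = n" "degX (single (Inl a) n) = n" "degX (single (Inr b) n) = 0"
  "degY (single (Inl a) n) = 0" "degY (single (Inr b) n) = n"
  by (simp_all add: tdeg_def degX_def degY_def lookup_single when_def)

lemma tdeg_eq: "tdeg m = degX m + degY m"
proof -
  have "UNIV = (Inl ` UNIV :: ('a + 'b) set) \<union> Inr ` UNIV" by (rule UNIV_sum)
  then have "tdeg m = (\<Sum>v\<in>Inl ` UNIV \<union> Inr ` UNIV. lookup m v)" by (simp add: tdeg_def)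
  also have "\<dots> = degX m + degY m"
    by (subst sum.union_disjoint) (auto simp: degX_def degY_def sum.reindex)
  finally show ?thesis .
qed

section \<open>Partial derivatives\<close>

lemma partial_deriv_eq: "partial_deriv v = extend (\<lambda>m c. single (m - single v 1) (of_nat (lookup m v) * c))"
  by (rule ext) (simp add: partial_deriv_def extend_def)

lemma partial_deriv_add: "partial_deriv v (f + g) = partial_deriv v f + partial_deriv v g"
  unfolding partial_deriv_eq by (rule extend_add) (auto simp: distrib_left single_add)

lemma partial_deriv_single:
  "partial_deriv v (single m c) = single (m - single v 1) (of_nat (lookup m v) * c)"
  unfolding partial_deriv_eq by (rule extend_single) auto

lemma partial_deriv_mult:
  "partial_deriv v (f * g) = partial_deriv v f * g + f * partial_deriv v g"
proof (induction f rule: poly_mapping_add_induct)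
  case (single m c)
  show ?case
  proof (induction g rule: poly_mapping_add_induct)
    case (single n d)
    have 1: "single (m - single v 1 + n) (of_nat (lookup m v) * c * d)
      = single (m + n - single v 1) (of_nat (lookup m v) * c * d)"
    proof (cases "lookup m v = 0")
      case False
      then have "m - single v 1 + n = m + n - single v 1"
        by (intro poly_mapping_eqI) (auto simp: lookup_add lookup_minus lookup_single when_def)
      then show ?thesis by simp
    qed simp
    have 2: "single (m + (n - single v 1)) (c * (of_nat (lookup n v) * d))
      = single (m + n - single v 1) (c * (of_nat (lookup n v) * d))"
    proof (cases "lookup n v = 0")
      case False
      then have "m + (n - single v 1) = m + n - single v 1"
        by (intro poly_mapping_eqI) (auto simp: lookup_add lookup_minus lookup_single when_def)
      then show ?thesis by simp
    qed simp
    show ?case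
      unfolding mult_single partial_deriv_single 1 2 single_add[symmetric]
      by (simp add: lookup_add algebra_simps)
  qed (auto simp: distrib_left partial_deriv_add algebra_simps)
qed (auto simp: distrib_right partial_deriv_add algebra_simps)

lemma partial_deriv_const [simp]: "partial_deriv v (const c) = 0"
  by (simp add: const_def partial_deriv_single)

lemma partial_deriv_var [simp]: "partial_deriv v (var w) = (if v = w then 1 else 0)"
  by (auto simp: var_def partial_deriv_single lookup_single when_def)

lemma partial_deriv_zero [simp]: "partial_deriv v 0 = 0"
  by (simp add: partial_deriv_eq)

lemma partial_deriv_sum: "partial_deriv v (\<Sum>i\<in>A. f i) = (\<Sum>i\<in>A. partial_deriv v (f i))"
  by (induction A rule: infinite_finite_induct) (auto simp: partial_deriv_add)

section \<open>Linear algebra\<close>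

lemma (in vector_space) independent_span_Int:
  assumes "independent B" "A \<subseteq> B" "x \<in> span A" "x \<in> span (B - A)"
  shows "x = 0"
proof -
  have 1: "representation B x = representation A x"
    by (rule representation_extend) (use assms in auto)
  have 2: "representation B x = representation (B - A) x"
    by (rule representation_extend) (use assms in auto)
  have "representation B x b = 0" for b
    using 1 2 representation_ne_zero[of A x b] representation_ne_zero[of "B - A" x b] by fastforce
  then show "x = 0"
    using sum_nonzero_representation_eq[OF assms(1), of x] span_mono[OF assms(2)] assms(3)
    by (simp add: subset_iff)
qed

text \<open>The projection along \<open>U\<close> onto a complement. It replaces the quotient by
  \<open>U\<close>.\<close>

lemma (in vector_space) exists_linear_with_kernel:
  assumes "subspace U"
  shows "\<exists>L. Vector_Spaces.linear scale scale L \<and> (\<forall>x. L x = 0 \<longleftrightarrow> x \<in> U)"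
proof -
  interpret vector_space_pair scale scale by unfold_locales
  obtain A where A: "A \<subseteq> U" "independent A" "U \<subseteq> span A"
    using maximal_independent_subset by blast
  have spanA: "span A = U"
    using A assms by (simp add: subset_antisym span_minimal)
  obtain B where B: "A \<subseteq> B" "independent B" "span B = UNIV"
    using maximal_independent_subset_extend[of A UNIV] A by (metis subset_UNIV top.extremum_uniqueI)
  define L where "L = construct B (\<lambda>b. if b \<in> A then 0 else b)"
  have L: "Vector_Spaces.linear scale scale L" unfolding L_def by (rule linear_construct[OF B(2)])
  interpret L: Vector_Spaces.linear scale scale L by (rule L)
  have LB: "L b = (if b \<in> A then 0 else b)" if "b \<in> B" for b
    unfolding L_def using that by (rule construct_basis[OF B(2)])
  have diff: "x - L x \<in> U" for x
  proof -
    have "x \<in> span B" using B by auto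
    then show ?thesis
    proof (induction rule: span_induct_alt)
      case base
      then show ?case using assms by (simp add: subspace_0)
    next
      case (step c b y)
      have "b - L b \<in> U"
        using LB[OF step(1)] A assms by (auto simp: subspace_0)
      then have "scale c (b - L b) + (y - L y) \<in> U"
        using assms step by (auto intro!: subspace_add subspace_scale)
      then show ?case by (simp add: L.add L.scale algebra_simps)
    qed
  qed
  have "L x = 0" if "x \<in> U" for x
  proof -
    have "x \<in> span A" using that spanA by simp
    then show ?thesis
    proof (induction rule: span_induct_alt)
      case (step c b y)
      then show ?case using LB[of b] B by (auto simp: L.add L.scale)
    qed simp
  qed
  then have "L x = 0 \<longleftrightarrow> x \<in> U" for x using diff[of x] by auto
  then show ?thesis using L by blast
qed

lemma (in vector_space_pair) rank_nullity:
  assumes f: "Vector_Spaces.linear s1 s2 f" and V: "vs1.subspace V" and T: "V \<subseteq> vs1.span T" "finite T"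
  shows "vs1.dim V = vs2.dim (f ` V) + vs1.dim {x \<in> V. f x = 0}"
proof -
  interpret f: Vector_Spaces.linear s1 s2 f by fact
  define N where "N = {x \<in> V. f x = 0}"
  obtain A where A: "A \<subseteq> N" "vs1.independent A" "N \<subseteq> vs1.span A"
    using vs1.maximal_independent_subset by blast
  obtain B where B: "A \<subseteq> B" "B \<subseteq> V" "vs1.independent B" "V \<subseteq> vs1.span B"
    using vs1.maximal_independent_subset_extend[of A V] A N_def by blast
  have fin: "finite B"
    using vs1.independent_span_bound[OF T(2) B(3)] B(2) T(1) by blast
  have dimV: "vs1.dim V = card B" using B by (intro vs1.dim_unique) auto
  have dimN: "vs1.dim N = card A" using A by (intro vs1.dim_unique) auto
  have spanBA: "vs1.span (B - A) \<subseteq> V" using B V by (intro vs1.span_minimal) auto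
  have inj: "inj_on f (vs1.span (B - A))"
  proof (rule inj_onI)
    fix x y assume xy: "x \<in> vs1.span (B - A)" "y \<in> vs1.span (B - A)" "f x = f y"
    then have 1: "x - y \<in> vs1.span (B - A)" by (simp add: vs1.span_diff)
    then have "x - y \<in> N" using spanBA xy by (auto simp: N_def f.diff)
    then have "x - y \<in> vs1.span A" using A by auto
    then show "x = y" using vs1.independent_span_Int[OF B(3) B(1) _ 1] by simp
  qed
  have ind: "vs2.independent (f ` (B - A))"
    using vs1.independent_mono[OF B(3)] inj f by (intro linear_independent_injective_image) auto
  have "f ` V \<subseteq> vs2.span (f ` (B - A))"
  proof
    fix y assume "y \<in> f ` V"
    then obtain x where "x \<in> vs1.span B" "y = f x" using B by auto
    then have "y \<in> vs2.span (f ` B)" using f.span_image by auto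
    also have "f ` B \<subseteq> vs2.span (f ` (B - A))"
    proof
      fix y assume "y \<in> f ` B"
      then obtain b where "b \<in> B" "y = f b" by auto
      then show "y \<in> vs2.span (f ` (B - A))"
        using A by (cases "b \<in> A") (auto simp: N_def vs2.span_zero intro: vs2.span_base)
    qed
    then have "vs2.span (f ` B) \<subseteq> vs2.span (f ` (B - A))"
      by (intro vs2.span_minimal) auto
    finally show "y \<in> vs2.span (f ` (B - A))" .
  qed
  then have "vs2.dim (f ` V) = card (f ` (B - A))"
    using ind B by (intro vs2.dim_unique) auto
  also have "\<dots> = card (B - A)"
    using inj by (intro card_image) (auto simp: inj_on_def vs1.span_base)
  finally have "vs2.dim (f ` V) = card B - card A"
    using fin B by (simp add: card_Diff_subset finite_subset)
  then show ?thesis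
    using dimV dimN card_mono[OF fin B(1)] by (simp add: N_def)
qed

text \<open>Scalars act on polynomials as constant polynomials, so that ideals are subspaces.\<close>

interpretation mp: vector_space "\<lambda>(c::'k::field) (f :: ('v, 'k) mpoly). const c * f"
  by unfold_locales (auto simp: algebra_simps)

interpretation fv: vector_space "\<lambda>(c::'k::field) (f :: 'p \<Rightarrow> 'k). (\<lambda>x. c * f x)"
  by unfold_locales (auto simp: algebra_simps fun_eq_iff)

interpretation mpfv: vector_space_pair "\<lambda>(c::'k::field) (f :: ('v, 'k) mpoly). const c * f"
  "\<lambda>(c::'k::field) (f :: 'p \<Rightarrow> 'k). (\<lambda>x. c * f x)"
  by unfold_locales

interpretation mpmp: vector_space_pair "\<lambda>(c::'k::field) (f :: ('v, 'k) mpoly). const c * f"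
  "\<lambda>(c::'k::field) (f :: ('v, 'k) mpoly). const c * f"
  by unfold_locales

interpretation fvfv: vector_space_pair "\<lambda>(c::'k::field) (f :: 'p \<Rightarrow> 'k). (\<lambda>x. c * f x)"
  "\<lambda>(c::'k::field) (f :: 'q \<Rightarrow> 'k). (\<lambda>x. c * f x)"
  by unfold_locales

section \<open>Ideals and residue classes\<close>

text \<open>An ideal is a submodule of the ring acting on itself. Generated ideals thus inherit the
  induction rules of spans, and \<open>genideal_eq\<close> translates the carrier-based notion into
  this one.\<close>

interpretation idl: Modules.module "(*) :: 'a::comm_ring_1 \<Rightarrow> 'a \<Rightarrow> 'a"
  by unfold_locales (auto simp: algebra_simps)

abbreviation ideal_span :: "'a::comm_ring_1 set \<Rightarrow> 'a set" where
  "ideal_span \<equiv> Modules.module.span (*)"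

abbreviation is_ideal :: "'a::comm_ring_1 set \<Rightarrow> bool" where
  "is_ideal \<equiv> Modules.module.subspace (*)"

abbreviation type_ring :: "'a::comm_ring_1 ring" where
  "type_ring \<equiv> ring_of_type_algebra"

lemma type_ring_simps [simp]:
  "carrier type_ring = UNIV" "x \<otimes>\<^bsub>type_ring\<^esub> y = x * y" "x \<oplus>\<^bsub>type_ring\<^esub> y = x + y"
  "\<zero>\<^bsub>type_ring\<^esub> = 0" "\<one>\<^bsub>type_ring\<^esub> = 1"
  by (simp_all add: ring_of_type_algebra_def)

interpretation type_ring: cring "type_ring :: 'a::comm_ring_1 ring"
  by (rule cring_from_type_algebra)

lemma is_ideal_iff:
  fixes I :: "'a::comm_ring_1 set"
  shows "ideal I type_ring \<longleftrightarrow> is_ideal I"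
proof
  assume "ideal I type_ring"
  then interpret ideal I type_ring .
  have "c * x \<in> I" if "x \<in> I" for c x using I_l_closed[OF that, of c] by simp
  moreover have "0 \<in> I" using zero_closed by simp
  moreover have "x + y \<in> I" if "x \<in> I" "y \<in> I" for x y using a_closed[OF that] by simp
  ultimately show "is_ideal I" unfolding idl.subspace_def by blast
next
  assume I: "is_ideal I"
  show "ideal I type_ring"
  proof (rule idealI)
    show "ring type_ring" ..
    show "subgroup I (add_monoid type_ring)"
    proof (rule type_ring.add.subgroupI)
      show "I \<noteq> {}" using I idl.subspace_0 by blast
      fix a assume "a \<in> I"
      have "\<ominus>\<^bsub>type_ring\<^esub> a = - a"
        by (rule type_ring.minus_equality) auto
      then show "\<ominus>\<^bsub>type_ring\<^esub> a \<in> I" using idl.subspace_neg[OF I \<open>a \<in> I\<close>] by simp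
    qed (use I in \<open>auto simp: idl.subspace_add\<close>)
    fix a x :: 'a assume "a \<in> I"
    then show "x \<otimes>\<^bsub>type_ring\<^esub> a \<in> I" "a \<otimes>\<^bsub>type_ring\<^esub> x \<in> I"
      using idl.subspace_scale[OF I, of a x] by (simp_all add: mult.commute)
  qed
qed

lemma genideal_eq: "Idl\<^bsub>type_ring\<^esub> G = ideal_span G"
proof
  show "Idl\<^bsub>type_ring\<^esub> G \<subseteq> ideal_span G"
    by (rule type_ring.genideal_minimal) (auto simp: is_ideal_iff idl.span_base)
  have "is_ideal (Idl\<^bsub>type_ring\<^esub> G)"
    using type_ring.genideal_ideal[of G] by (simp add: is_ideal_iff)
  then show "ideal_span G \<subseteq> Idl\<^bsub>type_ring\<^esub> G"
    using type_ring.genideal_self[of G] by (intro idl.span_minimal) auto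
qed

lemma ideal_span_image:
  assumes "finite A"
  shows "f \<in> ideal_span (F ` A) \<longleftrightarrow> (\<exists>u. f = (\<Sum>k\<in>A. u k * F k))"
proof
  assume "f \<in> ideal_span (F ` A)"
  then show "\<exists>u. f = (\<Sum>k\<in>A. u k * F k)"
  proof (induction rule: idl.span_induct_alt)
    case base
    show ?case by (rule exI[of _ "\<lambda>_. 0"]) simp
  next
    case (step c x y)
    then obtain k u where k: "k \<in> A" "x = F k" "y = (\<Sum>k\<in>A. u k * F k)" by auto
    have "c * x = (\<Sum>l\<in>A. (if l = k then c else 0) * F l)"
      using k assms by (simp add: if_distrib[of "\<lambda>x. x * _"] cong: if_cong)
    then show ?case
      by (intro exI[of _ "\<lambda>l. (if l = k then c else 0) + u l"])
        (simp add: k sum.distrib distrib_right)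
  qed
next
  assume "\<exists>u. f = (\<Sum>k\<in>A. u k * F k)"
  then obtain u where "f = (\<Sum>k\<in>A. u k * F k)" by blast
  moreover have "u k * F k \<in> ideal_span (F ` A)" if "k \<in> A" for k
    using that by (intro idl.span_scale idl.span_base imageI)
  ultimately show "f \<in> ideal_span (F ` A)" by (simp add: idl.span_sum)
qed

lemma residue_of_eq_iff:
  assumes "is_ideal I"
  shows "residue_of I f = residue_of I g \<longleftrightarrow> f - g \<in> I"
proof -
  have res: "residue_of I h = {x. x - h \<in> I}" for h
  proof -
    have "residue_of I h = (\<Union>x\<in>I. {x + h})"
      by (simp add: residue_of_def a_r_coset_def')
    also have "\<dots> = {x. x - h \<in> I}"
    proof (intro equalityI subsetI)
      fix x assume "x \<in> {x. x - h \<in> I}"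
      then show "x \<in> (\<Union>x\<in>I. {x + h})" by (intro UN_I[of "x - h"]) auto
    qed auto
    finally show ?thesis .
  qed
  show ?thesis
  proof
    assume "residue_of I f = residue_of I g"
    moreover have "f \<in> residue_of I f" by (simp add: res idl.subspace_0[OF assms])
    ultimately have "f \<in> residue_of I g" by simp
    then show "f - g \<in> I" by (simp add: res)
  next
    assume fg: "f - g \<in> I"
    have "x - f \<in> I \<longleftrightarrow> x - g \<in> I" for x
      using idl.subspace_add[OF assms fg, of "x - f"] idl.subspace_diff[OF assms _ fg, of "x - g"]
      by (auto simp: algebra_simps)
    then show "residue_of I f = residue_of I g" by (simp add: res)
  qed
qed

lemma residue_ring:
  fixes I :: "('v, 'k::field) mpoly set"
  assumes "is_ideal I"
  shows "cring (residue_ring_of I)"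
    and "carrier (residue_ring_of I) = range (residue_of I)"
    and "residue_of I f \<otimes>\<^bsub>residue_ring_of I\<^esub> residue_of I g = residue_of I (f * g)"
    and "residue_of I f \<oplus>\<^bsub>residue_ring_of I\<^esub> residue_of I g = residue_of I (f + g)"
    and "\<zero>\<^bsub>residue_ring_of I\<^esub> = residue_of I 0"
    and "\<one>\<^bsub>residue_ring_of I\<^esub> = residue_of I 1"
proof -
  interpret ideal I "type_ring" using assms by (simp add: is_ideal_iff)
  show "cring (residue_ring_of I)"
    unfolding residue_ring_of_def by (rule quotient_is_cring) unfold_locales
  show "carrier (residue_ring_of I) = range (residue_of I)"
    by (auto simp: residue_ring_of_def FactRing_def A_RCOSETS_def' residue_of_def)
  show "residue_of I f \<otimes>\<^bsub>residue_ring_of I\<^esub> residue_of I g = residue_of I (f * g)"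
    using rcoset_mult_add[of f g] by (simp add: residue_ring_of_def residue_of_def FactRing_def)
  show "residue_of I f \<oplus>\<^bsub>residue_ring_of I\<^esub> residue_of I g = residue_of I (f + g)"
    using a_rcos_sum[of f g] by (simp add: residue_ring_of_def residue_of_def FactRing_def)
  have "0 \<in> I" using assms by (rule idl.subspace_0)
  then show "\<zero>\<^bsub>residue_ring_of I\<^esub> = residue_of I 0"
    using a_rcos_const[of 0] by (simp add: residue_ring_of_def residue_of_def FactRing_def)
  show "\<one>\<^bsub>residue_ring_of I\<^esub> = residue_of I 1"
    by (simp add: residue_ring_of_def residue_of_def FactRing_def)
qed

text \<open>Ideals of the residue ring correspond to the ideals containing \<open>I\<close>. Each
  inclusion follows from the minimality of one of the two generated ideals.\<close>

lemma residue_genideal: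
  assumes I: "is_ideal I"
  shows "residue_of I f \<in> Idl\<^bsub>residue_ring_of I\<^esub> (residue_of I ` G) \<longleftrightarrow> f \<in> ideal_span (I \<union> G)"
proof -
  interpret Q: cring "residue_ring_of I" using residue_ring(1)[OF I] .
  note Q = residue_ring[OF I]
  define J where "J = Idl\<^bsub>residue_ring_of I\<^esub> (residue_of I ` G)"
  have sub: "residue_of I ` G \<subseteq> carrier (residue_ring_of I)" by (auto simp: Q)
  interpret J: ideal J "residue_ring_of I"
    unfolding J_def using sub by (rule Q.genideal_ideal)
  have "is_ideal {f. residue_of I f \<in> J}"
  proof (rule idl.subspaceI)
    show "0 \<in> {f. residue_of I f \<in> J}" using J.zero_closed by (simp add: Q)
    show "x + y \<in> {f. residue_of I f \<in> J}" if "x \<in> {f. residue_of I f \<in> J}" "y \<in> {f. residue_of I f \<in> J}" for x y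
      using J.a_closed[of "residue_of I x" "residue_of I y"] that by (simp add: Q)
    show "c * x \<in> {f. residue_of I f \<in> J}" if "x \<in> {f. residue_of I f \<in> J}" for c x
      using J.I_l_closed[of "residue_of I x" "residue_of I c"] that by (simp add: Q)
  qed
  moreover have "x \<in> {f. residue_of I f \<in> J}" if "x \<in> I \<union> G" for x
  proof (cases "x \<in> I")
    case True
    then have "residue_of I x = residue_of I 0" by (simp add: residue_of_eq_iff[OF I])
    then show ?thesis using J.zero_closed by (simp add: Q)
  next
    case False
    then show ?thesis using that Q.genideal_self[OF sub] by (auto simp: J_def)
  qed
  ultimately have 1: "ideal_span (I \<union> G) \<subseteq> {f. residue_of I f \<in> J}"
    by (intro idl.span_minimal) auto
  define J' where "J' = residue_of I ` ideal_span (I \<union> G)"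
  have "ideal J' (residue_ring_of I)"
  proof (rule idealI)
    show "ring (residue_ring_of I)" ..
    show "subgroup J' (add_monoid (residue_ring_of I))"
    proof (rule Q.add.subgroupI)
      show "J' \<subseteq> carrier (residue_ring_of I)" by (auto simp: Q J'_def)
      show "J' \<noteq> {}" using idl.span_zero by (auto simp: J'_def)
      fix a assume "a \<in> J'"
      then obtain x where x: "x \<in> ideal_span (I \<union> G)" "a = residue_of I x" by (auto simp: J'_def)
      have "\<ominus>\<^bsub>residue_ring_of I\<^esub> a = residue_of I (- x)"
        by (rule Q.minus_equality) (auto simp: Q x)
      then show "\<ominus>\<^bsub>residue_ring_of I\<^esub> a \<in> J'"
        using x by (auto simp: J'_def intro!: imageI idl.span_neg)
      fix b assume "b \<in> J'"
      then obtain y where y: "y \<in> ideal_span (I \<union> G)" "b = residue_of I y" by (auto simp: J'_def)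
      show "a \<oplus>\<^bsub>residue_ring_of I\<^esub> b \<in> J'"
        using x y by (auto simp: J'_def Q intro!: imageI idl.span_add)
    qed
    fix a x assume "a \<in> J'" "x \<in> carrier (residue_ring_of I)"
    then obtain f g where "f \<in> ideal_span (I \<union> G)" "a = residue_of I f" "x = residue_of I g"
      by (auto simp: J'_def Q)
    then show "x \<otimes>\<^bsub>residue_ring_of I\<^esub> a \<in> J'" "a \<otimes>\<^bsub>residue_ring_of I\<^esub> x \<in> J'"
      using idl.span_scale[of f "I \<union> G" g] by (auto simp: J'_def Q mult.commute)
  qed
  moreover have "residue_of I ` G \<subseteq> J'" by (auto simp: J'_def idl.span_base)
  ultimately have "J \<subseteq> J'" unfolding J_def by (rule Q.genideal_minimal)
  then have "f \<in> ideal_span (I \<union> G)" if resJ: "residue_of I f \<in> J"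
  proof -
    obtain g where "g \<in> ideal_span (I \<union> G)" "residue_of I f = residue_of I g"
      using subsetD[OF \<open>J \<subseteq> J'\<close> resJ[folded J_def]] unfolding J'_def by (elim imageE)
    moreover from this have "f - g \<in> ideal_span (I \<union> G)"
      using idl.span_base[of "f - g" "I \<union> G"] by (simp add: residue_of_eq_iff[OF I])
    ultimately show ?thesis using idl.span_add[of "f - g" "I \<union> G" g] by simp
  qed
  then show ?thesis using 1 by (auto simp: J_def)
qed

text \<open>Both \<open>ev\<close> and the residue map have the kernel \<open>I\<close> on
  \<open>V\<close>. So a basis of \<open>ev ` V\<close>, lifted along \<open>ev\<close>, has residue
  classes that form a basis of the piece of the residue ring.\<close>

lemma residue_dim:
  fixes I :: "('v, 'k::field) mpoly set" and ev :: "('v, 'k) mpoly \<Rightarrow> 'p \<Rightarrow> 'k"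
  assumes I: "is_ideal I" "1 \<notin> I"
    and ev: "Vector_Spaces.linear (\<lambda>c f. const c * f) (\<lambda>c f x. c * f x) ev"
    and V: "mp.subspace V" "\<And>f. f \<in> V \<Longrightarrow> ev f = 0 \<longleftrightarrow> f \<in> I"
    and T: "ev ` V \<subseteq> fv.span T" "finite T"
  shows "ring.dim (residue_ring_of I) (range (\<lambda>c. residue_of I (const c))) (residue_of I ` V)
    = fv.dim (ev ` V)"
proof -
  interpret ev: Vector_Spaces.linear "\<lambda>c f. const c * f" "\<lambda>c f x. c * f x" ev by (rule ev)
  interpret Q: cring "residue_ring_of I" using residue_ring(1)[OF I(1)] .
  note Q = residue_ring[OF I(1)]
  note res_eq = residue_of_eq_iff[OF I(1)]
  define K where "K = range (\<lambda>c :: 'k. residue_of I (const c))"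
  have "(\<lambda>c. residue_of I (const c)) \<in> ring_hom (type_ring :: 'k ring) (residue_ring_of I)"
    by (rule ring_hom_memI) (auto simp: Q)
  then interpret h: ring_hom_ring "type_ring :: 'k ring" "residue_ring_of I" "\<lambda>c. residue_of I (const c)"
    by (intro ring_hom_ringI2) unfold_locales
  have "field (type_ring :: 'k ring)" by (rule field_from_type_algebra)
  then have "subfield UNIV (type_ring :: 'k ring)" using field.carrier_is_subfield by fastforce
  moreover have "\<one>\<^bsub>residue_ring_of I\<^esub> \<noteq> \<zero>\<^bsub>residue_ring_of I\<^esub>" using I(2) by (simp add: Q res_eq)
  ultimately have K: "subfield K (residue_ring_of I)"
    unfolding K_def using h.img_is_subfield(2) by blast
  have Span: "Q.Span K (map (residue_of I) us) = residue_of I ` mp.span (set us)" for us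
  proof (induction us)
    case Nil
    show ?case by (simp add: Q)
  next
    case (Cons u us)
    have "Q.line_extension K (residue_of I u) (residue_of I ` mp.span (set us))
      = residue_of I ` {const c * u + v | c v. v \<in> mp.span (set us)}"
    proof (intro equalityI subsetI)
      fix r assume "r \<in> Q.line_extension K (residue_of I u) (residue_of I ` mp.span (set us))"
      then obtain c v where cv: "v \<in> mp.span (set us)" "r = residue_of I (const c * u + v)"
        by (auto simp: Q.line_extension_mem_iff K_def Q)
      then show "r \<in> residue_of I ` {const c * u + v | c v. v \<in> mp.span (set us)}" by blast
    next
      fix r assume "r \<in> residue_of I ` {const c * u + v | c v. v \<in> mp.span (set us)}"
      then obtain c v where cv: "v \<in> mp.span (set us)" "r = residue_of I (const c * u + v)"
        by blast
      have "r = residue_of I (const c) \<otimes>\<^bsub>residue_ring_of I\<^esub> residue_of I u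
          \<oplus>\<^bsub>residue_ring_of I\<^esub> residue_of I v"
        by (simp add: Q cv)
      then show "r \<in> Q.line_extension K (residue_of I u) (residue_of I ` mp.span (set us))"
        unfolding Q.line_extension_mem_iff K_def using cv by blast
    qed
    also have "{const c * u + v | c v. v \<in> mp.span (set us)} = mp.span (set (u # us))"
    proof (intro equalityI subsetI)
      fix f assume "f \<in> mp.span (set (u # us))"
      then obtain c where "f - const c * u \<in> mp.span (set us)"
        by (auto simp: mp.span_insert)
      then show "f \<in> {const c * u + v | c v. v \<in> mp.span (set us)}"
        by (intro CollectI exI[of _ c] exI[of _ "f - const c * u"]) simp
    next
      fix f assume "f \<in> {const c * u + v | c v. v \<in> mp.span (set us)}"
      then obtain c v where cv: "f = const c * u + v" "v \<in> mp.span (set us)" by blast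
      then have "f - const c * u \<in> mp.span (set us)" by simp
      then show "f \<in> mp.span (set (u # us))"
        unfolding list.set(2) mp.span_insert by blast
    qed
    finally have 1: "Q.line_extension K (residue_of I u) (residue_of I ` mp.span (set us))
      = residue_of I ` mp.span (set (u # us))" .
    have "Q.Span K (map (residue_of I) (u # us))
      = Q.line_extension K (residue_of I u) (Q.Span K (map (residue_of I) us))" by simp
    then show ?case unfolding Cons.IH 1 .
  qed
  obtain B where B: "B \<subseteq> ev ` V" "fv.independent B" "ev ` V \<subseteq> fv.span B"
    using fv.maximal_independent_subset by blast
  have finB: "finite B" using fv.independent_span_bound[OF T(2) B(2)] B(1) T(1) by blast
  have "\<exists>f. f \<in> V \<and> ev f = b" if "b \<in> B" for b
    using subsetD[OF B(1) that] by blast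
  then obtain lft where lft: "\<And>b. b \<in> B \<Longrightarrow> lft b \<in> V" "\<And>b. b \<in> B \<Longrightarrow> ev (lft b) = b"
    by metis
  have ev_lft: "ev ` lft ` A = A" if "A \<subseteq> B" for A
  proof -
    have "ev ` lft ` A = (\<lambda>b. b) ` A"
      unfolding image_image by (rule image_cong) (use that lft(2) in blast)+
    then show ?thesis by simp
  qed
  obtain bs where bs: "set bs = B" "distinct bs" using finB finite_distinct_list by blast
  have in_V: "f \<in> V" if "f \<in> mp.span (lft ` A)" "A \<subseteq> B" for f A
    using mp.span_minimal[OF _ V(1), of "lft ` A"] lft(1) that by auto
  have ind: "Q.independent K (map (residue_of I) (map lft cs))"
    if "set cs \<subseteq> B" "distinct cs" for cs
    using that
  proof (induction cs)
    case (Cons c cs)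
    have "residue_of I (lft c) \<notin> Q.Span K (map (residue_of I) (map lft cs))"
    proof
      assume "residue_of I (lft c) \<in> Q.Span K (map (residue_of I) (map lft cs))"
      then obtain g where g: "g \<in> mp.span (lft ` set cs)" "lft c - g \<in> I"
        unfolding Span by (auto simp: res_eq)
      have "g \<in> V" using in_V[OF g(1)] Cons by auto
      then have "ev (lft c - g) = 0"
        using V g(2) lft(1)[of c] Cons by (simp add: mp.subspace_diff)
      then have "c = ev g" using lft(2)[of c] Cons by (simp add: ev.diff)
      also have "ev g \<in> fv.span (ev ` lft ` set cs)" using g(1) ev.span_image by blast
      also have "ev ` lft ` set cs = set cs"
        using Cons ev_lft by simp
      finally show False
        using Cons B(2) fv.independent_mono[of B "set (c # cs)"]
        by (simp add: fv.independent_insert)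
    qed
    then show ?case using Cons by (auto simp: Q intro!: Q.li_Cons)
  qed simp
  have "residue_of I ` V = residue_of I ` mp.span (lft ` B)"
  proof (intro equalityI subsetI)
    fix r assume "r \<in> residue_of I ` V"
    then obtain f where f: "f \<in> V" "r = residue_of I f" by auto
    have "ev f \<in> fv.span B" using B f by auto
    also have "B = ev ` lft ` B" using ev_lft by simp
    finally have "ev f \<in> ev ` mp.span (lft ` B)" using ev.span_image by blast
    then obtain g where g: "g \<in> mp.span (lft ` B)" "ev f = ev g" by auto
    have "f - g \<in> I"
      using V(2)[of "f - g"] in_V[OF g(1)] f g by (auto simp: ev.diff mp.subspace_diff[OF V(1)])
    then show "r \<in> residue_of I ` mp.span (lft ` B)" using f g by (auto simp: res_eq intro!: image_eqI[of _ _ g])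
  qed (use in_V in auto)
  also have "\<dots> = Q.Span K (map (residue_of I) (map lft bs))" using bs by (simp only: Span) simp
  finally have "Q.dimension (length bs) K (residue_of I ` V)"
    using Q.dimension_independent[OF ind[of bs]] bs by simp
  then have "Q.dim K (residue_of I ` V) = length bs"
    using Q.dimI[OF K] by (simp add: over_def)
  also have "length bs = fv.dim (ev ` V)"
    using bs B fv.basis_card_eq_dim[of B "ev ` V"] distinct_card[of bs] by simp
  finally show ?thesis by (simp add: K_def)
qed

section \<open>Determinants over commutative rings\<close>

lemma hom_det:
  fixes A :: "'a::comm_ring_1^'n^'n" and h :: "'a \<Rightarrow> 'b::comm_ring_1"
  assumes "\<And>a b. h (a + b) = h a + h b" "\<And>a b. h (a * b) = h a * h b" "h 1 = 1" "h 0 = 0"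
  shows "h (det A) = det (\<chi> i j. h (A $ i $ j))"
proof -
  have sum: "h (\<Sum>i\<in>S. g i) = (\<Sum>i\<in>S. h (g i))" for S :: "('n \<Rightarrow> 'n) set" and g
    by (induction S rule: infinite_finite_induct) (auto simp: assms)
  have prod: "h (\<Prod>i\<in>S. g i) = (\<Prod>i\<in>S. h (g i))" for S :: "'n set" and g
    by (induction S rule: infinite_finite_induct) (auto simp: assms)
  have uminus: "h (- a) = - h a" for a
    using assms(1)[of a "- a"] by (simp add: assms(4) add_eq_0_iff)
  have sgn: "h (of_int (sign p)) = of_int (sign p)" for p :: "'n \<Rightarrow> 'n"
  proof (cases "sign p = 1")
    case True
    then show ?thesis by (simp add: assms)
  next
    case False
    then have "sign p = -1" using sign_cases[of p] by blast
    then show ?thesis using uminus[of 1] by (simp add: assms)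
  qed
  show ?thesis by (simp add: det_def sum prod assms sgn)
qed

text \<open>Cramer's rule: \<open>det A * y c\<close> is the determinant of \<open>A\<close> with column
  \<open>c\<close> replaced by the vector \<open>A y\<close>, whose entries lie in
  \<open>J\<close>.\<close>

lemma det_mult_in_ideal:
  fixes A :: "'a::comm_ring_1^'n^'n"
  assumes J: "is_ideal J" and w: "\<And>i. (\<Sum>j\<in>UNIV. A $ i $ j * y j) \<in> J"
  shows "det A * y c \<in> J"
proof -
  define w where "w = (\<lambda>i. \<Sum>j\<in>UNIV. A $ i $ j * y j)"
  \<comment> \<open>Transposed, so that the replaced column becomes a row.\<close>
  define N where "N = transpose A"
  define B where "B = (\<chi> i. if i = c then (\<Sum>j\<in>UNIV. y j *s row j N) else row i N)"
  have "det B = (\<Sum>j\<in>UNIV. det (\<chi> i. if i = c then y j *s row j N else row i N))"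
    unfolding B_def by (rule det_linear_row_sum) simp
  also have "\<dots> = (\<Sum>j\<in>UNIV. y j * det (\<chi> i. if i = c then row j N else row i N))"
    by (simp add: det_row_mul)
  also have "\<dots> = (\<Sum>j\<in>UNIV. if j = c then y j * det N else 0)"
  proof (rule sum.cong)
    fix j
    show "y j * det (\<chi> i. if i = c then row j N else row i N) = (if j = c then y j * det N else 0)"
    proof (cases "j = c")
      case True
      have N: "(\<chi> i. if i = c then row c N else row i N) = N"
        by (simp add: vec_eq_iff row_def)
      show ?thesis by (simp only: True N if_True simp_thms)
    next
      case False
      have "det (\<chi> i. if i = c then row j N else row i N) = 0"
        by (rule det_identical_rows[of c j]) (use False in \<open>auto simp: row_def vec_eq_iff\<close>)
      then show ?thesis using False by simp
    qed
  qed simp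
  also have "\<dots> = y c * det N" by simp
  finally have "det A * y c = det B" by (simp add: N_def mult.commute)
  also have "det B \<in> J"
    unfolding det_def
  proof (intro idl.subspace_sum[OF J] idl.subspace_scale[OF J])
    fix p
    have "B $ c $ p c = w (p c)"
      by (simp add: B_def w_def N_def row_def transpose_def mult.commute)
    then have "(\<Prod>i\<in>UNIV. B $ i $ p i) = (\<Prod>i\<in>UNIV - {c}. B $ i $ p i) * w (p c)"
      by (subst prod.remove[of _ c]) (auto simp: mult.commute)
    also have "\<dots> \<in> J" using w[of "p c"] by (intro idl.subspace_scale[OF J]) (simp add: w_def)
    finally show "(\<Prod>i\<in>UNIV. B $ i $ p i) \<in> J" .
  qed
  finally show ?thesis .
qed

section \<open>Divided differences\<close>

text \<open>In the doubled set of variables, \<open>inclL f\<close> is \<open>f(x)\<close> and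
  \<open>inclR f\<close> is \<open>f(x')\<close>. The exponent vectors \<open>left k\<close> and
  \<open>right k\<close> are the parts of \<open>k\<close> for the two copies of the variables.\<close>

abbreviation inclL :: "('v::finite, 'k::field) mpoly \<Rightarrow> ('v + 'v, 'k) mpoly" where
  "inclL \<equiv> peval const (\<lambda>v. var (Inl v))"

abbreviation inclR :: "('v::finite, 'k::field) mpoly \<Rightarrow> ('v + 'v, 'k) mpoly" where
  "inclR \<equiv> peval const (\<lambda>v. var (Inr v))"

definition left :: "('a + 'b \<Rightarrow>\<^sub>0 nat) \<Rightarrow> ('a \<Rightarrow>\<^sub>0 nat)" where
  "left k = Poly_Mapping.map_key Inl k"

definition right :: "('a + 'b \<Rightarrow>\<^sub>0 nat) \<Rightarrow> ('b \<Rightarrow>\<^sub>0 nat)" where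
  "right k = Poly_Mapping.map_key Inr k"

lemma left_right_simps [simp]:
  "left (k + l) = left k + left l" "right (k + l) = right k + right l"
  "left 0 = 0" "right 0 = 0"
  "left (single (Inl v) n) = single v n" "right (single (Inr w) n) = single w n"
  "left (single (Inr w) n) = 0" "right (single (Inl v) n) = 0"
proof -
  have inj: "inj (Inl :: 'x \<Rightarrow> 'x + 'y)" "inj (Inr :: 'y \<Rightarrow> 'x + 'y)" for x :: 'x and y :: 'y
    by simp_all
  show "left (k + l) = left k + left l" "right (k + l) = right k + right l"
    "left 0 = 0" "right 0 = 0"
    "left (single (Inl v) n) = single v n" "right (single (Inr w) n) = single w n"
    by (simp_all add: left_def right_def map_key_plus)
  show "left (single (Inr w) n) = 0" "right (single (Inl v) n) = 0"
    by (auto simp: left_def right_def map_key.rep_eq lookup_single when_def intro!: poly_mapping_eqI)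
qed

lemma lookup_left: "lookup (left k) v = lookup k (Inl v)"
  and lookup_right: "lookup (right k) w = lookup k (Inr w)"
  by (simp_all add: left_def right_def map_key.rep_eq)

lemma pmono_case_sum: "pmono (case_sum a b) k = pmono a (left k) * pmono b (right k)"
proof -
  have "pmono (case_sum a b) k = (\<Prod>v\<in>Inl ` UNIV \<union> Inr ` UNIV. case_sum a b v ^ lookup k v)"
    unfolding pmono_def UNIV_sum ..
  also have "\<dots> = pmono a (left k) * pmono b (right k)"
    by (subst prod.union_disjoint) (auto simp: pmono_def prod.reindex lookup_left lookup_right)
  finally show ?thesis .
qed

lemma monomial_in_right_variables:
  obtains n where "pmono (\<lambda>v. var (Inr v) :: ('v::finite + 'v, 'k::field) mpoly) m = single n 1"
    "left n = 0" "right n = m"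
proof -
  have var_power: "var w ^ n = (single (single w n) 1 :: ('v + 'v, 'k) mpoly)" for w n
    using single_eq[of "single w n" "1 :: 'k"] by (simp add: pmono_single)
  have "\<exists>n. pmono (\<lambda>v. var (Inr v)) m = (single n 1 :: ('v + 'v, 'k) mpoly) \<and> left n = 0 \<and> right n = m"
  proof (induction m rule: poly_mapping_add_induct)
    case (single v n)
    show ?case by (rule exI[of _ "single (Inr v) n"]) (simp add: pmono_single var_power)
  next
    case (add m m')
    then obtain n n' where "pmono (\<lambda>v. var (Inr v)) m = (single n 1 :: ('v + 'v, 'k) mpoly)"
      "left n = 0" "right n = m" "pmono (\<lambda>v. var (Inr v)) m' = (single n' 1 :: ('v + 'v, 'k) mpoly)"
      "left n' = 0" "right n' = m'" by blast
    then show ?case by (intro exI[of _ "n + n'"]) (simp add: pmono_add mult_single)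
  qed
  then show ?thesis using that by blast
qed

lemma monomial_induct [case_names zero step]:
  fixes m :: "'v \<Rightarrow>\<^sub>0 nat"
  assumes "P 0" "\<And>m v. P m \<Longrightarrow> P (m + single v 1)"
  shows "P m"
proof -
  have single: "P m \<Longrightarrow> P (m + single v n)" for m v n
  proof (induction n)
    case (Suc n)
    have "m + single v (Suc n) = (m + single v n) + single v 1"
      by (simp add: add.assoc flip: single_add)
    then show ?case using Suc assms(2)[of "m + single v n" v] by simp
  qed simp
  have "P (\<Sum>v\<in>A. single v (lookup m v))" if "finite A" for A
    using that
  proof (induction A rule: finite_induct)
    case (insert v A)
    then show ?case using single[OF insert.IH, of v "lookup m v"] by (simp add: add.commute)
  qed (use assms in simp)
  from this[of "keys m"] show ?thesis using sum_singles[of m] by simp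
qed

text \<open>Induction on the degree, with \<open>m(x) x\<^sub>w - m(x') x'\<^sub>w = (m(x) - m(x'))
  x\<^sub>w + m(x') (x\<^sub>w - x'\<^sub>w)\<close>.\<close>

lemma divided_differences_monomial:
  fixes m :: "'v::finite \<Rightarrow>\<^sub>0 nat"
  shows "\<exists>A :: 'v \<Rightarrow> ('v + 'v, 'k::field) mpoly.
    inclL (pmono var m) - inclR (pmono var m) = (\<Sum>v\<in>UNIV. A v * (var (Inl v) - var (Inr v))) \<and>
    (\<forall>v. \<forall>k\<in>keys (A v). left k + right k + single v 1 = m) \<and>
    (\<forall>v a. evaluate (case_sum a a) (A v) = evaluate a (partial_deriv v (pmono var m)))"
proof (induction m rule: monomial_induct)
  case zero
  have "partial_deriv v (1 :: ('v, 'k) mpoly) = 0" for v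
    using partial_deriv_const[of v 1] by simp
  then show ?case by (intro exI[of _ "\<lambda>_. 0"]) (simp add: cst.peval_simps)
next
  case (step m w)
  then obtain A :: "'v \<Rightarrow> ('v + 'v, 'k) mpoly" where A:
    "inclL (pmono var m) - inclR (pmono var m) = (\<Sum>v\<in>UNIV. A v * (var (Inl v) - var (Inr v)))"
    "\<And>v k. k \<in> keys (A v) \<Longrightarrow> left k + right k + single v 1 = m"
    "\<And>v a. evaluate (case_sum a a) (A v) = evaluate a (partial_deriv v (pmono var m))"
    by blast
  have mono: "pmono var (m + single w 1) = pmono var m * (var w :: ('v, 'k) mpoly)"
    by (simp add: pmono_add pmono_single)
  have incl_mono: "inclR (pmono var m) = (pmono (\<lambda>v. var (Inr v)) m :: ('v + 'v, 'k) mpoly)"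
    by (simp add: pmono_def cst.peval_simps)
  define A' where "A' = (\<lambda>v. A v * var (Inl w) + (if v = w then inclR (pmono var m) else 0))"
  have sum_w: "(\<Sum>v\<in>UNIV. (if v = w then inclR (pmono var m) else 0) * (var (Inl v) - var (Inr v)))
    = inclR (pmono var m) * (var (Inl w) - var (Inr w) :: ('v + 'v, 'k) mpoly)"
    by (simp add: if_distrib[of "\<lambda>x. x * _"] cong: if_cong)
  show ?case
  proof (intro exI[of _ A'] conjI allI ballI)
    have "inclL (pmono var (m + single w 1)) - inclR (pmono var (m + single w 1))
      = (inclL (pmono var m) - inclR (pmono var m)) * var (Inl w)
        + inclR (pmono var m) * (var (Inl w) - var (Inr w) :: ('v + 'v, 'k) mpoly)"
      unfolding mono cst.peval_mult cst.peval_var left_diff_distrib right_diff_distrib by simp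
    also have "\<dots> = (\<Sum>v\<in>UNIV. A' v * (var (Inl v) - var (Inr v)))"
      unfolding A A'_def distrib_right sum.distrib sum_w sum_distrib_right
      by (simp only: ac_simps)
    finally show "inclL (pmono var (m + single w 1)) - inclR (pmono var (m + single w 1))
      = (\<Sum>v\<in>UNIV. A' v * (var (Inl v) - var (Inr v)))" .
  next
    fix v k assume "k \<in> keys (A' v)"
    then consider "k \<in> keys (A v * var (Inl w))" | "v = w" "k \<in> keys (inclR (pmono var m) :: ('v + 'v, 'k) mpoly)"
      using keys_add[of "A v * var (Inl w)" "if v = w then inclR (pmono var m) else 0"]
      by (auto simp: A'_def split: if_splits)
    then show "left k + right k + single v 1 = m + single w 1"
    proof cases
      case 1
      then obtain l where "l \<in> keys (A v)" "k = l + single (Inl w) 1"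
        using keys_mult[of "A v" "var (Inl w)"] by (auto simp: var_def)
      moreover from this have "m = left l + right l + single v 1" using A(2) by metis
      ultimately show ?thesis by (simp add: ac_simps)
    next
      case 2
      obtain n where "pmono (\<lambda>v. var (Inr v) :: ('v + 'v, 'k) mpoly) m = single n 1"
        "left n = 0" "right n = m" by (rule monomial_in_right_variables)
      then show ?thesis using 2 by (simp add: incl_mono)
    qed
  next
    fix v and a :: "'v \<Rightarrow> 'k"
    have "evaluate (case_sum a a) (inclR (pmono var m)) = evaluate a (pmono var m)"
      by (simp only: evaluate_peval_const evaluate_simps sum.case)
    then show "evaluate (case_sum a a) (A' v) = evaluate a (partial_deriv v (pmono var (m + single w 1)))"
      unfolding mono partial_deriv_mult A'_def evaluate_simps A(3) by simp
  qed
qed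

text \<open>The condition on exponents says for every grading at once that the coefficients are
  homogeneous of the expected degree in both copies of the variables together.\<close>

lemma divided_differences:
  fixes f :: "('v::finite, 'k::field) mpoly"
  obtains A :: "'v \<Rightarrow> ('v + 'v, 'k) mpoly" where
    "inclL f - inclR f = (\<Sum>v\<in>UNIV. A v * (var (Inl v) - var (Inr v)))"
    "\<And>v k. k \<in> keys (A v) \<Longrightarrow> left k + right k + single v 1 \<in> keys f"
    "\<And>v a. evaluate (case_sum a a) (A v) = evaluate a (partial_deriv v f)"
proof -
  define P where "P = (\<lambda>m (A :: 'v \<Rightarrow> ('v + 'v, 'k) mpoly).
    inclL (pmono var m) - inclR (pmono var m) = (\<Sum>v\<in>UNIV. A v * (var (Inl v) - var (Inr v))) \<and>
    (\<forall>v. \<forall>k\<in>keys (A v). left k + right k + single v 1 = m) \<and>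
    (\<forall>v a. evaluate (case_sum a a) (A v) = evaluate a (partial_deriv v (pmono var m))))"
  have "\<exists>A. P m A" for m unfolding P_def by (rule divided_differences_monomial)
  then have "\<forall>m. \<exists>A. P m A" by blast
  then obtain A where PA: "\<forall>m. P m (A m)" by (rule choice[THEN exE])
  have A:
    "\<And>m. inclL (pmono var m) - inclR (pmono var m) = (\<Sum>v\<in>UNIV. A m v * (var (Inl v) - var (Inr v)))"
    "\<And>m v k. k \<in> keys (A m v) \<Longrightarrow> left k + right k + single v 1 = m"
    "\<And>m v a. evaluate (case_sum a a) (A m v) = evaluate a (partial_deriv v (pmono var m))"
    using PA[unfolded P_def] by blast+
  have f: "f = (\<Sum>m\<in>keys f. const (lookup f m) * pmono var m)"
    using sum_singles[of f] by (simp add: single_eq)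
  define A' where "A' = (\<lambda>v. \<Sum>m\<in>keys f. const (lookup f m) * A m v)"
  have const_deriv: "partial_deriv v (const c * g) = const c * partial_deriv v g" for v c and g :: "('v, 'k) mpoly"
    by (simp add: partial_deriv_mult)
  show ?thesis
  proof (rule that[of A'])
    have "inclL f - inclR f = (\<Sum>m\<in>keys f. const (lookup f m) * (inclL (pmono var m) - inclR (pmono var m)))"
    proof -
      have "inclL f = (\<Sum>m\<in>keys f. const (lookup f m) * inclL (pmono var m))"
        by (subst f) (simp only: cst.peval_sum cst.peval_mult cst.peval_const)
      moreover have "inclR f = (\<Sum>m\<in>keys f. const (lookup f m) * inclR (pmono var m))"
        by (subst f) (simp only: cst.peval_sum cst.peval_mult cst.peval_const)
      ultimately show ?thesis by (simp only: sum_subtractf right_diff_distrib)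
    qed
    also have "\<dots> = (\<Sum>m\<in>keys f. \<Sum>v\<in>UNIV. const (lookup f m) * (A m v * (var (Inl v) - var (Inr v))))"
      unfolding A by (simp only: sum_distrib_left)
    also have "\<dots> = (\<Sum>v\<in>UNIV. \<Sum>m\<in>keys f. const (lookup f m) * (A m v * (var (Inl v) - var (Inr v))))"
      by (rule sum.swap)
    also have "\<dots> = (\<Sum>v\<in>UNIV. A' v * (var (Inl v) - var (Inr v)))"
      by (rule sum.cong) (simp_all only: A'_def sum_distrib_right mult.assoc)
    finally show "inclL f - inclR f = (\<Sum>v\<in>UNIV. A' v * (var (Inl v) - var (Inr v)))" .
  next
    fix v k assume "k \<in> keys (A' v)"
    then obtain m where m: "m \<in> keys f" "k \<in> keys (const (lookup f m) * A m v)"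
      using keys_sum[of "\<lambda>m. const (lookup f m) * A m v" "keys f"] unfolding A'_def by blast
    then have "k \<in> keys (A m v)"
      using keys_mult[of "const (lookup f m)" "A m v"] by (auto simp: const_def split: if_splits)
    then show "left k + right k + single v 1 \<in> keys f" using A(2)[of k m v] m by simp
  next
    fix v and a :: "'v \<Rightarrow> 'k"
    have "partial_deriv v f = (\<Sum>m\<in>keys f. const (lookup f m) * partial_deriv v (pmono var m))"
      by (subst f) (simp only: partial_deriv_sum const_deriv)
    then show "evaluate (case_sum a a) (A' v) = evaluate a (partial_deriv v f)"
      by (simp add: A'_def evaluate_sum A(3))
  qed
qed

text \<open>In each of the products that make up the determinant, the degrees \<open>a i\<close> of the
  rows and \<open>u j\<close> of the columns occur once each.\<close>

lemma keys_det_degree: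
  fixes M :: "('v, 'k::field) mpoly^'n^'n" and g :: "('v \<Rightarrow>\<^sub>0 nat) \<Rightarrow> nat"
  assumes "grading g" "\<And>i j k. k \<in> keys (M $ i $ j) \<Longrightarrow> g k + u j = a i" "k \<in> keys (det M)"
  shows "g k + (\<Sum>j\<in>UNIV. u j) = (\<Sum>i\<in>UNIV. a i)"
proof -
  interpret grading g by fact
  obtain p where p: "p permutes UNIV" "k \<in> keys (of_int (sign p) * (\<Prod>i\<in>UNIV. M $ i $ p i))"
    using assms(3) keys_sum unfolding det_def by fast
  then have "k \<in> keys (\<Prod>i\<in>UNIV. M $ i $ p i)"
  proof (cases "sign p = 1")
    case False
    then have "sign p = -1" using sign_cases[of p] by blast
    then show ?thesis using p(2) by (simp add: in_keys_iff)
  qed (use p(2) in simp)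
  moreover have "\<forall>k\<in>keys (\<Prod>i\<in>S. M $ i $ p i). g k + (\<Sum>i\<in>S. u (p i)) = (\<Sum>i\<in>S. a i)" for S
  proof (induction S rule: infinite_finite_induct)
    case (insert i S)
    show ?case
    proof
      fix k assume "k \<in> keys (\<Prod>i\<in>insert i S. M $ i $ p i)"
      then obtain k1 k2 where "k = k1 + k2" "k1 \<in> keys (M $ i $ p i)" "k2 \<in> keys (\<Prod>i\<in>S. M $ i $ p i)"
        using insert keys_mult[of "M $ i $ p i" "\<Prod>i\<in>S. M $ i $ p i"] by auto
      then show "g k + (\<Sum>i\<in>insert i S. u (p i)) = (\<Sum>i\<in>insert i S. a i)"
        using insert assms(2)[of k1 i "p i"] by (auto simp: deg_add)
    qed
  qed auto
  moreover have "(\<Sum>i\<in>UNIV. u (p i)) = (\<Sum>j\<in>UNIV. u j)"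
    using sum.permute[OF p(1), of u] by (simp add: o_def)
  ultimately show ?thesis by metis
qed

section \<open>The determinant of divided differences\<close>

lemma jacobian_var_simps [simp]:
  "jacobian_var None = Inl (Some ())" "jacobian_var (Some j) = Inr (Some j)"
  by (simp_all add: jacobian_var_def)

lemma sum_variables:
  "(\<Sum>v\<in>UNIV. g v) = g (Inl None) + g (Inr None) + (\<Sum>c\<in>UNIV. g (jacobian_var c))"
  for g :: "unit option + 'n::finite option \<Rightarrow> 'a::comm_monoid_add"
proof -
  have "(\<Sum>v\<in>UNIV. g v) = (\<Sum>v\<in>Inl ` UNIV \<union> Inr ` UNIV. g v)"
    unfolding UNIV_sum ..
  also have "\<dots> = (\<Sum>a\<in>UNIV. g (Inl a)) + (\<Sum>b\<in>UNIV. g (Inr b))"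
    by (subst sum.union_disjoint) (auto simp: sum.reindex)
  finally show ?thesis by (simp add: UNIV_option_conv sum.reindex UNIV_unit ac_simps)
qed

lemma single_sum: "single m (\<Sum>i\<in>A. g i) = (\<Sum>i\<in>A. single m (g i))"
  by (induction A rule: infinite_finite_induct) (simp_all add: single_add)

lemma evaluate_jacobian_minor:
  "evaluate a (jacobian_minor F) = det (\<chi> k c. evaluate a (partial_deriv (jacobian_var c) (F k)))"
  unfolding jacobian_minor_def by (subst hom_det[of "evaluate a"]) simp_all

text \<open>The weights \<open>\<phi>\<close> define a functional on polynomials, the weighted sum of the
  values at the points. The assumption \<open>kill\<close> says that it annihilates all monomials of
  small degree in one of the two blocks of variables.\<close>

locale weighted_points =
  fixes Z :: "'p set" and e :: "'p \<Rightarrow> unit option + 'n::finite option \<Rightarrow> 'k::field"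
    and \<phi> :: "'p \<Rightarrow> 'k" and D1 D2 :: nat
  assumes finite_Z: "finite Z"
    and e_X0: "p \<in> Z \<Longrightarrow> e p (Inl None) = 1" and e_Y0: "p \<in> Z \<Longrightarrow> e p (Inr None) = 1"
    and inj_e: "inj_on e Z"
    and kill: "degX m < D1 \<or> degY m < D2 \<Longrightarrow> (\<Sum>p\<in>Z. \<phi> p * pmono (e p) m) = 0"
begin

text \<open>The functional is applied to the second copy of the variables. The degree by which a monomial
  exceeds \<open>(D1, D2)\<close> is returned as a power of \<open>X\<^sub>0\<close> and
  \<open>Y\<^sub>0\<close>, which keeps the result homogeneous without changing its values at the
  points. Truncated subtraction affects only monomials that the functional annihilates.\<close>

definition shift :: "((unit option + 'n option) \<Rightarrow>\<^sub>0 nat) \<Rightarrow> (unit option + 'n option) \<Rightarrow>\<^sub>0 nat" where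
  "shift r = single (Inl None) (degX r - D1) + single (Inr None) (degY r - D2)"

definition \<Phi> :: "((unit option + 'n option) + (unit option + 'n option), 'k) mpoly \<Rightarrow> ('n, 'k) bipoly" where
  "\<Phi> = extend (\<lambda>k c. single (left k + shift (right k)) (c * (\<Sum>p\<in>Z. \<phi> p * pmono (e p) (right k))))"

lemma \<Phi>_single: "\<Phi> (single k c)
    = single (left k + shift (right k)) (c * (\<Sum>p\<in>Z. \<phi> p * pmono (e p) (right k)))"
  unfolding \<Phi>_def by (rule extend_single) simp

lemma \<Phi>_add: "\<Phi> (f + g) = \<Phi> f + \<Phi> g"
  unfolding \<Phi>_def by (rule extend_add) (simp_all add: distrib_right single_add)

lemma \<Phi>_zero [simp]: "\<Phi> 0 = 0"
  unfolding \<Phi>_def by simp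

lemma \<Phi>_diff: "\<Phi> (f - g) = \<Phi> f - \<Phi> g"
  using \<Phi>_add[of "f - g" g] by simp

lemma \<Phi>_sum: "\<Phi> (\<Sum>i\<in>A. f i) = (\<Sum>i\<in>A. \<Phi> (f i))"
  by (induction A rule: infinite_finite_induct) (simp_all add: \<Phi>_add)

lemma \<Phi>_inclL: "\<Phi> (inclL f * g) = f * \<Phi> g"
proof (induction f arbitrary: g rule: mpoly_induct)
  case (const c)
  show ?case
  proof (induction g rule: poly_mapping_add_induct)
    case (single k d)
    show ?case unfolding cst.peval_const unfolding const_def mult_single \<Phi>_single by (simp only: add_0 mult.assoc)
  qed (simp only: distrib_left \<Phi>_add)
next
  case (var v)
  show ?case
  proof (induction g rule: poly_mapping_add_induct)
    case (single k d)
    show ?case unfolding cst.peval_var unfolding var_def mult_single \<Phi>_single left_right_simps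
      by (simp only: add_0 mult_1 ac_simps)
  qed (simp only: distrib_left \<Phi>_add)
next
  case (add f1 f2)
  then show ?case by (simp only: cst.peval_add distrib_right \<Phi>_add)
next
  case (mult f1 f2)
  then show ?case by (simp only: cst.peval_mult mult.assoc)
qed

text \<open>Homogeneity makes the powers of \<open>X\<^sub>0\<close> and \<open>Y\<^sub>0\<close> the same
  for all terms of \<open>f\<close>, so that they can be factored out of the sum of the values of
  \<open>f\<close>.\<close>

lemma \<Phi>_inclR_vanishing:
  assumes f: "f \<in> bihom_piece i j" "\<And>p. p \<in> Z \<Longrightarrow> evaluate (e p) f = 0"
  shows "\<Phi> (inclR f * g) = 0"
proof (induction g rule: poly_mapping_add_induct)
  case (single k d)
  define E where "E = left k + (single (Inl None) (degX (right k) + i - D1)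
    + single (Inr None) (degY (right k) + j - D2))"
  have summand: "\<Phi> (inclR (single m c) * single k d)
      = single E (d * (\<Sum>p\<in>Z. \<phi> p * pmono (e p) (right k) * evaluate (e p) (single m c)))"
    if m: "m \<in> keys f" for m c
  proof -
    obtain n where n: "pmono (\<lambda>v. var (Inr v) :: ((unit option + 'n option) + (unit option + 'n option), 'k) mpoly) m = single n 1"
      "left n = 0" "right n = m" by (rule monomial_in_right_variables)
    have deg: "degX m = i" "degY m = j" using m f(1) by (auto simp: bihom_piece_eq piece_def)
    have "inclR (single m c) * single k d = single (n + k) (c * d)"
      by (simp add: cst.peval_single n const_def mult_single)
    then have "\<Phi> (inclR (single m c) * single k d)
        = single (left (n + k) + shift (right (n + k)))
            (c * d * (\<Sum>p\<in>Z. \<phi> p * pmono (e p) (right (n + k))))"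
      by (simp only: \<Phi>_single)
    also have "left (n + k) + shift (right (n + k)) = E"
      by (simp add: n E_def shift_def degX.deg_add degY.deg_add deg add.commute)
    also have "c * d * (\<Sum>p\<in>Z. \<phi> p * pmono (e p) (right (n + k)))
        = d * (\<Sum>p\<in>Z. \<phi> p * pmono (e p) (right k) * evaluate (e p) (single m c))"
      unfolding left_right_simps n pmono_add evaluate_single sum_distrib_left
      by (simp only: ac_simps)
    finally show ?thesis .
  qed
  have "inclR f * single k d = (\<Sum>m\<in>keys f. inclR (single m (lookup f m)) * single k d)"
    by (subst sum_singles[of f]) (simp only: cst.peval_sum sum_distrib_right)
  then have "\<Phi> (inclR f * single k d)
      = (\<Sum>m\<in>keys f. single E (d * (\<Sum>p\<in>Z. \<phi> p * pmono (e p) (right k) * evaluate (e p) (single m (lookup f m)))))"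
    by (simp only: \<Phi>_sum summand cong: sum.cong)
  also have "\<dots> = single E (\<Sum>m\<in>keys f. d * (\<Sum>p\<in>Z. \<phi> p * pmono (e p) (right k) * evaluate (e p) (single m (lookup f m))))"
    by (rule single_sum[symmetric])
  also have "(\<Sum>m\<in>keys f. d * (\<Sum>p\<in>Z. \<phi> p * pmono (e p) (right k) * evaluate (e p) (single m (lookup f m))))
    = d * (\<Sum>p\<in>Z. \<phi> p * pmono (e p) (right k) * evaluate (e p) (\<Sum>m\<in>keys f. single m (lookup f m)))"
    unfolding sum_distrib_left[symmetric] evaluate_sum by (subst sum.swap) (simp only: sum_distrib_left)
  also have "\<dots> = 0" using f(2) by (simp add: sum_singles[symmetric])
  finally show ?case by simp
qed (simp only: distrib_left \<Phi>_add, simp)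

text \<open>At the points the second copy of a base coordinate has the value \<open>1\<close>; the factor
  that is lost this way is the one that \<open>shift\<close> returns in the first copy.\<close>

lemma \<Phi>_base_variable:
  assumes "v = Inl None \<or> v = Inr None"
  shows "\<Phi> ((var (Inl v) - var (Inr v)) * g) = 0"
proof (induction g rule: poly_mapping_add_induct)
  case (single k d)
  define S where "S = (\<Sum>p\<in>Z. \<phi> p * pmono (e p) (right k))"
  have S: "(\<Sum>p\<in>Z. \<phi> p * pmono (e p) (single v 1 + right k)) = S"
    unfolding S_def by (rule sum.cong) (use assms e_X0 e_Y0 in \<open>auto simp: pmono_add pmono_single\<close>)
  have "\<Phi> (var (Inl v) * single k d) = single (single v 1 + left k + shift (right k)) (d * S)"
    unfolding var_def mult_single \<Phi>_single S_def by simp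
  moreover have "\<Phi> (var (Inr v) * single k d) = single (left k + shift (single v 1 + right k)) (d * S)"
    unfolding var_def mult_single \<Phi>_single left_right_simps S by simp
  moreover have "single v 1 + left k + shift (right k) = left k + shift (single v 1 + right k)" if "S \<noteq> 0"
  proof -
    have "D1 \<le> degX (right k)" "D2 \<le> degY (right k)"
      using kill[of "right k"] that by (auto simp: S_def not_le[symmetric])
    then show ?thesis
      by (intro poly_mapping_eqI) (use assms in \<open>auto simp: shift_def lookup_add lookup_single when_def
        degX.deg_add degY.deg_add Suc_diff_le\<close>)
  qed
  ultimately show ?case
    by (cases "S = 0") (auto simp: left_diff_distrib \<Phi>_diff)
qed (simp only: distrib_left \<Phi>_add, simp)

lemma evaluate_\<Phi>:
  assumes "q \<in> Z"
  shows "evaluate (e q) (\<Phi> g) = (\<Sum>p\<in>Z. \<phi> p * evaluate (case_sum (e q) (e p)) g)"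
proof (induction g rule: poly_mapping_add_induct)
  case (single k d)
  have "pmono (e q) (shift r) = 1" for r
    using assms by (simp add: shift_def pmono_add pmono_single e_X0 e_Y0)
  then show ?case
    unfolding \<Phi>_single evaluate_single pmono_add pmono_case_sum sum_distrib_left
    by (simp only: sum_distrib_left sum_distrib_right mult_1_right mult_1 ac_simps)
qed (simp only: \<Phi>_add evaluate_simps sum.distrib distrib_left)

text \<open>The determinant \<open>det M\<close> of the divided differences multiplies all
  \<open>x\<^sub>v - x'\<^sub>v\<close> into the ideal of \<open>G\<close>, hence also all
  \<open>f(x) - f(x')\<close>. Its terms have total degree at most \<open>(D1, D2)\<close> in both
  copies together, and \<open>\<Phi>\<close> annihilates those of smaller degree in the second copy; what
  remains is the constant \<open>c\<close>. Applying \<open>\<Phi>\<close> to \<open>det M * (f(x) -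
  f(x'))\<close> gives \<open>c f\<close>, because \<open>\<Phi>\<close> annihilates the multiples of
  \<open>f(x')\<close>. At two different points \<open>x\<close> and \<open>x'\<close> the
  determinant is zero, since some \<open>x\<^sub>v - x'\<^sub>v\<close> is not; so the weighted sum
  for \<open>c\<close> has only one summand at each point.\<close>

theorem exists_determinant_constant:
  fixes F :: "'n option \<Rightarrow> ('n, 'k) bipoly"
  assumes F: "\<And>k. F k \<in> bihom_piece (a k) (b k)" "\<And>k p. p \<in> Z \<Longrightarrow> evaluate (e p) (F k) = 0"
    and a: "(\<Sum>k\<in>UNIV. a k) \<le> D1 + 1" and b: "(\<Sum>k\<in>UNIV. b k) \<le> D2 + CARD('n)"
  shows "\<exists>c. (\<forall>p\<in>Z. \<phi> p * evaluate (e p) (jacobian_minor F) = c) \<and>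
    (\<forall>f i j. f \<in> bihom_piece i j \<longrightarrow> (\<forall>p\<in>Z. evaluate (e p) f = 0) \<longrightarrow> const c * f \<in> ideal_span (range F)) \<and>
    ((\<Sum>k\<in>UNIV. a k) < D1 + 1 \<or> (\<Sum>k\<in>UNIV. b k) < D2 + CARD('n) \<longrightarrow> c = 0)"
proof -
  define y where "y = (\<lambda>v. var (Inl v) - var (Inr v) :: ((unit option + 'n option) + (unit option + 'n option), 'k) mpoly)"
  define Pr where "Pr = (\<lambda>k A. inclL (F k) - inclR (F k) = (\<Sum>v\<in>UNIV. A v * y v) \<and>
    (\<forall>v. \<forall>l\<in>keys (A v). left l + right l + single v 1 \<in> keys (F k)) \<and>
    (\<forall>v x. evaluate (case_sum x x) (A v) = evaluate x (partial_deriv v (F k))))"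
  have "\<exists>A. Pr k A" for k
    unfolding Pr_def y_def by (rule divided_differences[of "F k"]) blast
  then have "\<forall>k. \<exists>A. Pr k A" by blast
  then obtain A where PA: "\<forall>k. Pr k (A k)" by (rule choice[THEN exE])
  have A: "\<And>k. inclL (F k) - inclR (F k) = (\<Sum>v\<in>UNIV. A k v * y v)"
    "\<And>k v l. l \<in> keys (A k v) \<Longrightarrow> left l + right l + single v 1 \<in> keys (F k)"
    "\<And>k v x. evaluate (case_sum x x) (A k v) = evaluate x (partial_deriv v (F k))"
    using PA[unfolded Pr_def] by blast+
  define M where "M = (\<chi> k c. A k (jacobian_var c))"
  define G where "G = (\<lambda>k. inclL (F k) - inclR (F k)) ` UNIV \<union> {y (Inl None), y (Inr None)}"
  have ideal_G: "is_ideal (ideal_span G)" by (rule idl.subspace_span)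
  have y0: "y (Inl None) \<in> ideal_span G" "y (Inr None) \<in> ideal_span G"
    by (auto simp: G_def intro: idl.span_base)
  have "(\<Sum>c\<in>UNIV. M $ k $ c * y (jacobian_var c)) \<in> ideal_span G" for k
  proof -
    have "(\<Sum>c\<in>UNIV. M $ k $ c * y (jacobian_var c))
        = (inclL (F k) - inclR (F k)) - (A k (Inl None) * y (Inl None) + A k (Inr None) * y (Inr None))"
      unfolding A(1) sum_variables M_def by simp
    also have "\<dots> \<in> ideal_span G"
      by (intro idl.span_diff idl.span_add idl.span_scale y0 idl.span_base) (auto simp: G_def)
    finally show ?thesis .
  qed
  then have d1: "det M * y (jacobian_var c) \<in> ideal_span G" for c
    using det_mult_in_ideal[OF ideal_G, of M "\<lambda>c. y (jacobian_var c)"] by blast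
  have d2: "det M * y (Inl None) \<in> ideal_span G" "det M * y (Inr None) \<in> ideal_span G"
    by (intro idl.span_scale y0)+
  have cases_v: "v = Inl None \<or> v = Inr None \<or> (\<exists>c. v = jacobian_var c)" for v :: "unit option + 'n option"
  proof (cases v)
    case (Inl a)
    then show ?thesis by (cases a) (auto intro: exI[of _ None])
  next
    case (Inr b)
    then show ?thesis by (cases b) (auto intro: exI[of _ "Some _"])
  qed
  have det_y: "det M * y v \<in> ideal_span G" for v
    using cases_v[of v] by (elim disjE exE) (simp_all only: d1 d2)
  have det_f: "det M * (inclL f - inclR f) \<in> ideal_span G" for f
  proof -
    obtain B where B: "inclL f - inclR f = (\<Sum>v\<in>UNIV. B v * y v)"
      unfolding y_def by (rule divided_differences[of f]) blast
    have "det M * (inclL f - inclR f) = (\<Sum>v\<in>UNIV. B v * (det M * y v))"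
      unfolding B sum_distrib_left by (simp only: ac_simps)
    also have "\<dots> \<in> ideal_span G" by (intro idl.span_sum idl.span_scale det_y)
    finally show ?thesis .
  qed
  have \<Phi>_G: "\<Phi> g \<in> ideal_span (range F)" if "g \<in> ideal_span G" for g
    using that
  proof (induction rule: idl.span_induct_alt)
    case base
    show ?case by (simp add: idl.span_zero)
  next
    case (step c x g)
    have "\<Phi> (c * x) \<in> ideal_span (range F)"
    proof (cases "x = y (Inl None) \<or> x = y (Inr None)")
      case True
      then have "\<Phi> (x * c) = 0" unfolding y_def using \<Phi>_base_variable by blast
      then show ?thesis by (simp only: mult.commute[of c x] idl.span_zero)
    next
      case False
      then obtain k where k: "x = inclL (F k) - inclR (F k)" using step(1) by (auto simp: G_def)
      have "\<Phi> (x * c) = F k * \<Phi> c"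
        unfolding k left_diff_distrib \<Phi>_diff \<Phi>_inclL
        using \<Phi>_inclR_vanishing[OF F(1)[of k] F(2)] by simp
      then have "\<Phi> (c * x) = \<Phi> c * F k" by (simp only: mult.commute)
      then show ?thesis by (simp add: idl.span_scale idl.span_base)
    qed
    then show ?case unfolding \<Phi>_add using step by (intro idl.span_add)
  qed
  have evaluate_G: "evaluate (case_sum (e q) (e p)) g = 0" if "g \<in> ideal_span G" "p \<in> Z" "q \<in> Z" for g p q
    using that(1)
  proof (induction rule: idl.span_induct_alt)
    case (step c x g)
    have "evaluate (case_sum (e q) (e p)) x = 0"
      using step(1) that F(2) by (auto simp: G_def y_def evaluate_peval_const e_X0 e_Y0)
    then show ?case using step by simp
  qed simp
  have keys_M: "degX (left l) + degX (right l) + 1 = (\<Sum>k\<in>UNIV. a k)"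
    "degY (left l) + degY (right l) + CARD('n) = (\<Sum>k\<in>UNIV. b k)" if l: "l \<in> keys (det M)" for l
  proof -
    have entry: "left l + right l + single (jacobian_var c) 1 \<in> keys (F k)"
      if "l \<in> keys (M $ k $ c)" for l k c
      using A(2) that by (simp add: M_def)
    have "degX (left l) + degX (right l) + (\<Sum>c\<in>UNIV. degX (single (jacobian_var c :: unit option + 'n option) 1))
        = (\<Sum>k\<in>UNIV. a k)"
    proof (rule keys_det_degree[where M = M and g = "\<lambda>l. degX (left l) + degX (right l)", OF _ _ l])
      show "grading (\<lambda>l. degX (left l) + degX (right l))"
        by unfold_locales (simp add: degX.deg_add)
      show "degX (left l) + degX (right l) + degX (single (jacobian_var j) 1) = a i"
        if "l \<in> keys (M $ i $ j)" for i j l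
        using entry[OF that] F(1)[of i] unfolding bihom_piece_eq piece_def
        by (auto simp: degX.deg_add)
    qed
    then show "degX (left l) + degX (right l) + 1 = (\<Sum>k\<in>UNIV. a k)"
      by (simp add: UNIV_option_conv sum.reindex)
    have "degY (left l) + degY (right l) + (\<Sum>c\<in>UNIV. degY (single (jacobian_var c :: unit option + 'n option) 1))
        = (\<Sum>k\<in>UNIV. b k)"
    proof (rule keys_det_degree[where M = M and g = "\<lambda>l. degY (left l) + degY (right l)", OF _ _ l])
      show "grading (\<lambda>l. degY (left l) + degY (right l))"
        by unfold_locales (simp add: degY.deg_add)
      show "degY (left l) + degY (right l) + degY (single (jacobian_var j) 1) = b i"
        if "l \<in> keys (M $ i $ j)" for i j l
        using entry[OF that] F(1)[of i] unfolding bihom_piece_eq piece_def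
        by (auto simp: degY.deg_add)
    qed
    then show "degY (left l) + degY (right l) + CARD('n) = (\<Sum>k\<in>UNIV. b k)"
      by (simp add: UNIV_option_conv sum.reindex)
  qed
  define w where "w = (\<lambda>l. lookup (det M) l * (\<Sum>p\<in>Z. \<phi> p * pmono (e p) (right l)))"
  define c where "c = (\<Sum>l\<in>keys (det M). w l)"
  have w: "degX (right l) \<ge> D1 \<and> degY (right l) \<ge> D2" if "w l \<noteq> 0" for l
    using kill[of "right l"] that by (auto simp: w_def not_le[symmetric])
  have "\<Phi> (det M) = (\<Sum>l\<in>keys (det M). single (left l + shift (right l)) (w l))"
    by (simp add: \<Phi>_def extend_def w_def)
  also have "\<dots> = (\<Sum>l\<in>keys (det M). single 0 (w l))"
  proof (rule sum.cong)
    fix l assume l: "l \<in> keys (det M)"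
    show "single (left l + shift (right l)) (w l) = single 0 (w l)"
    proof (cases "w l = 0")
      case False
      then have "degX (right l) = D1" "degY (right l) = D2" "degX (left l) = 0" "degY (left l) = 0"
        using w[of l] keys_M[OF l] a b by auto
      moreover from this have "tdeg (left l) = 0" by (simp add: tdeg_eq)
      then have "left l = 0" by (intro poly_mapping_eqI) (simp add: tdeg_def)
      ultimately show ?thesis by (simp add: shift_def)
    qed simp
  qed simp
  also have "\<dots> = const c" by (simp only: const_def c_def single_sum)
  finally have \<Phi>_det: "\<Phi> (det M) = const c" .
  show ?thesis
  proof (intro exI[of _ c] conjI ballI allI impI)
    fix q assume q: "q \<in> Z"
    have "c = (\<Sum>p\<in>Z. \<phi> p * evaluate (case_sum (e q) (e p)) (det M))"
      using evaluate_\<Phi>[OF q, of "det M"] unfolding \<Phi>_det by simp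
    also have "\<dots> = (\<Sum>p\<in>Z. if p = q then \<phi> q * evaluate (case_sum (e q) (e q)) (det M) else 0)"
    proof (rule sum.cong)
      fix p assume p: "p \<in> Z"
      show "\<phi> p * evaluate (case_sum (e q) (e p)) (det M)
        = (if p = q then \<phi> q * evaluate (case_sum (e q) (e q)) (det M) else 0)"
      proof (cases "p = q")
        case False
        then have "e p \<noteq> e q" using inj_e p q by (auto simp: inj_on_def)
        then obtain v where "e p v \<noteq> e q v" by auto
        moreover have "evaluate (case_sum (e q) (e p)) (det M * y v) = 0"
          by (rule evaluate_G[OF det_y p q])
        ultimately have "evaluate (case_sum (e q) (e p)) (det M) = 0" by (simp add: y_def)
        then show ?thesis using False by simp
      qed simp
    qed simp
    also have "\<dots> = \<phi> q * evaluate (case_sum (e q) (e q)) (det M)"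
      using q finite_Z by simp
    also have "evaluate (case_sum (e q) (e q)) (det M) = evaluate (e q) (jacobian_minor F)"
      unfolding evaluate_jacobian_minor
      by (subst hom_det[of "evaluate (case_sum (e q) (e q))"]) (simp_all add: M_def A(3))
    finally show "\<phi> q * evaluate (e q) (jacobian_minor F) = c" by simp
  next
    fix f i j assume f: "f \<in> bihom_piece i j" "\<forall>p\<in>Z. evaluate (e p) f = 0"
    have "\<Phi> (det M * (inclL f - inclR f)) = \<Phi> (inclL f * det M) - \<Phi> (inclR f * det M)"
      by (simp only: right_diff_distrib \<Phi>_diff mult.commute)
    also have "\<dots> = const c * f"
    proof -
      have "\<Phi> (inclR f * det M) = 0" by (rule \<Phi>_inclR_vanishing[OF f(1)]) (use f(2) in blast)
      then show ?thesis unfolding \<Phi>_inclL \<Phi>_det by (simp only: diff_zero mult.commute)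
    qed
    finally show "const c * f \<in> ideal_span (range F)" using \<Phi>_G[OF det_f[of f]] by simp
  next
    assume less: "(\<Sum>k\<in>UNIV. a k) < D1 + 1 \<or> (\<Sum>k\<in>UNIV. b k) < D2 + CARD('n)"
    have "w l = 0" if "l \<in> keys (det M)" for l
    proof (rule ccontr)
      assume "w l \<noteq> 0"
      from w[OF this] keys_M[OF that] less show False by auto
    qed
    then show "c = 0" by (simp add: c_def)
  qed
qed

end

section \<open>Regular sequences from independent differentials\<close>

lemma digits_less:
  fixes a :: "nat \<Rightarrow> nat"
  assumes "\<And>i. i < n \<Longrightarrow> a i < B"
  shows "(\<Sum>i<n. a i * B ^ i) < B ^ n"
  using assms
proof (induction n)
  case (Suc n)
  have "(\<Sum>i<Suc n. a i * B ^ i) < B ^ n + a n * B ^ n" using Suc by simp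
  also have "\<dots> = (1 + a n) * B ^ n" by simp
  also have "\<dots> \<le> B * B ^ n" using Suc.prems[of n] by (intro mult_right_mono) auto
  finally show ?case by simp
qed simp

lemma digits_unique:
  fixes a b :: "nat \<Rightarrow> nat"
  assumes "(\<Sum>i<n. a i * B ^ i) = (\<Sum>i<n. b i * B ^ i)"
    and "\<And>i. i < n \<Longrightarrow> a i < B" "\<And>i. i < n \<Longrightarrow> b i < B" "i < n"
  shows "a i = b i"
  using assms
proof (induction n)
  case (Suc n)
  define s where "s = (\<Sum>i<n. a i * B ^ i)"
  define t where "t = (\<Sum>i<n. b i * B ^ i)"
  have st: "s < B ^ n" "t < B ^ n" unfolding s_def t_def using Suc.prems by (auto intro!: digits_less)
  have eq: "s + a n * B ^ n = t + b n * B ^ n" using Suc.prems(1) by (simp add: s_def t_def)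
  have Bn: "B ^ n \<noteq> 0" using st by linarith
  have "a n = (s + a n * B ^ n) div B ^ n"
    by (simp only: div_mult_self1[OF Bn] div_less[OF st(1)] add_0_right)
  also have "\<dots> = b n"
    by (simp only: eq div_mult_self1[OF Bn] div_less[OF st(2)] add_0_right)
  finally have "a n = b n" .
  moreover from this have "s = t" using eq by simp
  ultimately show ?case using Suc.IH Suc.prems unfolding s_def t_def by (cases "i = n") auto
qed simp

text \<open>Substituting \<open>v \<mapsto> t\<^bsup>B\<^sup>i\<^esup>\<close>, with \<open>i\<close> the
  number of the variable \<open>v\<close> and \<open>B\<close> larger than all exponents, keeps
  distinct monomials distinct and leads to a polynomial in one variable with infinitely many zeros.\<close>

lemma evaluate_all_zero:
  fixes g :: "('v::finite, 'k::field_char_0) mpoly"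
  assumes "\<And>a. evaluate a g = 0"
  shows "g = 0"
proof -
  obtain idx where idx: "bij_betw idx (UNIV :: 'v set) {..<CARD('v)}"
    using ex_bij_betw_finite_nat[of "UNIV :: 'v set"] by (auto simp: atLeast0LessThan)
  define B where "B = Suc (\<Sum>m\<in>keys g. tdeg m)"
  define N where "N = (\<lambda>m :: 'v \<Rightarrow>\<^sub>0 nat. \<Sum>v\<in>UNIV. lookup m v * B ^ idx v)"
  have less: "lookup m v < B" if "m \<in> keys g" for m v
  proof -
    have "lookup m v \<le> tdeg m" unfolding tdeg_def by (rule member_le_sum) auto
    also have "\<dots> \<le> (\<Sum>m\<in>keys g. tdeg m)" by (rule member_le_sum) (use that in auto)
    finally show ?thesis by (simp add: B_def)
  qed
  have N_digits: "N m = (\<Sum>i<CARD('v). lookup m (inv_into UNIV idx i) * B ^ i)" for m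
    unfolding N_def
    by (rule sum.reindex_bij_witness[of _ "inv_into UNIV idx" idx])
      (use idx in \<open>auto simp: bij_betw_def inv_into_f_f f_inv_into_f intro!: f_inv_into_f\<close>)
  have inj: "m = m'" if "m \<in> keys g" "m' \<in> keys g" "N m = N m'" for m m'
  proof (rule poly_mapping_eqI)
    fix v
    have v: "idx v < CARD('v)" "inv_into UNIV idx (idx v) = v"
      using idx by (auto simp: bij_betw_def)
    have "lookup m (inv_into UNIV idx (idx v)) = lookup m' (inv_into UNIV idx (idx v))"
      by (rule digits_unique[where n = "CARD('v)" and B = B]) (use that less v N_digits in auto)
    then show "lookup m v = lookup m' v" using v by simp
  qed
  define q where "q = (\<Sum>m\<in>keys g. Polynomial.monom (lookup g m) (N m))"
  have "poly q t = evaluate (\<lambda>v. t ^ (B ^ idx v)) g" for t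
    by (simp add: q_def poly_sum poly_monom evaluate_def N_def power_sum mult.commute
        flip: power_mult)
  then have "q = 0" using assms by (simp flip: poly_all_0_iff_0)
  have "lookup g m = 0" for m
  proof (cases "m \<in> keys g")
    case True
    have "0 = Polynomial.coeff q (N m)" using \<open>q = 0\<close> by simp
    also have "\<dots> = (\<Sum>m'\<in>keys g. if m' = m then lookup g m' else 0)"
      unfolding q_def coeff_sum by (rule sum.cong) (use inj True in auto)
    finally show ?thesis using True by simp
  qed (simp add: in_keys_iff)
  then show ?thesis by (intro poly_mapping_eqI) simp
qed

interpretation cp: coeff_hom "\<lambda>c. [:c:] :: 'k::field poly"
  by unfold_locales auto

text \<open>The restriction of a polynomial to the line \<open>a + t d\<close>. Its linear coefficient is
  the derivative in the direction \<open>d\<close>.\<close>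

abbreviation on_line :: "('v::finite \<Rightarrow> 'k) \<Rightarrow> ('v \<Rightarrow> 'k) \<Rightarrow> ('v, 'k::field) mpoly \<Rightarrow> 'k poly" where
  "on_line a d \<equiv> peval (\<lambda>c. [:c:]) (\<lambda>v. [:a v, d v:])"

lemma on_line_coeff:
  "Polynomial.coeff (on_line a d f) 0 = evaluate a f \<and>
   Polynomial.coeff (on_line a d f) 1 = (\<Sum>v\<in>UNIV. d v * evaluate a (partial_deriv v f))"
proof (induction f rule: mpoly_induct)
  case (var v)
  have "(\<Sum>w\<in>UNIV. d w * evaluate a (partial_deriv w (var v))) = (\<Sum>w\<in>UNIV. if w = v then d w else 0)"
    by (rule sum.cong) auto
  then show ?case by (simp add: cp.peval_var)
next
  case (add f g)
  then show ?case by (simp add: cp.peval_add partial_deriv_add sum.distrib distrib_left)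
next
  case (mult f g)
  have "Polynomial.coeff (on_line a d f * on_line a d g) 1
    = Polynomial.coeff (on_line a d f) 0 * Polynomial.coeff (on_line a d g) 1
      + Polynomial.coeff (on_line a d f) 1 * Polynomial.coeff (on_line a d g) 0"
    by (simp add: coeff_mult)
  moreover have "(\<Sum>v\<in>UNIV. d v * evaluate a (partial_deriv v (f * g)))
    = evaluate a f * (\<Sum>v\<in>UNIV. d v * evaluate a (partial_deriv v g))
      + (\<Sum>v\<in>UNIV. d v * evaluate a (partial_deriv v f)) * evaluate a g"
    unfolding partial_deriv_mult evaluate_simps distrib_left sum.distrib sum_distrib_left sum_distrib_right
    by (simp only: ac_simps)
  ultimately show ?case
    using mult by (simp only: cp.peval_mult coeff_mult_0 evaluate_simps simp_thms)
qed (simp add: cp.peval_const)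

lemma pmono_mult: "pmono (\<lambda>i. x i * y i) \<alpha> = pmono x \<alpha> * pmono y \<alpha>"
  by (simp add: pmono_def power_mult_distrib prod.distrib)

lemma pmono_const: "pmono (\<lambda>i. x) \<alpha> = x ^ tdeg \<alpha>"
  by (simp add: pmono_def tdeg_def power_sum)

lemma hom_pmono:
  assumes "\<And>a b. h (a * b) = h a * h b" "h 1 = 1"
  shows "h (pmono x \<alpha>) = pmono (\<lambda>i. h (x i)) \<alpha>"
proof -
  have power: "h (a ^ n) = h a ^ n" for a n by (induction n) (simp_all add: assms)
  have "h (\<Prod>i\<in>A. x i ^ lookup \<alpha> i) = (\<Prod>i\<in>A. h (x i) ^ lookup \<alpha> i)" for A
    by (induction A rule: infinite_finite_induct) (simp_all add: assms power)
  then show ?thesis by (simp add: pmono_def)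
qed

text \<open>On the line through \<open>z\<close> in direction \<open>d\<close> the function \<open>f
  i\<close> is \<open>l i * t\<close> up to higher powers of \<open>t\<close>. So the coefficient of
  \<open>t\<^sup>k\<close> in the relation is \<open>g\<close>, the form with coefficients
  \<open>evaluate z (r \<alpha>)\<close>, evaluated at \<open>l\<close>; and \<open>l\<close> is
  arbitrary.\<close>

lemma lowest_coefficients_vanish:
  fixes f :: "'i::finite \<Rightarrow> ('v::finite, 'k::field_char_0) mpoly"
  assumes f: "\<And>i. evaluate z (f i) = 0"
    and d: "\<And>l. \<exists>d. \<forall>i. (\<Sum>v\<in>UNIV. d v * evaluate z (partial_deriv v (f i))) = l i"
    and A: "finite A" "(\<Sum>\<alpha>\<in>A. r \<alpha> * pmono f \<alpha>) = 0" "\<And>\<alpha>. \<alpha> \<in> A \<Longrightarrow> k \<le> tdeg \<alpha>"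
    and \<alpha>0: "\<alpha>0 \<in> A" "tdeg \<alpha>0 = k"
  shows "evaluate z (r \<alpha>0) = 0"
proof -
  define g where "g = (\<Sum>\<alpha>\<in>A. single \<alpha> (if tdeg \<alpha> = k then evaluate z (r \<alpha>) else 0))"
  have "evaluate l g = 0" for l
  proof -
    obtain d where d: "\<And>i. (\<Sum>v\<in>UNIV. d v * evaluate z (partial_deriv v (f i))) = l i"
      using assms(2) by blast
    have "\<exists>h. on_line z d (f i) = [:0, 1:] * h \<and> poly h 0 = l i" for i
    proof -
      obtain a h where h: "on_line z d (f i) = pCons a h" by (cases "on_line z d (f i)") auto
      then have "a = 0" "Polynomial.coeff h 0 = l i"
        using on_line_coeff[of z d "f i"] f[of i] d[of i] by auto
      then show ?thesis using h by (intro exI[of _ h]) (simp add: poly_0_coeff_0)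
    qed
    then obtain h where h: "\<And>i. on_line z d (f i) = [:0, 1:] * h i" "\<And>i. poly (h i) 0 = l i" by metis
    define R where "R = (\<lambda>\<alpha>. on_line z d (r \<alpha>))"
    have R0: "poly (R \<alpha>) 0 = evaluate z (r \<alpha>)" for \<alpha>
      using on_line_coeff[of z d "r \<alpha>"] by (simp add: R_def poly_0_coeff_0)
    have "0 = on_line z d (\<Sum>\<alpha>\<in>A. r \<alpha> * pmono f \<alpha>)" using A(2) by (simp add: cp.peval_zero)
    also have "\<dots> = (\<Sum>\<alpha>\<in>A. R \<alpha> * pmono (\<lambda>i. on_line z d (f i)) \<alpha>)"
      unfolding cp.peval_sum cp.peval_mult R_def
      by (subst hom_pmono[of "on_line z d"]) (simp_all add: cp.peval_mult cp.peval_one)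
    also have "\<dots> = (\<Sum>\<alpha>\<in>A. [:0, 1:] ^ k * (R \<alpha> * [:0, 1:] ^ (tdeg \<alpha> - k) * pmono h \<alpha>))"
    proof (rule sum.cong)
      fix \<alpha> assume "\<alpha> \<in> A"
      then have "[:0, 1:] ^ tdeg \<alpha> = [:0, 1 :: 'k:] ^ k * [:0, 1:] ^ (tdeg \<alpha> - k)"
        using A(3) by (simp flip: power_add)
      then show "R \<alpha> * pmono (\<lambda>i. on_line z d (f i)) \<alpha>
        = [:0, 1:] ^ k * (R \<alpha> * [:0, 1:] ^ (tdeg \<alpha> - k) * pmono h \<alpha>)"
        unfolding h(1) pmono_mult pmono_const by (simp only: ac_simps)
    qed simp
    also have "\<dots> = [:0, 1:] ^ k * (\<Sum>\<alpha>\<in>A. R \<alpha> * [:0, 1:] ^ (tdeg \<alpha> - k) * pmono h \<alpha>)"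
      by (simp only: sum_distrib_left)
    finally have "(\<Sum>\<alpha>\<in>A. R \<alpha> * [:0, 1:] ^ (tdeg \<alpha> - k) * pmono h \<alpha>) = 0"
      by simp
    then have "0 = poly (\<Sum>\<alpha>\<in>A. R \<alpha> * [:0, 1:] ^ (tdeg \<alpha> - k) * pmono h \<alpha>) 0" by simp
    also have "\<dots> = (\<Sum>\<alpha>\<in>A. (if tdeg \<alpha> = k then evaluate z (r \<alpha>) else 0) * pmono l \<alpha>)"
      unfolding poly_sum
    proof (rule sum.cong)
      fix \<alpha> assume "\<alpha> \<in> A"
      have "poly (pmono h \<alpha>) 0 = pmono l \<alpha>"
        by (subst hom_pmono[of "\<lambda>p. poly p 0"]) (simp_all add: h(2))
      then show "poly (R \<alpha> * [:0, 1:] ^ (tdeg \<alpha> - k) * pmono h \<alpha>) 0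
        = (if tdeg \<alpha> = k then evaluate z (r \<alpha>) else 0) * pmono l \<alpha>"
        using A(3)[OF \<open>\<alpha> \<in> A\<close>] by (auto simp: R0 power_0_left)
    qed simp
    also have "\<dots> = evaluate l g" unfolding g_def evaluate_sum evaluate_single ..
    finally show ?thesis by simp
  qed
  then have "g = 0" by (rule evaluate_all_zero)
  then have "0 = lookup g \<alpha>0" by simp
  also have "\<dots> = (\<Sum>\<alpha>\<in>A. if \<alpha> = \<alpha>0 then evaluate z (r \<alpha>) else 0)"
    unfolding g_def lookup_sum by (rule sum.cong) (use \<alpha>0 in \<open>auto simp: lookup_single when_def\<close>)
  also have "\<dots> = evaluate z (r \<alpha>0)" using A(1) \<alpha>0 by simp
  finally show ?thesis by simp
qed

lemma (in grading) ideal_homogeneous: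
  assumes "\<And>g. g \<in> G \<Longrightarrow> \<exists>e. g \<in> piece \<delta> e" "h \<in> ideal_span G"
  shows "hom_component \<delta> d h \<in> ideal_span G"
  using assms(2)
proof (induction rule: idl.span_induct_alt)
  case base
  show ?case by (simp add: idl.span_zero)
next
  case (step c x y)
  obtain e where e: "x \<in> piece \<delta> e" using assms(1) step(1) by blast
  have "hom_component \<delta> d (c * x) \<in> ideal_span G"
    using step(1) by (auto simp: hom_component_mult_piece[OF e] idl.span_zero intro: idl.span_scale idl.span_base)
  then show ?case unfolding hom_component_add using step by (intro idl.span_add)
qed

text \<open>Polynomials in new variables \<open>T\<^sub>i\<close>, one for each generator, with
  coefficients in the polynomial ring; this is multiplication by \<open>T\<^sub>i\<close>.\<close>

definition times_var :: "'i \<Rightarrow> (('i \<Rightarrow>\<^sub>0 nat) \<Rightarrow>\<^sub>0 'a::comm_monoid_add) \<Rightarrow> ('i \<Rightarrow>\<^sub>0 nat) \<Rightarrow>\<^sub>0 'a" where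
  "times_var i = extend (\<lambda>\<alpha> c. single (\<alpha> + single i 1) c)"

lemma times_var_simps:
  "times_var i (single \<alpha> c) = single (\<alpha> + single i 1) c"
  "times_var i (r + s) = times_var i r + times_var i s"
  unfolding times_var_def by (auto simp: extend_single extend_add single_add)

lemma lookup_times_var:
  "lookup (times_var i r) \<beta> = (if lookup \<beta> i = 0 then 0 else lookup r (\<beta> - single i 1))"
proof (induction r rule: poly_mapping_add_induct)
  case (single \<alpha> c)
  have "\<alpha> + single i 1 = \<beta> \<longleftrightarrow> \<alpha> = \<beta> - single i 1" if "lookup \<beta> i \<noteq> 0"
  proof
    assume "\<alpha> = \<beta> - single i 1"
    then show "\<alpha> + single i 1 = \<beta>" using that
      by (intro poly_mapping_eqI) (auto simp: lookup_add lookup_minus lookup_single when_def)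
  qed auto
  moreover have "\<alpha> + single i 1 \<noteq> \<beta>" if "lookup \<beta> i = 0"
    using that by (metis add_eq_0_iff_both_eq_0 lookup_add lookup_single_eq zero_neq_one)
  ultimately show ?case by (auto simp: times_var_simps lookup_single when_def)
qed (simp add: times_var_simps lookup_add)

text \<open>The differentials of the generators can be given arbitrary values simultaneously by a tangent
  direction at each point of \<open>Z\<close>, that is, they are linearly independent there. The
  generators are required to generate the full ideal of polynomials vanishing on \<open>Z\<close>.\<close>

locale independent_differentials =
  fixes Z :: "('v::finite \<Rightarrow> 'k::field_char_0) set" and f :: "'i::finite \<Rightarrow> ('v, 'k) mpoly"
    and d :: "'i \<Rightarrow> nat"
  assumes f_homogeneous: "f i \<in> piece tdeg (d i)" and d_pos: "d i \<ge> 1"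
    and generate: "ideal_span (range f) = {g. \<forall>z\<in>Z. evaluate z g = 0}"
    and independent: "z \<in> Z \<Longrightarrow> \<exists>v. \<forall>i. (\<Sum>x\<in>UNIV. v x * evaluate z (partial_deriv x (f i))) = l i"
begin

definition I :: "('v, 'k) mpoly set" where "I = ideal_span (range f)"

text \<open>A basis of \<open>I\<close> is extended by monomials to a basis of the polynomial ring. The
  span of the added monomials is a complement that contains the homogeneous components of its
  elements.\<close>

lemma monomial_complement:
  obtains C where "mp.subspace C" "C \<inter> I = {0}"
    "\<And>h D. h \<in> piece tdeg D \<Longrightarrow> \<exists>c\<in>C. h - c \<in> I \<inter> piece tdeg D"
proof -
  have sub_I: "mp.subspace I"
    unfolding I_def by (rule mp.subspaceI) (auto intro: idl.span_zero idl.span_add idl.span_scale)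
  obtain A where A: "A \<subseteq> I" "mp.independent A" "I \<subseteq> mp.span A"
    using mp.maximal_independent_subset by blast
  have span_A: "mp.span A = I" using A sub_I by (simp add: subset_antisym mp.span_minimal)
  define Mon where "Mon = range (\<lambda>m :: 'v \<Rightarrow>\<^sub>0 nat. single m (1 :: 'k))"
  obtain B where B: "A \<subseteq> B" "B \<subseteq> A \<union> Mon" "mp.independent B" "A \<union> Mon \<subseteq> mp.span B"
    using mp.maximal_independent_subset_extend[of A "A \<union> Mon"] A(2) by blast
  have span_B: "h \<in> mp.span B" for h
  proof -
    have "const (lookup h m) * single m 1 \<in> mp.span B" for m
      using B(4) by (intro mp.span_scale) (auto simp: Mon_def)
    then have "(\<Sum>m\<in>keys h. const (lookup h m) * single m 1) \<in> mp.span B"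
      by (intro mp.span_sum)
    also have "(\<Sum>m\<in>keys h. const (lookup h m) * single m 1) = (\<Sum>m\<in>keys h. single m (lookup h m))"
      by (simp add: const_def mult_single)
    finally show ?thesis by (simp add: sum_singles[symmetric])
  qed
  define C where "C = mp.span (B - A)"
  have hom_component_C: "hom_component tdeg D c \<in> C" if "c \<in> C" for c D
    using that unfolding C_def
  proof (induction rule: mp.span_induct_alt)
    case base
    show ?case by (simp add: mp.span_zero)
  next
    case (step a x y)
    then obtain m where m: "x = single m 1" using B by (auto simp: Mon_def)
    have "hom_component tdeg D (const a * x) = (if tdeg m = D then const a * x else 0)"
      unfolding m const_def mult_single by (rule poly_mapping_eqI) (auto simp: lookup_hom_component lookup_single when_def)
    then have "hom_component tdeg D (const a * x) \<in> mp.span (B - A)"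
      using step(1) by (auto intro: mp.span_zero mp.span_scale mp.span_base)
    then show ?case unfolding hom_component_add using step by (intro mp.span_add)
  qed
  show ?thesis
  proof (rule that[of C])
    show "mp.subspace C" unfolding C_def by (rule mp.subspace_span)
    have "x = 0" if "x \<in> C" "x \<in> I" for x
      by (rule mp.independent_span_Int[OF B(3) B(1)]) (use that span_A in \<open>auto simp: C_def\<close>)
    moreover have "0 \<in> C" "0 \<in> I" unfolding C_def I_def by (auto simp: mp.span_zero idl.span_zero)
    ultimately show "C \<inter> I = {0}" by blast
  next
    fix h :: "('v, 'k) mpoly" and D assume h: "h \<in> piece tdeg D"
    have "h \<in> mp.span (A \<union> (B - A))" using span_B[of h] B(1) by (simp add: Un_absorb1)
    then obtain g c where gc: "h = g + c" "g \<in> I" "c \<in> C"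
      unfolding mp.span_Un span_A C_def by blast
    have "hom_component tdeg D g + hom_component tdeg D c = h"
      using hom_component_of_piece[OF h, of D] by (simp add: gc hom_component_add)
    then have "h - hom_component tdeg D c = hom_component tdeg D g"
      using add_diff_cancel_right'[of "hom_component tdeg D g" "hom_component tdeg D c"] by simp
    moreover have "hom_component tdeg D g \<in> I"
      using tdeg.ideal_homogeneous[of "range f" g D] gc f_homogeneous unfolding I_def by blast
    ultimately show "\<exists>c\<in>C. h - c \<in> I \<inter> piece tdeg D"
      using hom_component_C[OF gc(3)] hom_component_in_piece by (intro bexI[of _ "hom_component tdeg D c"]) auto
  qed
qed

text \<open>Substitution of the generators for the new variables.\<close>

definition expand :: "(('i \<Rightarrow>\<^sub>0 nat) \<Rightarrow>\<^sub>0 ('v, 'k) mpoly) \<Rightarrow> ('v, 'k) mpoly" where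
  "expand = extend (\<lambda>\<alpha> c. c * pmono f \<alpha>)"

lemma expand_simps:
  "expand (single \<alpha> c) = c * pmono f \<alpha>" "expand (r + s) = expand r + expand s" "expand 0 = 0"
  unfolding expand_def by (auto simp: extend_single extend_add distrib_right)

lemma expand_times_var: "expand (times_var i r) = f i * expand r"
proof (induction r rule: poly_mapping_add_induct)
  case (single \<alpha> c)
  show ?case unfolding times_var_simps expand_simps pmono_add pmono_single by simp
qed (simp only: times_var_simps expand_simps distrib_left)

lemma expand_diff: "expand (r - s) = expand r - expand s"
  using expand_simps(2)[of "r - s" s] by simp

lemma expand_sum: "expand (\<Sum>i\<in>A. r i) = (\<Sum>i\<in>A. expand (r i))"
  by (induction A rule: infinite_finite_induct) (auto simp: expand_simps)

text \<open>With coefficients in a complement \<open>C\<close> of the ideal, every polynomial has an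
  expansion in powers of the generators, by induction on the degree. It is unique: in a relation,
  the coefficients of lowest order vanish on \<open>Z\<close>, so they lie in \<open>I\<close> as
  well as in \<open>C\<close>. The elements of the ideal of the \<open>f i\<close> with \<open>i
  \<in> A\<close> are those in whose expansion every power involves some \<open>i \<in> A\<close>,
  and multiplication by \<open>f k\<close> shifts expansions without affecting this condition.\<close>

lemma regular:
  assumes k: "k \<notin> A" and h: "f k * h \<in> ideal_span (f ` A)"
  shows "h \<in> ideal_span (f ` A)"
proof -
  obtain C where C: "mp.subspace C" "C \<inter> I = {0}"
    "\<And>h D. h \<in> piece tdeg D \<Longrightarrow> \<exists>c\<in>C. h - c \<in> I \<inter> piece tdeg D"
    by (rule monomial_complement) blast
  define valued where "valued = (\<lambda>r :: ('i \<Rightarrow>\<^sub>0 nat) \<Rightarrow>\<^sub>0 ('v, 'k) mpoly. \<forall>\<alpha>. lookup r \<alpha> \<in> C)"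
  have C0: "0 \<in> C" by (rule mp.subspace_0[OF C(1)])
  have valued_add: "valued (r + s)" if "valued r" "valued s" for r s
    using that mp.subspace_add[OF C(1)] by (auto simp: valued_def lookup_add)
  have valued_diff: "valued (r - s)" if "valued r" "valued s" for r s
    using that mp.subspace_diff[OF C(1)] by (auto simp: valued_def lookup_minus)
  have valued_sum: "valued (\<Sum>i\<in>S. r i)" if "\<And>i. i \<in> S \<Longrightarrow> valued (r i)" for S :: "'i set" and r
    using that by (induction S rule: infinite_finite_induct) (auto simp: valued_add, auto simp: valued_def C0)
  have valued_times: "valued (times_var i r)" if "valued r" for i r
    using that by (auto simp: valued_def lookup_times_var C0)
  have homogeneous: "\<exists>r. valued r \<and> expand r = h" if "h \<in> piece tdeg D" for h D
    using that
  proof (induction D arbitrary: h rule: less_induct)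
    case (less D)
    obtain c where c: "c \<in> C" "h - c \<in> I" "h - c \<in> piece tdeg D" using C(3)[OF less.prems] by blast
    obtain u where u: "h - c = (\<Sum>i\<in>UNIV. u i * f i)"
      using c(2) ideal_span_image[of UNIV "h - c" f] unfolding I_def by auto
    define u' where "u' = (\<lambda>i. if d i \<le> D then hom_component tdeg (D - d i) (u i) else 0)"
    have u': "h - c = (\<Sum>i\<in>UNIV. u' i * f i)"
      unfolding u'_def by (rule tdeg.homogeneous_combination[OF c(3) u f_homogeneous])
    have "\<exists>r. valued r \<and> expand r = u' i" for i
    proof (cases "d i \<le> D")
      case True
      then show ?thesis
        using less.IH[of "D - d i" "u' i"] d_pos[of i] by (simp add: u'_def hom_component_in_piece)
    next
      case False
      then show ?thesis
        by (intro exI[of _ 0]) (simp add: u'_def expand_simps valued_def C0)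
    qed
    then obtain r where r: "\<And>i. valued (r i)" "\<And>i. expand (r i) = u' i" by metis
    have "valued (single 0 c + (\<Sum>i\<in>UNIV. times_var i (r i)))"
      by (intro valued_add valued_sum valued_times r) (auto simp: valued_def lookup_single when_def c C0)
    moreover have "expand (single 0 c + (\<Sum>i\<in>UNIV. times_var i (r i))) = c + (\<Sum>i\<in>UNIV. f i * u' i)"
      by (simp add: expand_simps expand_sum expand_times_var r)
    moreover have "\<dots> = h" using u' by (simp add: mult.commute algebra_simps)
    ultimately show ?case by auto
  qed
  have expansion: "\<exists>r. valued r \<and> expand r = h" for h
  proof -
    have "\<forall>D. \<exists>r. valued r \<and> expand r = hom_component tdeg D h"
      using homogeneous[OF hom_component_in_piece] by blast
    then obtain r where r: "\<And>D. valued (r D) \<and> expand (r D) = hom_component tdeg D h" by metis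
    have "valued (\<Sum>D\<in>S. r D)" for S
      using r by (induction S rule: infinite_finite_induct) (auto simp: valued_add, auto simp: valued_def C0)
    moreover have "expand (\<Sum>D\<in>S. r D) = (\<Sum>D\<in>S. hom_component tdeg D h)" for S
      using r by (induction S rule: infinite_finite_induct) (auto simp: expand_simps)
    ultimately show ?thesis using sum_hom_component[of h tdeg] by metis
  qed
  have unique: "t = 0" if t: "valued t" "expand t = 0" for t
  proof (rule ccontr)
    assume "t \<noteq> 0"
    then have ne: "keys t \<noteq> {}" by simp
    define k where "k = Min (tdeg ` keys t)"
    have "k \<in> tdeg ` keys t" unfolding k_def using ne by (intro Min_in) auto
    then obtain \<alpha> where \<alpha>: "\<alpha> \<in> keys t" "tdeg \<alpha> = k" by auto
    have "evaluate z (lookup t \<alpha>) = 0" if z: "z \<in> Z" for z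
    proof (rule lowest_coefficients_vanish[of z f "keys t" "lookup t" k, OF _ _ finite_keys _ _ \<alpha>])
      have "f i \<in> {g. \<forall>z\<in>Z. evaluate z g = 0}" for i
        unfolding generate[symmetric] by (simp add: idl.span_base)
      then show "evaluate z (f i) = 0" for i using z by blast
      show "\<exists>d. \<forall>i. (\<Sum>v\<in>UNIV. d v * evaluate z (partial_deriv v (f i))) = l i" for l
        by (rule independent[OF z])
      show "(\<Sum>\<alpha>\<in>keys t. lookup t \<alpha> * pmono f \<alpha>) = 0"
        using t(2) by (simp add: expand_def extend_def)
      show "k \<le> tdeg \<alpha>" if "\<alpha> \<in> keys t" for \<alpha> unfolding k_def using that by (intro Min_le) auto
    qed
    then have "lookup t \<alpha> \<in> I" unfolding I_def generate by simp
    then have "lookup t \<alpha> = 0" using C(2) t(1) by (auto simp: valued_def)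
    then show False using \<alpha> by (simp add: in_keys_iff)
  qed
  obtain r where r: "valued r" "expand r = h" using expansion by blast
  \<comment> \<open>Split off the terms of the expansion that involve no \<open>f i\<close> with \<open>i \<in>
    A\<close>; these have to be zero.\<close>
  define avoid where "avoid = (\<lambda>\<alpha> :: 'i \<Rightarrow>\<^sub>0 nat. \<forall>i\<in>A. lookup \<alpha> i = 0)"
  define r1 where "r1 = Poly_Mapping.mapp (\<lambda>\<alpha> c. c when avoid \<alpha>) r"
  define r2 where "r2 = r - r1"
  have lookup_r1: "lookup r1 \<alpha> = (lookup r \<alpha> when avoid \<alpha>)" for \<alpha>
    by (auto simp: r1_def lookup_mapp when_def in_keys_iff)
  have valued_r1: "valued r1" using r C0 by (auto simp: valued_def lookup_r1 when_def)
  have r2: "expand r2 \<in> ideal_span (f ` A)"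
    unfolding expand_def extend_def
  proof (intro idl.span_sum idl.span_scale)
    fix \<alpha> assume "\<alpha> \<in> keys r2"
    then have "\<not> avoid \<alpha>" by (auto simp: in_keys_iff r2_def lookup_minus lookup_r1)
    then obtain i where i: "i \<in> A" "lookup \<alpha> i \<noteq> 0" by (auto simp: avoid_def)
    then obtain n where n: "lookup \<alpha> i = Suc n" by (cases "lookup \<alpha> i") auto
    then have "pmono f \<alpha> = (\<Prod>j\<in>UNIV - {i}. f j ^ lookup \<alpha> j) * f i ^ n * f i"
      unfolding pmono_def prod.remove[OF finite_class.finite_UNIV UNIV_I, of _ i] n power_Suc
      by (simp only: ac_simps)
    then show "pmono f \<alpha> \<in> ideal_span (f ` A)"
      using i(1) by (simp only:) (intro idl.span_scale idl.span_base imageI)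
  qed
  have "h = expand r1 + expand r2" using r(2) by (simp add: r2_def expand_diff)
  then have "f k * expand r1 = f k * h - f k * expand r2" by (simp add: algebra_simps)
  then have "f k * expand r1 \<in> ideal_span (f ` A)"
    using h r2 by (simp add: idl.span_diff idl.span_scale)
  then obtain u where u: "f k * expand r1 = (\<Sum>i\<in>A. u i * f i)"
    using ideal_span_image[of A _ f] by auto
  have "\<forall>i. \<exists>r. valued r \<and> expand r = u i" using expansion by blast
  then obtain s where s: "\<And>i. valued (s i)" "\<And>i. expand (s i) = u i" by metis
  define t where "t = times_var k r1 - (\<Sum>i\<in>A. times_var i (s i))"
  have "expand t = 0"
    unfolding t_def expand_diff expand_sum expand_times_var s u by (simp only: mult.commute diff_self)
  moreover have "valued t"
    unfolding t_def by (intro valued_diff valued_sum valued_times valued_r1 s)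
  ultimately have "t = 0" by (rule unique[rotated])
  have "lookup r1 \<alpha> = 0" for \<alpha>
  proof (cases "avoid \<alpha>")
    case True
    have "lookup (times_var i (s i)) (\<alpha> + single k 1) = 0" if "i \<in> A" for i
      using True that k by (auto simp: lookup_times_var avoid_def lookup_add lookup_single when_def)
    then have "lookup t (\<alpha> + single k 1) = lookup r1 \<alpha>"
      by (simp add: t_def lookup_minus lookup_sum lookup_times_var lookup_add)
    then show ?thesis using \<open>t = 0\<close> by simp
  qed (simp add: lookup_r1)
  then have "r1 = 0" by (intro poly_mapping_eqI) simp
  then show ?thesis using \<open>h = expand r1 + expand r2\<close> r2 by (simp add: expand_simps)
qed

end

section \<open>Spaces of functions on a finite set\<close>

definition ind :: "'p \<Rightarrow> 'p \<Rightarrow> 'k::field" where "ind p = (\<lambda>q. if q = p then 1 else 0)"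

lemma function_as_sum:
  fixes g :: "'p \<Rightarrow> 'k::field"
  assumes "finite Z" "\<And>x. x \<notin> Z \<Longrightarrow> g x = 0"
  shows "g = (\<Sum>x\<in>Z. (\<lambda>y. g x * ind x y))"
proof
  fix y
  have "(\<Sum>x\<in>Z. (\<lambda>y. g x * ind x y)) y = (\<Sum>x\<in>Z. g x * ind x y)"
    by (induction Z rule: infinite_finite_induct) auto
  also have "\<dots> = (\<Sum>x\<in>Z. if x = y then g y else 0)"
    by (rule sum.cong) (auto simp: ind_def)
  also have "\<dots> = g y" using assms by simp
  finally show "g y = (\<Sum>x\<in>Z. (\<lambda>y. g x * ind x y)) y" by simp
qed

lemma function_in_span:
  fixes g :: "'p \<Rightarrow> 'k::field"
  assumes "finite Z" "\<And>x. x \<notin> Z \<Longrightarrow> g x = 0"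
  shows "g \<in> fv.span (ind ` Z)"
proof -
  have "(\<Sum>x\<in>Z. (\<lambda>y. g x * ind x y)) \<in> fv.span (ind ` Z)"
    by (intro fv.span_sum fv.span_scale fv.span_base imageI)
  then show ?thesis using function_as_sum[OF assms] by simp
qed

text \<open>A linear map with kernel \<open>W\<close> does not annihilate \<open>ind p\<close>. The
  functional is a coordinate of this map that is nonzero on \<open>ind p\<close>, and its weights
  are its values on the functions \<open>ind x\<close>.\<close>

lemma linear_functional_avoiding:
  fixes W :: "('p \<Rightarrow> 'k::field) set"
  assumes W: "fv.subspace W" "\<And>g x. g \<in> W \<Longrightarrow> x \<notin> Z \<Longrightarrow> g x = 0" "finite Z" and p: "ind p \<notin> W"
  obtains \<phi> where "\<And>g. g \<in> W \<Longrightarrow> (\<Sum>x\<in>Z. \<phi> x * g x) = 0" "\<phi> p \<noteq> (0 :: 'k)"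
proof -
  have "\<exists>L. Vector_Spaces.linear (\<lambda>(c::'k) (f :: 'p \<Rightarrow> 'k). (\<lambda>x. c * f x)) (\<lambda>c (f :: 'p \<Rightarrow> 'k). (\<lambda>x. c * f x)) L
    \<and> (\<forall>x. L x = 0 \<longleftrightarrow> x \<in> W)"
    by (rule fv.exists_linear_with_kernel[OF W(1)])
  then obtain L where L: "Vector_Spaces.linear (\<lambda>(c::'k) (f :: 'p \<Rightarrow> 'k). (\<lambda>x. c * f x)) (\<lambda>c (f :: 'p \<Rightarrow> 'k). (\<lambda>x. c * f x)) L"
    "\<And>x. L x = 0 \<longleftrightarrow> x \<in> W" by (elim exE conjE) simp
  interpret L: Vector_Spaces.linear "\<lambda>(c::'k) (f :: 'p \<Rightarrow> 'k). (\<lambda>x. c * f x)" "\<lambda>c (f :: 'p \<Rightarrow> 'k). (\<lambda>x. c * f x)" L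
    by (rule L(1))
  have "L (ind p) \<noteq> 0" using L(2) p by simp
  then obtain x0 where x0: "L (ind p) x0 \<noteq> 0" by (auto simp: fun_eq_iff)
  show ?thesis
  proof (rule that[of "\<lambda>x. L (ind x) x0"])
    fix g assume g: "g \<in> W"
    have "0 = L g x0" using L(2)[of g] g by simp
    also have "g = (\<Sum>x\<in>Z. (\<lambda>y. g x * ind x y))" by (rule function_as_sum[OF W(3) W(2)[OF g]])
    also have "L \<dots> = (\<Sum>x\<in>Z. (\<lambda>y. g x * L (ind x) y))"
      unfolding L.sum L.scale ..
    also have "\<dots> x0 = (\<Sum>x\<in>Z. L (ind x) x0 * g x)"
      by (induction Z rule: infinite_finite_induct) auto
    finally show "(\<Sum>x\<in>Z. L (ind x) x0 * g x) = 0" by simp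
  qed (rule x0)
qed

lemma dim_eq_card_iff:
  fixes W :: "('p \<Rightarrow> 'k::field) set"
  assumes W: "fv.subspace W" "\<And>g x. g \<in> W \<Longrightarrow> x \<notin> Z \<Longrightarrow> g x = 0" "finite Z"
  shows "fv.dim W = card Z \<longleftrightarrow> (\<forall>x\<in>Z. ind x \<in> W)" and "fv.dim W \<le> card Z"
proof -
  have inj: "inj_on (ind :: 'p \<Rightarrow> 'p \<Rightarrow> 'k) Z"
    by (rule inj_onI) (metis ind_def zero_neq_one)
  obtain B where B: "B \<subseteq> W" "fv.independent B" "W \<subseteq> fv.span B" "card B = fv.dim W"
    by (rule fv.basis_exists)
  have W_sub: "W \<subseteq> fv.span (ind ` Z)" using function_in_span[OF W(3)] W(2) by blast
  have bound: "finite C \<and> card C \<le> card Z" if "fv.independent C" "C \<subseteq> fv.span (ind ` Z)"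
    for C :: "('p \<Rightarrow> 'k) set"
  proof -
    have "finite C \<and> card C \<le> card (ind ` Z :: ('p \<Rightarrow> 'k) set)"
      using fv.independent_span_bound[OF _ that] W(3) by simp
    then show ?thesis using card_image_le[OF W(3), of "ind :: 'p \<Rightarrow> 'p \<Rightarrow> 'k"] by linarith
  qed
  show le: "fv.dim W \<le> card Z" using bound[OF B(2)] B W_sub by auto
  show "fv.dim W = card Z \<longleftrightarrow> (\<forall>x\<in>Z. ind x \<in> W)"
  proof
    assume eq: "fv.dim W = card Z"
    show "\<forall>x\<in>Z. ind x \<in> W"
    proof (rule ballI, rule ccontr)
      fix x assume x: "x \<in> Z" "ind x \<notin> W"
      have "ind x \<notin> fv.span B" using x fv.span_minimal[OF B(1) W(1)] by blast
      then have ind: "fv.independent (insert (ind x) B)" "ind x \<notin> B"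
        using B(2) fv.span_base[of "ind x" B] by (auto simp: fv.independent_insert)
      have "insert (ind x) B \<subseteq> fv.span (ind ` Z)"
        using B(1) W_sub x by (auto intro: fv.span_base)
      then have "card (insert (ind x) B) \<le> card Z" "finite (insert (ind x) B)"
        using bound[OF ind(1)] by auto
      then show False using ind(2) B(4) eq by auto
    qed
  next
    assume "\<forall>x\<in>Z. ind x \<in> W"
    moreover have "fv.independent (ind ` Z :: ('p \<Rightarrow> 'k) set)"
    proof (rule fv.independent_if_scalars_zero)
      show "finite (ind ` Z)" using W(3) by simp
      fix f :: "('p \<Rightarrow> 'k) \<Rightarrow> 'k" and b :: "'p \<Rightarrow> 'k"
      assume eq: "(\<Sum>x\<in>ind ` Z. (\<lambda>y. f x * x y)) = 0" and b: "b \<in> ind ` Z"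
      then obtain z where z: "b = ind z" "z \<in> Z" by auto
      have "(\<Sum>x\<in>ind ` Z. (\<lambda>y. f x * x y)) = (\<Sum>x\<in>Z. (\<lambda>y. f (ind x) * ind x y))"
        using inj by (simp add: sum.reindex)
      then have "0 = (\<Sum>x\<in>Z. (\<lambda>y. f (ind x) * ind x y)) z" using eq by simp
      also have "\<dots> = (\<Sum>x\<in>Z. f (ind x) * ind x z)"
        by (induction Z rule: infinite_finite_induct) auto
      also have "\<dots> = (\<Sum>x\<in>Z. if x = z then f (ind z) else 0)" by (rule sum.cong) (auto simp: ind_def)
      also have "\<dots> = f b" using z W(3) by simp
      finally show "f b = 0" by simp
    qed
    ultimately have "card (ind ` Z :: ('p \<Rightarrow> 'k) set) = fv.dim W"
      using W_sub by (intro fv.basis_card_eq_dim) auto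
    then show "fv.dim W = card Z" using card_image[OF inj] by simp
  qed
qed

text \<open>Forgetting the value at \<open>p\<close> is a linear map on \<open>W\<close> whose kernel
  consists of the multiples of \<open>ind p\<close> in \<open>W\<close>.\<close>

lemma dim_remove_point:
  fixes W :: "('p \<Rightarrow> 'k::field) set"
  assumes W: "fv.subspace W" "\<And>g x. g \<in> W \<Longrightarrow> x \<notin> Z \<Longrightarrow> g x = 0" "finite Z"
  shows "fv.dim W = fv.dim ((\<lambda>g. g(p := 0)) ` W) + (if ind p \<in> W then 1 else 0)"
proof -
  have lin: "Vector_Spaces.linear (\<lambda>(c::'k) (f :: 'p \<Rightarrow> 'k). (\<lambda>x. c * f x)) (\<lambda>c (f :: 'p \<Rightarrow> 'k). (\<lambda>x. c * f x)) (\<lambda>g. g(p := 0))"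
    by (simp add: Vector_Spaces.linear_iff fv.vector_space_axioms fun_eq_iff)
  have "fv.dim {g \<in> W. g(p := 0) = 0} = (if ind p \<in> W then 1 else 0)"
  proof -
    have g: "g = (\<lambda>x. g p * ind p x)" if "g(p := 0) = 0" for g :: "'p \<Rightarrow> 'k"
    proof
      fix x
      show "g x = g p * ind p x" using fun_cong[OF that, of x] by (auto simp: ind_def split: if_splits)
    qed
    show ?thesis
    proof (cases "ind p \<in> W")
      case True
      have "fv.dim {g \<in> W. g(p := 0) = 0} = card {ind p :: 'p \<Rightarrow> 'k}"
      proof (rule fv.basis_card_eq_dim[symmetric])
        show "{ind p} \<subseteq> {g \<in> W. g(p := 0) = 0}" using True by (auto simp: ind_def)
        show "{g \<in> W. g(p := 0) = 0} \<subseteq> fv.span {ind p}"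
          using g by (auto simp: fv.span_singleton)
        show "fv.independent {ind p :: 'p \<Rightarrow> 'k}"
          by (simp add: ind_def fun_eq_iff)
      qed
      then show ?thesis using True by simp
    next
      case False
      have "g = 0" if "g \<in> W" "g(p := 0) = 0" for g
      proof (rule ccontr)
        assume "g \<noteq> 0"
        have gx: "g x = g p * ind p x" for x using fun_cong[OF g[OF that(2)], of x] .
        have gp: "g p \<noteq> 0"
        proof
          assume "g p = 0"
          then have "g x = 0" for x using gx[of x] by simp
          then show False using \<open>g \<noteq> 0\<close> by (simp add: fun_eq_iff)
        qed
        have "(\<lambda>x. inverse (g p) * g x) = ind p"
        proof
          fix x
          have "inverse (g p) * g x = inverse (g p) * (g p * ind p x)" by (simp only: gx[of x])
          also have "\<dots> = ind p x" using gp by simp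
          finally show "inverse (g p) * g x = ind p x" .
        qed
        then show False using fv.subspace_scale[OF W(1) that(1), of "inverse (g p)"] False by simp
      qed
      then have "{g \<in> W. g(p := 0) = 0} \<subseteq> {0}" by blast
      then have "fv.dim {g \<in> W. g(p := 0) = 0} = 0"
        using fv.dim_le_card[of "{g \<in> W. g(p := 0) = 0}" "{}"] by simp
      then show ?thesis using False by simp
    qed
  qed
  moreover have "W \<subseteq> fv.span (ind ` Z)" using function_in_span[OF W(3)] W(2) by blast
  ultimately show ?thesis
    using fvfv.rank_nullity[OF lin W(1), of "ind ` Z"] W(3) by simp
qed

lemma dim_eq_0_iff:
  fixes W :: "('p \<Rightarrow> 'k::field) set"
  assumes W: "\<And>g x. g \<in> W \<Longrightarrow> x \<notin> Z \<Longrightarrow> g x = 0" "finite Z"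
  shows "fv.dim W = 0 \<longleftrightarrow> W \<subseteq> {0}"
proof
  obtain B where B: "B \<subseteq> W" "fv.independent B" "W \<subseteq> fv.span B" "card B = fv.dim W"
    by (rule fv.basis_exists)
  have "W \<subseteq> fv.span (ind ` Z)" using function_in_span[OF W(2)] W(1) by blast
  then have "finite B" using fv.independent_span_bound[OF _ B(2), of "ind ` Z"] B(1) W(2) by blast
  moreover assume "fv.dim W = 0"
  ultimately have "B = {}" using B(4) by simp
  then show "W \<subseteq> {0}" using B(3) by simp
next
  assume "W \<subseteq> {0}"
  then show "fv.dim W = 0" using fv.dim_le_card[of W "{}"] by simp
qed

section \<open>Points and their coordinates\<close>

lemma homog_coords_nonempty: "\<exists>v. v \<in> homog_coords p"
  by transfer auto

lemma homog_coords_unique: "v \<in> homog_coords p \<Longrightarrow> v \<in> homog_coords q \<Longrightarrow> p = q"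
  by transfer (metis mem_Collect_eq part_equivp_proj_rel part_equivp_symp part_equivp_transp)

lemma homog_coords_scale:
  "v \<in> homog_coords p \<Longrightarrow> w \<in> homog_coords p \<Longrightarrow> \<exists>c. c \<noteq> 0 \<and> w = (\<lambda>i. c * v i)"
proof (transfer)
  fix p v w :: "'a option \<Rightarrow> 'b"
  assume "v \<in> {w. proj_rel p w}" "w \<in> {w. proj_rel p w}"
  then have "proj_rel v w"
    by (metis mem_Collect_eq part_equivp_proj_rel part_equivp_symp part_equivp_transp)
  then show "\<exists>c. c \<noteq> 0 \<and> w = (\<lambda>i. c * v i)" by (simp add: proj_rel_def)
qed

lemma homog_coords_scaled: "v \<in> homog_coords p \<Longrightarrow> c \<noteq> 0 \<Longrightarrow> (\<lambda>i. c * v i) \<in> homog_coords p"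
proof (transfer)
  fix p v :: "'a option \<Rightarrow> 'b" and c :: 'b
  assume "v \<in> {w. proj_rel p w}" "c \<noteq> 0"
  then obtain d where "p \<noteq> (\<lambda>_. 0)" "d \<noteq> 0" "v = (\<lambda>i. d * p i)" by (auto simp: proj_rel_def)
  then show "(\<lambda>i. c * v i) \<in> {w. proj_rel p w}"
    using \<open>c \<noteq> 0\<close> by (auto simp: proj_rel_def intro!: exI[of _ "c * d"])
qed

lemma homog_coords_nonzero: "v \<in> homog_coords p \<Longrightarrow> \<exists>i. v i \<noteq> 0"
proof (transfer)
  fix p v :: "'a option \<Rightarrow> 'b"
  assume "v \<in> {w. proj_rel p w}"
  then obtain d where "p \<noteq> (\<lambda>_. 0)" "d \<noteq> 0" "v = (\<lambda>i. d * p i)" by (auto simp: proj_rel_def)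
  then show "\<exists>i. v i \<noteq> 0" by (auto simp: fun_eq_iff)
qed

lemma evaluate_scaled:
  assumes "\<And>m. m \<in> keys f \<Longrightarrow> pmono c m = t"
  shows "evaluate (\<lambda>x. c x * y x) f = t * evaluate y f"
  unfolding evaluate_eq_peval peval_def extend_def sum_distrib_left
  unfolding pmono_mult by (rule sum.cong) (simp_all only: assms ac_simps)

lemma evaluate_hom_scaled: "f \<in> hom_piece i \<Longrightarrow> evaluate (\<lambda>x. c * y x) f = c ^ i * evaluate y f"
  by (rule evaluate_scaled) (auto simp: hom_piece_eq piece_def pmono_const)

lemma pmono_two_const: "pmono (case_sum (\<lambda>_. c) (\<lambda>_. d)) m = c ^ degX m * d ^ degY m"
  unfolding pmono_case_sum pmono_const by (simp add: tdeg_def degX_def degY_def lookup_left lookup_right)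

lemma evaluate_bihom_scaled:
  assumes "f \<in> bihom_piece i j"
  shows "evaluate (case_sum (\<lambda>a. c * v a) (\<lambda>b. d * w b)) f = c ^ i * d ^ j * evaluate (case_sum v w) f"
proof -
  have eq: "case_sum (\<lambda>a. c * v a) (\<lambda>b. d * w b) = (\<lambda>x. case_sum (\<lambda>_. c) (\<lambda>_. d) x * case_sum v w x)"
    by (auto simp: fun_eq_iff split: sum.split)
  show ?thesis unfolding eq
    by (rule evaluate_scaled) (use assms in \<open>auto simp: bihom_piece_eq piece_def pmono_two_const\<close>)
qed

definition affine_point :: "('m, 'k::field) proj \<Rightarrow> bool" where
  "affine_point p \<longleftrightarrow> (\<exists>v\<in>homog_coords p. v None \<noteq> 0)"

definition affine_rep :: "('m, 'k::field) proj \<Rightarrow> 'm option \<Rightarrow> 'k" where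
  "affine_rep p = (SOME v. v \<in> homog_coords p \<and> v None = 1)"

lemma affine_rep:
  assumes "affine_point p"
  shows "affine_rep p \<in> homog_coords p" "affine_rep p None = 1"
proof -
  obtain v where v: "v \<in> homog_coords p" "v None \<noteq> 0" using assms by (auto simp: affine_point_def)
  then have "(\<lambda>i. inverse (v None) * v i) \<in> homog_coords p" by (intro homog_coords_scaled) auto
  then have "\<exists>v. v \<in> homog_coords p \<and> v None = 1"
    using v by (intro exI[of _ "\<lambda>i. inverse (v None) * v i"]) auto
  from someI_ex[OF this] show "affine_rep p \<in> homog_coords p" "affine_rep p None = 1"
    by (simp_all add: affine_rep_def)
qed

lemma homog_coords_affine:
  "affine_point p \<Longrightarrow> v \<in> homog_coords p \<Longrightarrow> \<exists>c. c \<noteq> 0 \<and> v = (\<lambda>i. c * affine_rep p i)"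
  using homog_coords_scale[OF affine_rep(1)] by blast

section \<open>Forms with prescribed zeros\<close>

lemma var_piece:
  "var c \<in> piece tdeg (Suc 0)" "var (Inl a) \<in> piece degX (Suc 0)" "var (Inl a) \<in> piece degY 0"
  "var (Inr b) \<in> piece degX 0" "var (Inr b) \<in> piece degY (Suc 0)"
  by (auto simp: piece_def var_def)

lemma gradings: "grading tdeg" "grading degX" "grading degY" "grading (\<lambda>_. 0)"
  by (rule tdeg.grading_axioms degX.grading_axioms degY.grading_axioms)+ (simp add: grading_def)

lemma inX_piece:
  assumes "f \<in> hom_piece i"
  shows "(peval const (\<lambda>a. var (Inl a)) f :: ('n::finite, 'k::field) bipoly) \<in> bihom_piece i 0"
  unfolding bihom_piece_eq
proof (rule IntI)
  show "peval const (\<lambda>a. var (Inl a)) f \<in> piece degX i"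
    by (rule peval_const_piece[OF gradings(1,2)]) (use assms in \<open>auto simp: hom_piece_eq var_piece\<close>)
  show "peval const (\<lambda>a. var (Inl a)) f \<in> piece degY 0"
    by (rule peval_const_piece[OF gradings(4,3)]) (auto simp: var_piece, simp add: piece_def)
qed

lemma inY_piece:
  assumes "f \<in> hom_piece i"
  shows "(peval const (\<lambda>b. var (Inr b)) f :: ('n::finite, 'k::field) bipoly) \<in> bihom_piece 0 i"
  unfolding bihom_piece_eq
proof (rule IntI)
  show "peval const (\<lambda>b. var (Inr b)) f \<in> piece degY i"
    by (rule peval_const_piece[OF gradings(1,3)]) (use assms in \<open>auto simp: hom_piece_eq var_piece\<close>)
  show "peval const (\<lambda>b. var (Inr b)) f \<in> piece degX 0"
    by (rule peval_const_piece[OF gradings(4,2)]) (auto simp: var_piece, simp add: piece_def)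
qed

lemma product_form:
  assumes "f \<in> hom_piece i" "g \<in> hom_piece j"
  obtains h :: "('n::finite, 'k::field) bipoly" where "h \<in> bihom_piece i j"
    "\<And>v w. evaluate (case_sum v w) h = evaluate v f * evaluate w g"
proof
  show "peval const (\<lambda>a. var (Inl a)) f * peval const (\<lambda>a. var (Inr a)) g \<in> bihom_piece i j"
    using inX_piece[OF assms(1)] inY_piece[OF assms(2)]
      degX.piece_mult[of _ i _ 0] degY.piece_mult[of _ 0 _ j] by (auto simp: bihom_piece_eq)
qed (simp add: evaluate_peval_const)

lemma sliceY:
  fixes f :: "('n::finite, 'k::field) bipoly"
  assumes "f \<in> bihom_piece i j"
  obtains g where "g \<in> hom_piece j" "\<And>w. evaluate w g = evaluate (case_sum v w) f"
proof
  show "peval const (case_sum (\<lambda>a. const (v a)) var) f \<in> hom_piece j"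
    unfolding hom_piece_eq
    by (rule peval_const_piece[OF gradings(3,1)])
      (use assms in \<open>auto simp: bihom_piece_eq tdeg.piece_const var_piece split: sum.split\<close>)
  show "evaluate w (peval const (case_sum (\<lambda>a. const (v a)) var) f) = evaluate (case_sum v w) f" for w
    unfolding evaluate_peval_const by (rule arg_cong2[of _ _ _ _ evaluate]) (auto split: sum.split)
qed

lemma sliceX:
  fixes f :: "('n::finite, 'k::field) bipoly"
  assumes "f \<in> bihom_piece i j"
  obtains g where "g \<in> hom_piece i" "\<And>v. evaluate v g = evaluate (case_sum v w) f"
proof
  show "peval const (case_sum var (\<lambda>b. const (w b))) f \<in> hom_piece i"
    unfolding hom_piece_eq
    by (rule peval_const_piece[OF gradings(2,1)])
      (use assms in \<open>auto simp: bihom_piece_eq tdeg.piece_const var_piece split: sum.split\<close>)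
  show "evaluate v (peval const (case_sum var (\<lambda>b. const (w b))) f) = evaluate (case_sum v w) f" for v
    unfolding evaluate_peval_const by (rule arg_cong2[of _ _ _ _ evaluate]) (auto split: sum.split)
qed

lemma hom_piece_mult: "f \<in> hom_piece i \<Longrightarrow> g \<in> hom_piece j \<Longrightarrow> f * g \<in> hom_piece (i + j)"
  unfolding hom_piece_eq by (rule tdeg.piece_mult)

lemma bihom_piece_mult:
  "f \<in> bihom_piece i j \<Longrightarrow> g \<in> bihom_piece k l \<Longrightarrow> f * g \<in> bihom_piece (i + k) (j + l)"
  unfolding bihom_piece_eq using degX.piece_mult degY.piece_mult by blast

text \<open>The coordinate vectors of distinct points are linearly independent, so some \<open>2 \<times>
  2\<close> minor of them is nonzero; the form is this minor as a function of one of the two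
  vectors.\<close>

lemma linear_separator:
  assumes "p \<noteq> q"
  obtains l :: "('m::finite option, 'k::field) mpoly" where "l \<in> hom_piece 1"
    "\<And>v. v \<in> homog_coords p \<Longrightarrow> evaluate v l \<noteq> 0" "\<And>w. w \<in> homog_coords q \<Longrightarrow> evaluate w l = 0"
proof -
  obtain v where v: "v \<in> homog_coords p" using homog_coords_nonempty by blast
  obtain w where w: "w \<in> homog_coords q" using homog_coords_nonempty by blast
  have "\<exists>a b. w a * v b \<noteq> w b * v a"
  proof (rule ccontr)
    assume "\<not> (\<exists>a b. w a * v b \<noteq> w b * v a)"
    then have all: "w a * v b = w b * v a" for a b by blast
    obtain a where a: "w a \<noteq> 0" using homog_coords_nonzero[OF w] by blast
    then have vb: "v b = (v a / w a) * w b" for b using all[of a b] by (simp add: field_simps)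
    then have "v a / w a \<noteq> 0" using homog_coords_nonzero[OF v] by (metis mult_zero_left)
    then have "(\<lambda>b. (v a / w a) * w b) \<in> homog_coords q" by (intro homog_coords_scaled w)
    moreover have "(\<lambda>b. (v a / w a) * w b) = v" by (rule ext) (rule vb[symmetric])
    ultimately show False using homog_coords_unique v assms by metis
  qed
  then obtain a b where ab: "w a * v b \<noteq> w b * v a" by blast
  define l :: "('m option, 'k) mpoly" where "l = const (w a) * var b - const (w b) * var a"
  have "var c \<in> (hom_piece 1 :: ('m option, 'k) mpoly set)" for c
    using tdeg.piece_var[of c] by (simp add: hom_piece_eq)
  then have l: "l \<in> hom_piece 1"
    unfolding l_def hom_piece_eq by (intro piece_diff tdeg.piece_const_mult) auto
  show ?thesis
  proof (rule that[OF l])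
    fix v' assume "v' \<in> homog_coords p"
    then obtain c where "c \<noteq> 0" "v' = (\<lambda>i. c * v i)" using homog_coords_scale[OF v] by blast
    then show "evaluate v' l \<noteq> 0" using ab evaluate_hom_scaled[OF l, of c v] by (simp add: l_def)
  next
    fix w' assume "w' \<in> homog_coords q"
    then obtain c where "c \<noteq> 0" "w' = (\<lambda>i. c * w i)" using homog_coords_scale[OF w] by blast
    then show "evaluate w' l = 0" using evaluate_hom_scaled[OF l, of c w] by (simp add: l_def)
  qed
qed

lemma avoiding_form:
  assumes "finite S" "p \<notin> S"
  obtains f :: "('m::finite option, 'k::field) mpoly" where "f \<in> hom_piece (card S)"
    "\<And>v. v \<in> homog_coords p \<Longrightarrow> evaluate v f \<noteq> 0"
    "\<And>q w. q \<in> S \<Longrightarrow> w \<in> homog_coords q \<Longrightarrow> evaluate w f = 0"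
  using assms
proof (induction S arbitrary: thesis rule: finite_induct)
  case empty
  have "1 \<in> hom_piece 0" using tdeg.piece_one by (simp add: hom_piece_eq)
  then show ?case using empty(1)[of 1] by simp
next
  case (insert q S)
  obtain f :: "('m option, 'k) mpoly" where f: "f \<in> hom_piece (card S)"
    "\<And>v. v \<in> homog_coords p \<Longrightarrow> evaluate v f \<noteq> 0"
    "\<And>q w. q \<in> S \<Longrightarrow> w \<in> homog_coords q \<Longrightarrow> evaluate w f = 0"
    using insert.IH insert.prems by blast
  obtain l :: "('m option, 'k) mpoly" where l: "l \<in> hom_piece 1"
    "\<And>v. v \<in> homog_coords p \<Longrightarrow> evaluate v l \<noteq> 0" "\<And>w. w \<in> homog_coords q \<Longrightarrow> evaluate w l = 0"
    using linear_separator[of p q] insert.prems by blast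
  show ?case
    by (rule insert.prems(1)[of "l * f"])
      (use hom_piece_mult[OF l(1) f(1)] insert f l in auto)
qed

text \<open>With \<open>X\<^sub>0 = 1\<close> a binary form becomes a polynomial in one variable that
  determines the form, so it has no more zeros than its degree.\<close>

lemma binary_form_zeros:
  fixes f :: "(unit option, 'k::field) mpoly"
  assumes f: "f \<in> hom_piece a" "f \<noteq> 0" and S: "finite S" "\<And>p. p \<in> S \<Longrightarrow> affine_point p"
    "\<And>p. p \<in> S \<Longrightarrow> evaluate (affine_rep p) f = 0"
  shows "card S \<le> a"
proof -
  define q where "q = (\<Sum>m\<in>keys f. Polynomial.monom (lookup f m) (lookup m (Some ())))"
  have m: "lookup m None + lookup m (Some ()) = a" if "m \<in> keys f" for m
    using f(1) that by (auto simp: hom_piece_def UNIV_option_conv UNIV_unit)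
  have inj: "m = m'" if "m \<in> keys f" "m' \<in> keys f" "lookup m (Some ()) = lookup m' (Some ())" for m m'
  proof (rule poly_mapping_eqI)
    fix x show "lookup m x = lookup m' x"
      using m[OF that(1)] m[OF that(2)] that(3) by (cases x) auto
  qed
  obtain m where m0: "m \<in> keys f" using f(2) by fastforce
  have "Polynomial.coeff q (lookup m (Some ())) = (\<Sum>m'\<in>keys f. if m' = m then lookup f m' else 0)"
    unfolding q_def coeff_sum by (rule sum.cong) (use inj m0 in auto)
  also have "\<dots> = lookup f m" using m0 by simp
  finally have "q \<noteq> 0" using m0 by (auto simp: in_keys_iff)
  have deg: "Polynomial.degree q \<le> a"
    unfolding q_def
  proof (rule degree_sum_le)
    fix m assume "m \<in> keys f"
    then show "Polynomial.degree (Polynomial.monom (lookup f m) (lookup m (Some ()))) \<le> a"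
      using m[of m] degree_monom_le[of "lookup f m" "lookup m (Some ())"] by linarith
  qed simp
  have q: "poly q (affine_rep p (Some ())) = evaluate (affine_rep p) f" if "p \<in> S" for p
    using affine_rep(2)[OF S(2)[OF that]]
    by (simp add: q_def poly_sum poly_monom evaluate_def UNIV_option_conv UNIV_unit)
  have "inj_on (\<lambda>p. affine_rep p (Some ())) S"
  proof (rule inj_onI)
    fix p p' assume p: "p \<in> S" "p' \<in> S" "affine_rep p (Some ()) = affine_rep p' (Some ())"
    have "affine_rep p = affine_rep p'"
    proof
      fix x show "affine_rep p x = affine_rep p' x"
        using p affine_rep(2)[OF S(2)] by (cases x) auto
    qed
    then show "p = p'" using homog_coords_unique affine_rep(1)[OF S(2)] p by metis
  qed
  then have "card S = card ((\<lambda>p. affine_rep p (Some ())) ` S)" by (simp add: card_image)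
  also have "\<dots> \<le> card {x. poly q x = 0}"
    using poly_roots_finite[OF \<open>q \<noteq> 0\<close>] q S(3) by (intro card_mono) auto
  also have "\<dots> \<le> a" using card_poly_roots_bound[OF \<open>q \<noteq> 0\<close>] deg by linarith
  finally show ?thesis .
qed

section \<open>Hilbert functions and separators\<close>

text \<open>The functions are extended by zero, so that the spaces for a set and for its subsets consist
  of functions on the same type.\<close>

definition value_space ::
  "'p set \<Rightarrow> ('p \<Rightarrow> 'v::finite \<Rightarrow> 'k::field) \<Rightarrow> ('v, 'k) mpoly set \<Rightarrow> ('p \<Rightarrow> 'k) set" where
  "value_space Z e V = (\<lambda>f P. if P \<in> Z then evaluate (e P) f else 0) ` V"

definition separable ::
  "'p set \<Rightarrow> ('p \<Rightarrow> 'v::finite \<Rightarrow> 'k::field) \<Rightarrow> ('v, 'k) mpoly set \<Rightarrow> 'p \<Rightarrow> bool" where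
  "separable Z e V P \<longleftrightarrow> (\<exists>f\<in>V. evaluate (e P) f \<noteq> 0 \<and> (\<forall>Q\<in>Z - {P}. evaluate (e Q) f = 0))"

lemma linear_values:
  "Vector_Spaces.linear (\<lambda>c f. const c * f) (\<lambda>c (g :: 'p \<Rightarrow> 'k::field). (\<lambda>x. c * g x))
    (\<lambda>f P. if P \<in> Z then evaluate (e P) f else 0)"
  by (simp add: Vector_Spaces.linear_iff mp.vector_space_axioms fv.vector_space_axioms fun_eq_iff)

lemma value_space_subspace:
  fixes V :: "('v::finite, 'k::field) mpoly set" and e :: "'p \<Rightarrow> 'v \<Rightarrow> 'k"
  assumes "mp.subspace V"
  shows "fv.subspace (value_space Z e V)"
proof -
  interpret Vector_Spaces.linear "\<lambda>c f. const c * f" "\<lambda>c (g :: 'p \<Rightarrow> 'k). (\<lambda>x. c * g x)"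
    "\<lambda>f P. if P \<in> Z then evaluate (e P) f else 0"
    by (rule linear_values)
  show ?thesis unfolding value_space_def by (rule subspace_image[OF assms])
qed

lemma value_space_outside: "g \<in> value_space Z e V \<Longrightarrow> x \<notin> Z \<Longrightarrow> g x = 0"
  by (auto simp: value_space_def)

lemma value_space_remove:
  "value_space (Z - {P}) e V = (\<lambda>g. g(P := 0)) ` value_space Z e V"
  unfolding value_space_def image_image by (rule image_cong) (auto simp: fun_eq_iff)

lemma ind_in_value_space:
  assumes "mp.subspace V" "P \<in> Z"
  shows "ind P \<in> value_space Z e V \<longleftrightarrow> separable Z e V P"
proof
  assume "ind P \<in> value_space Z e V"
  then obtain f where f: "f \<in> V" "ind P = (\<lambda>Q. if Q \<in> Z then evaluate (e Q) f else 0)"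
    by (auto simp: value_space_def)
  have "evaluate (e Q) f = (if Q = P then 1 else 0)" if "Q \<in> Z" for Q
    using fun_cong[OF f(2), of Q] that by (simp add: ind_def)
  then show "separable Z e V P" unfolding separable_def using f(1) assms(2) by (intro bexI[of _ f]) auto
next
  assume "separable Z e V P"
  then obtain f where f: "f \<in> V" "evaluate (e P) f \<noteq> 0" "\<And>Q. Q \<in> Z - {P} \<Longrightarrow> evaluate (e Q) f = 0"
    by (auto simp: separable_def)
  define g where "g = const (inverse (evaluate (e P) f)) * f"
  have "g \<in> V" unfolding g_def using mp.subspace_scale[OF assms(1) f(1)] .
  moreover have "ind P = (\<lambda>Q. if Q \<in> Z then evaluate (e Q) g else 0)"
    using f assms(2) by (auto simp: ind_def g_def fun_eq_iff)
  ultimately show "ind P \<in> value_space Z e V" by (auto simp: value_space_def)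
qed

lemma subspace_pieces:
  "mp.subspace (piece \<delta> d)" "mp.subspace (hom_piece d)" "mp.subspace (bihom_piece i j)"
proof -
  have piece: "mp.subspace (piece \<delta> d)" for \<delta> :: "('w \<Rightarrow>\<^sub>0 nat) \<Rightarrow> nat" and d
  proof (rule mp.subspaceI)
    fix c and f :: "('w, 'z::field) mpoly" assume "f \<in> piece \<delta> d"
    moreover have "lookup (const c * f) m = c * lookup f m" for m
    proof (induction f rule: poly_mapping_add_induct)
      case (single k d)
      show ?case by (simp add: const_def mult_single lookup_single when_def)
    qed (simp add: distrib_left lookup_add)
    ultimately show "const c * f \<in> piece \<delta> d" by (auto simp: piece_def in_keys_iff)
  qed (auto intro: piece_add)
  show "mp.subspace (piece \<delta> d)" "mp.subspace (hom_piece d)" by (simp_all add: hom_piece_eq piece)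
  show "mp.subspace (bihom_piece i j)" unfolding bihom_piece_eq by (intro mp.subspace_inter piece)
qed

lemma dim_value_space_residues:
  fixes I :: "('v::finite, 'k::field) mpoly set"
  assumes "is_ideal I" "1 \<notin> I" "mp.subspace V" "finite Z"
    "\<And>f. f \<in> V \<Longrightarrow> (\<forall>P\<in>Z. evaluate (e P) f = 0) \<longleftrightarrow> f \<in> I"
  shows "ring.dim (residue_ring_of I) (range (\<lambda>c. residue_of I (const c))) (residue_of I ` V)
    = fv.dim (value_space Z e V)"
  unfolding value_space_def
proof (rule residue_dim[OF assms(1,2) linear_values assms(3)])
  show "(\<lambda>P. if P \<in> Z then evaluate (e P) f else 0) = 0 \<longleftrightarrow> f \<in> I" if "f \<in> V" for f
    using assms(5)[OF that] by (auto simp: fun_eq_iff)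
  show "(\<lambda>f P. if P \<in> Z then evaluate (e P) f else 0) ` V \<subseteq> fv.span (ind ` Z)"
  proof
    fix g assume "g \<in> (\<lambda>f P. if P \<in> Z then evaluate (e P) f else 0) ` V"
    then have "g x = 0" if "x \<notin> Z" for x using that by auto
    then show "g \<in> fv.span (ind ` Z)" by (rule function_in_span[OF assms(4)])
  qed
  show "finite (ind ` Z)" using assms(4) by simp
qed

definition rep2 :: "('n, 'k::field) bipoint \<Rightarrow> unit option + 'n option \<Rightarrow> 'k" where
  "rep2 P = case_sum (affine_rep (fst P)) (affine_rep (snd P))"

abbreviation bisep :: "('n::finite, 'k::field) bipoint set \<Rightarrow> nat \<Rightarrow> nat \<Rightarrow> ('n, 'k) bipoint \<Rightarrow> bool" where
  "bisep Z i j \<equiv> separable Z rep2 (bihom_piece i j)"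

abbreviation sep :: "('m::finite, 'k::field) proj set \<Rightarrow> nat \<Rightarrow> ('m, 'k) proj \<Rightarrow> bool" where
  "sep S j \<equiv> separable S affine_rep (hom_piece j)"

lemma bivanishing_ideal_eq: "bivanishing_ideal Z = ideal_span {f. bihomogeneous f \<and>
    (\<forall>(p, q)\<in>Z. \<forall>v\<in>homog_coords p. \<forall>w\<in>homog_coords q. evaluate (case_sum v w) f = 0)}"
  unfolding bivanishing_ideal_def genideal_eq ..

lemma is_ideal_bivanishing: "is_ideal (bivanishing_ideal Z)"
  unfolding bivanishing_ideal_eq by (rule idl.subspace_span)

lemma bivanishing_evaluate:
  assumes "f \<in> bivanishing_ideal Z" "(p, q) \<in> Z" "v \<in> homog_coords p" "w \<in> homog_coords q"
  shows "evaluate (case_sum v w) f = 0"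
  using assms(1) unfolding bivanishing_ideal_eq
proof (induction rule: idl.span_induct_alt)
  case (step c x y)
  then have "evaluate (case_sum v w) x = 0" using assms by blast
  then show ?case using step by simp
qed simp

text \<open>Finite sets of points at which neither \<open>X\<^sub>0\<close> nor \<open>Y\<^sub>0\<close>
  vanishes. The representative \<open>rep2 P\<close> has the value \<open>1\<close> in both of these
  coordinates.\<close>

locale affine_points =
  fixes Z :: "('n::finite, 'k::field) bipoint set"
  assumes finite_Z: "finite Z" and nonempty: "Z \<noteq> {}"
    and affine: "\<And>P. P \<in> Z \<Longrightarrow> affine_point (fst P) \<and> affine_point (snd P)"
begin

lemma rep2_X0: "P \<in> Z \<Longrightarrow> rep2 P (Inl None) = 1"
  and rep2_Y0: "P \<in> Z \<Longrightarrow> rep2 P (Inr None) = 1"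
  using affine[of P] affine_rep(2)[of "fst P"] affine_rep(2)[of "snd P"] by (simp_all add: rep2_def)

lemma inj_rep2: "inj_on rep2 Z"
proof (rule inj_onI)
  fix P Q assume PQ: "P \<in> Z" "Q \<in> Z" "rep2 P = rep2 Q"
  have "affine_rep (fst P) = affine_rep (fst Q)" "affine_rep (snd P) = affine_rep (snd Q)"
    using PQ(3) by (auto simp: rep2_def fun_eq_iff split: sum.splits)
  then have "fst P = fst Q" "snd P = snd Q"
    using homog_coords_unique affine_rep(1) affine PQ(1,2) by metis+
  then show "P = Q" by (rule prod_eqI)
qed

text \<open>Other coordinates of the same point change the value of a bihomogeneous form by a nonzero
  factor only.\<close>

lemma vanishing_on_reps:
  assumes "f \<in> bihom_piece i j"
  shows "(\<forall>(p, q)\<in>Z. \<forall>v\<in>homog_coords p. \<forall>w\<in>homog_coords q. evaluate (case_sum v w) f = 0)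
    \<longleftrightarrow> (\<forall>P\<in>Z. evaluate (rep2 P) f = 0)"
proof
  assume *: "\<forall>(p, q)\<in>Z. \<forall>v\<in>homog_coords p. \<forall>w\<in>homog_coords q. evaluate (case_sum v w) f = 0"
  show "\<forall>P\<in>Z. evaluate (rep2 P) f = 0"
  proof
    fix P assume P: "P \<in> Z"
    have "affine_rep (fst P) \<in> homog_coords (fst P)" "affine_rep (snd P) \<in> homog_coords (snd P)"
      using affine[OF P] affine_rep(1) by auto
    then show "evaluate (rep2 P) f = 0"
      using bspec[OF * P] unfolding rep2_def case_prod_unfold by blast
  qed
next
  assume *: "\<forall>P\<in>Z. evaluate (rep2 P) f = 0"
  show "\<forall>(p, q)\<in>Z. \<forall>v\<in>homog_coords p. \<forall>w\<in>homog_coords q. evaluate (case_sum v w) f = 0"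
  proof (clarify)
    fix p q v w assume pq: "(p, q) \<in> Z" "v \<in> homog_coords p" "w \<in> homog_coords q"
    then have "affine_point p" "affine_point q" using affine by force+
    then obtain c d where "v = (\<lambda>i. c * affine_rep p i)" "w = (\<lambda>i. d * affine_rep q i)"
      using homog_coords_affine pq(2,3) by metis
    then have "evaluate (case_sum v w) f = c ^ i * d ^ j * evaluate (rep2 (p, q)) f"
      using evaluate_bihom_scaled[OF assms, of c "affine_rep p" d "affine_rep q"] by (simp add: rep2_def)
    then show "evaluate (case_sum v w) f = 0" using * pq(1) by simp
  qed
qed

lemma ideal_evaluate: "f \<in> bivanishing_ideal Z \<Longrightarrow> P \<in> Z \<Longrightarrow> evaluate (rep2 P) f = 0"
  using bivanishing_evaluate[of f Z "fst P" "snd P" "affine_rep (fst P)" "affine_rep (snd P)"]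
    affine[of P] affine_rep(1)[of "fst P"] affine_rep(1)[of "snd P"] by (simp add: rep2_def)

lemma one_notin_ideal: "1 \<notin> bivanishing_ideal Z"
  using nonempty ideal_evaluate[of 1] by auto

lemma bihom_in_ideal:
  assumes "f \<in> bihom_piece i j"
  shows "f \<in> bivanishing_ideal Z \<longleftrightarrow> (\<forall>P\<in>Z. evaluate (rep2 P) f = 0)"
proof
  assume "\<forall>P\<in>Z. evaluate (rep2 P) f = 0"
  then have "\<forall>(p, q)\<in>Z. \<forall>v\<in>homog_coords p. \<forall>w\<in>homog_coords q. evaluate (case_sum v w) f = 0"
    using vanishing_on_reps[OF assms] by blast
  then show "f \<in> bivanishing_ideal Z"
    unfolding bivanishing_ideal_eq using assms
    by (intro idl.span_base CollectI conjI) (auto simp: bihomogeneous_def)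
qed (use ideal_evaluate in blast)

lemma HF_eq: "HF Z i j = fv.dim (value_space Z rep2 (bihom_piece i j))"
proof -
  have "carrier (coord_ring Z) \<inter> residue_of (bivanishing_ideal Z) ` bihom_piece i j
      = residue_of (bivanishing_ideal Z) ` bihom_piece i j"
    unfolding coord_ring_def residue_ring(2)[OF is_ideal_bivanishing] by auto
  then show ?thesis
    unfolding HF_def HF_module_def piece_dim_def
    using dim_value_space_residues[OF is_ideal_bivanishing one_notin_ideal subspace_pieces(3) finite_Z
        bihom_in_ideal[symmetric]] by simp
qed

lemma HF_remove:
  assumes "P \<in> Z" "Z \<noteq> {P}"
  shows "HF Z i j = HF (Z - {P}) i j + (if bisep Z i j P then 1 else 0)"
proof -
  interpret Z': affine_points "Z - {P}"
    using finite_Z nonempty affine assms by unfold_locales auto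
  show ?thesis
    unfolding HF_eq Z'.HF_eq value_space_remove ind_in_value_space[OF subspace_pieces(3) assms(1), symmetric]
    by (rule dim_remove_point[OF value_space_subspace[OF subspace_pieces(3)] _ finite_Z])
      (rule value_space_outside)
qed

text \<open>By \<open>HF_remove\<close> the Hilbert function of the complement of \<open>P\<close> records
  the degrees in which \<open>P\<close> has a separator.\<close>

lemma cayley_bacharach_iff:
  "cayley_bacharach Z \<longleftrightarrow> (\<forall>P\<in>Z. \<forall>Q\<in>Z. \<forall>i j. bisep Z i j P \<longleftrightarrow> bisep Z i j Q)"
proof (cases "\<exists>P. Z = {P}")
  case True
  \<comment> \<open>Here the complement of the point is empty and \<open>HF_remove\<close> does not apply.\<close>
  then show ?thesis by (auto simp: cayley_bacharach_def)
next
  case False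
  have "HF (Z - {P}) = HF (Z - {Q}) \<longleftrightarrow> (\<forall>i j. bisep Z i j P \<longleftrightarrow> bisep Z i j Q)"
    if PQ: "P \<in> Z" "Q \<in> Z" for P Q
  proof -
    have "Z \<noteq> {P}" "Z \<noteq> {Q}" using False by blast+
    then have "HF (Z - {P}) i j = HF (Z - {Q}) i j \<longleftrightarrow> (bisep Z i j P \<longleftrightarrow> bisep Z i j Q)" for i j
      using HF_remove[OF PQ(1), of i j] HF_remove[OF PQ(2), of i j] by (auto split: if_splits)
    then show ?thesis unfolding fun_eq_iff by blast
  qed
  then show ?thesis unfolding cayley_bacharach_def by blast
qed

text \<open>The dimension of a piece of the different is that of the space of values at the points of the
  forms that represent it.\<close>

lemma different_nonzero_iff:
  "HF_module Z (kaehler_different Z Fs) i j \<noteq> 0 \<longleftrightarrow>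
    (\<exists>f\<in>bihom_piece i j. f \<in> ideal_span (bivanishing_ideal Z \<union> {jacobian_minor r | r. range r \<subseteq> Fs}) \<and>
      (\<exists>P\<in>Z. evaluate (rep2 P) f \<noteq> 0))"
proof -
  define I where "I = bivanishing_ideal Z"
  define G where "G = {jacobian_minor r | r. range r \<subseteq> Fs}"
  define V where "V = bihom_piece i j \<inter> ideal_span (I \<union> G)"
  have I: "is_ideal I" "1 \<notin> I" unfolding I_def by (rule is_ideal_bivanishing one_notin_ideal)+
  have "kaehler_different Z Fs = Idl\<^bsub>residue_ring_of I\<^esub> (residue_of I ` G)"
    unfolding kaehler_different_def coord_ring_def I_def G_def
    by (rule arg_cong[of _ _ "genideal _"]) auto
  then have M: "residue_of I f \<in> kaehler_different Z Fs \<longleftrightarrow> f \<in> ideal_span (I \<union> G)" for f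
    using residue_genideal[OF I(1)] by simp
  have "kaehler_different Z Fs \<inter> residue_of I ` bihom_piece i j = residue_of I ` V"
    unfolding V_def using M by auto
  moreover have sub: "mp.subspace V"
    unfolding V_def
  proof (intro mp.subspace_inter subspace_pieces)
    show "mp.subspace (ideal_span (I \<union> G))"
      by (rule mp.subspaceI) (auto intro: idl.span_zero idl.span_add idl.span_scale)
  qed
  moreover have "(\<forall>P\<in>Z. evaluate (rep2 P) f = 0) \<longleftrightarrow> f \<in> I" if "f \<in> V" for f
    using bihom_in_ideal[of f i j] that by (auto simp: V_def I_def)
  ultimately have "HF_module Z (kaehler_different Z Fs) i j = fv.dim (value_space Z rep2 V)"
    unfolding HF_module_def piece_dim_def I_def[symmetric]
    using dim_value_space_residues[OF I, of V Z rep2] finite_Z by simp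
  also have "\<dots> \<noteq> 0 \<longleftrightarrow> \<not> value_space Z rep2 V \<subseteq> {0}"
  proof -
    have "fv.dim (value_space Z rep2 V) = 0 \<longleftrightarrow> value_space Z rep2 V \<subseteq> {0}"
      by (rule dim_eq_0_iff[OF _ finite_Z]) (rule value_space_outside)
    then show ?thesis by simp
  qed
  also have "\<dots> \<longleftrightarrow> (\<exists>f\<in>V. \<exists>P\<in>Z. evaluate (rep2 P) f \<noteq> 0)"
    unfolding value_space_def image_subset_iff by (auto simp: fun_eq_iff)
  finally show ?thesis unfolding V_def I_def G_def by blast
qed

end

lemma vanishing_ideal_eq: "vanishing_ideal S = ideal_span
    {f. (\<exists>i. f \<in> hom_piece i) \<and> (\<forall>p\<in>S. \<forall>v\<in>homog_coords p. evaluate v f = 0)}"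
  unfolding vanishing_ideal_def genideal_eq ..

locale affine_proj_points =
  fixes S :: "('m::finite, 'k::field) proj set"
  assumes finite_S: "finite S" and nonempty: "S \<noteq> {}"
    and affine: "\<And>p. p \<in> S \<Longrightarrow> affine_point p"
begin

lemma ideal_evaluate:
  assumes "f \<in> vanishing_ideal S" "p \<in> S"
  shows "evaluate (affine_rep p) f = 0"
  using assms(1) unfolding vanishing_ideal_eq
proof (induction rule: idl.span_induct_alt)
  case (step c x y)
  then have "evaluate (affine_rep p) x = 0" using assms(2) affine_rep(1)[OF affine[OF assms(2)]] by blast
  then show ?case using step by simp
qed simp

lemma hom_in_ideal:
  assumes "f \<in> hom_piece i"
  shows "(\<forall>p\<in>S. evaluate (affine_rep p) f = 0) \<longleftrightarrow> f \<in> vanishing_ideal S"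
proof
  assume *: "\<forall>p\<in>S. evaluate (affine_rep p) f = 0"
  have "evaluate v f = 0" if pv: "p \<in> S" "v \<in> homog_coords p" for p v
  proof -
    obtain c where "v = (\<lambda>i. c * affine_rep p i)" using homog_coords_affine[OF affine[OF pv(1)] pv(2)] by blast
    then show ?thesis using evaluate_hom_scaled[OF assms, of c "affine_rep p"] * that by simp
  qed
  then show "f \<in> vanishing_ideal S" unfolding vanishing_ideal_eq using assms by (auto intro!: idl.span_base)
qed (use ideal_evaluate in blast)

lemma HF_proj_eq: "HF_proj S i = fv.dim (value_space S affine_rep (hom_piece i))"
proof -
  have I: "is_ideal (vanishing_ideal S)" unfolding vanishing_ideal_eq by (rule idl.subspace_span)
  have "1 \<notin> vanishing_ideal S" using nonempty ideal_evaluate[of 1] by auto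
  moreover have "carrier (residue_ring_of (vanishing_ideal S)) \<inter> residue_of (vanishing_ideal S) ` hom_piece i
      = residue_of (vanishing_ideal S) ` hom_piece i"
    unfolding residue_ring(2)[OF I] by auto
  ultimately show ?thesis
    unfolding HF_proj_def piece_dim_def
    using dim_value_space_residues[OF I _ subspace_pieces(2) finite_S hom_in_ideal] by simp
qed

lemma HF_proj_eq_card_iff: "HF_proj S i = card S \<longleftrightarrow> (\<forall>p\<in>S. sep S i p)"
proof -
  have "HF_proj S i = card S \<longleftrightarrow> (\<forall>p\<in>S. ind p \<in> value_space S affine_rep (hom_piece i))"
    unfolding HF_proj_eq
    by (rule dim_eq_card_iff(1)[OF value_space_subspace[OF subspace_pieces(2)] _ finite_S])
      (rule value_space_outside)
  moreover have "ind p \<in> value_space S affine_rep (hom_piece i) \<longleftrightarrow> sep S i p" if "p \<in> S" for p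
    using that by (rule ind_in_value_space[OF subspace_pieces(2)])
  ultimately show ?thesis by auto
qed

lemma sep_mono:
  assumes "sep S i p" "p \<in> S" "i \<le> j"
  shows "sep S j p"
proof -
  obtain f where f: "f \<in> hom_piece i" "evaluate (affine_rep p) f \<noteq> 0"
    "\<forall>q\<in>S - {p}. evaluate (affine_rep q) f = 0" using assms(1) by (auto simp: separable_def)
  have "var None ^ (j - i) \<in> hom_piece (j - i)"
    using tdeg.piece_power[OF var_piece(1)] by (simp add: hom_piece_eq)
  from hom_piece_mult[OF this f(1)] have "var None ^ (j - i) * f \<in> hom_piece j" using assms(3) by simp
  then show ?thesis
    unfolding separable_def using f affine_rep(2)[OF affine] assms(2)
    by (intro bexI[of _ "var None ^ (j - i) * f"]) auto
qed

lemma sep_large: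
  assumes "p \<in> S"
  shows "sep S (card S - 1) p"
proof -
  obtain f :: "('m option, 'k) mpoly" where f: "f \<in> hom_piece (card (S - {p}))"
    "\<And>v. v \<in> homog_coords p \<Longrightarrow> evaluate v f \<noteq> 0"
    "\<And>q w. q \<in> S - {p} \<Longrightarrow> w \<in> homog_coords q \<Longrightarrow> evaluate w f = 0"
    by (rule avoiding_form[of "S - {p}" p]) (use finite_S in auto)
  then show ?thesis
    unfolding separable_def using assms finite_S affine_rep(1)[OF affine]
    by (intro bexI[of _ f]) auto
qed

text \<open>The Hilbert function reaches the number of points exactly in the degrees in which all points
  have separators, and multiplication by \<open>X\<^sub>0\<close> shows that these degrees are
  closed upwards.\<close>

lemma regularity_index_sep: "p \<in> S \<Longrightarrow> sep S (regularity_index S) p"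
  and regularity_index_below: "i < regularity_index S \<Longrightarrow> \<exists>p\<in>S. \<not> sep S i p"
proof -
  have "\<forall>i\<ge>card S - 1. HF_proj S i = card S"
    using HF_proj_eq_card_iff sep_mono sep_large by blast
  then have "\<forall>i\<ge>regularity_index S. HF_proj S i = card S"
    unfolding regularity_index_def by (rule LeastI)
  then show "p \<in> S \<Longrightarrow> sep S (regularity_index S) p" using HF_proj_eq_card_iff by blast
  show "\<exists>p\<in>S. \<not> sep S i p" if i: "i < regularity_index S"
  proof (rule ccontr)
    assume "\<not> (\<exists>p\<in>S. \<not> sep S i p)"
    then have "\<forall>j\<ge>i. HF_proj S j = card S" using HF_proj_eq_card_iff sep_mono by blast
    then have "regularity_index S \<le> i" unfolding regularity_index_def by (rule Least_le)
    then show False using i by simp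
  qed
qed

end

sublocale affine_points \<subseteq> fst: affine_proj_points "fst ` Z"
  using finite_Z nonempty affine by unfold_locales auto

sublocale affine_points \<subseteq> snd: affine_proj_points "snd ` Z"
  using finite_Z nonempty affine by unfold_locales auto

section \<open>Regular coordinates avoid the points\<close>

lemma ideal_bihom_components:
  assumes "h \<in> bivanishing_ideal Z"
  shows "hom_component degX i (hom_component degY j h) \<in> bivanishing_ideal Z"
proof -
  define G where "G = {f. bihomogeneous f \<and>
    (\<forall>(p, q)\<in>Z. \<forall>v\<in>homog_coords p. \<forall>w\<in>homog_coords q. evaluate (case_sum v w) f = 0)}"
  have G: "\<exists>e. g \<in> piece degX e" "\<exists>e. g \<in> piece degY e" if "g \<in> G" for g
    using that by (auto simp: G_def bihomogeneous_def bihom_piece_eq)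
  have "hom_component degY j h \<in> ideal_span G"
    using degY.ideal_homogeneous[of G h j] G(2) assms unfolding bivanishing_ideal_eq G_def by blast
  then have "hom_component degX i (hom_component degY j h) \<in> ideal_span G"
    using degX.ideal_homogeneous[of G "hom_component degY j h" i] G(1) by blast
  then show ?thesis unfolding bivanishing_ideal_eq G_def .
qed

lemma general_separator:
  fixes Z :: "('n::finite, 'k::field) bipoint set"
  assumes "finite Z" "(p, q) \<in> Z"
  obtains f i j where "f \<in> bihom_piece i j"
    "\<And>v w. v \<in> homog_coords p \<Longrightarrow> w \<in> homog_coords q \<Longrightarrow> evaluate (case_sum v w) f \<noteq> 0"
    "\<And>p' q' v w. (p', q') \<in> Z - {(p, q)} \<Longrightarrow> v \<in> homog_coords p' \<Longrightarrow> w \<in> homog_coords q'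
      \<Longrightarrow> evaluate (case_sum v w) f = 0"
proof -
  obtain f :: "(unit option, 'k) mpoly" where f: "f \<in> hom_piece (card (fst ` Z - {p}))"
    "\<And>v. v \<in> homog_coords p \<Longrightarrow> evaluate v f \<noteq> 0"
    "\<And>p' w. p' \<in> fst ` Z - {p} \<Longrightarrow> w \<in> homog_coords p' \<Longrightarrow> evaluate w f = 0"
    by (rule avoiding_form[of "fst ` Z - {p}" p]) (use assms in auto)
  obtain g :: "('n option, 'k) mpoly" where g: "g \<in> hom_piece (card (snd ` Z - {q}))"
    "\<And>v. v \<in> homog_coords q \<Longrightarrow> evaluate v g \<noteq> 0"
    "\<And>q' w. q' \<in> snd ` Z - {q} \<Longrightarrow> w \<in> homog_coords q' \<Longrightarrow> evaluate w g = 0"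
    by (rule avoiding_form[of "snd ` Z - {q}" q]) (use assms in auto)
  obtain h :: "('n, 'k) bipoly" where h: "h \<in> bihom_piece (card (fst ` Z - {p})) (card (snd ` Z - {q}))"
    "\<And>v w. evaluate (case_sum v w) h = evaluate v f * evaluate w g"
    using product_form[OF f(1) g(1)] by blast
  show ?thesis
  proof (rule that[OF h(1)])
    show "evaluate (case_sum v w) h \<noteq> 0" if "v \<in> homog_coords p" "w \<in> homog_coords q" for v w
      using f(2)[OF that(1)] g(2)[OF that(2)] by (simp add: h(2))
    show "evaluate (case_sum v w) h = 0"
      if "(p', q') \<in> Z - {(p, q)}" "v \<in> homog_coords p'" "w \<in> homog_coords q'" for p' q' v w
    proof -
      have "p' \<in> fst ` Z - {p} \<or> q' \<in> snd ` Z - {q}" using that(1) by force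
      then show ?thesis using f(3)[OF _ that(2)] g(3)[OF _ that(3)] by (auto simp: h(2))
    qed
  qed
qed

text \<open>If \<open>X\<^sub>0\<close> vanished at a point, its product with a separator of this point
  would be zero in the coordinate ring, so \<open>X\<^sub>0\<close> would be a zero divisor. If
  \<open>Y\<^sub>0\<close> vanished at a point, its product with a separator \<open>f\<close> would
  be zero, and \<open>f\<close> would be a multiple of \<open>X\<^sub>0\<close> modulo the ideal;
  the cofactor of \<open>X\<^sub>0\<close> would again be a separator, of smaller degree in
  \<open>X\<close>.\<close>

lemma coordinates_regular_affine:
  assumes fin: "finite Z" and reg: "coordinates_regular Z" and P: "(p, q) \<in> Z"
  shows "affine_point p" "affine_point q"
proof -
  define I where "I = bivanishing_ideal Z"
  have I: "is_ideal I" unfolding I_def by (rule is_ideal_bivanishing)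
  have span_I: "ideal_span I = I" using idl.span_eq_iff I by blast
  note Q = residue_ring[OF I]
  have reg': "regular_sequence (residue_ring_of I) [residue_of I (var (Inl None)), residue_of I (var (Inr None))]"
    using reg unfolding coordinates_regular_def coord_ring_def I_def .
  have x_regular: "f \<in> I" if "var (Inl None) * f \<in> I" for f
  proof -
    have "residue_of I (var (Inl None)) \<otimes>\<^bsub>residue_ring_of I\<^esub> residue_of I f \<in> Idl\<^bsub>residue_ring_of I\<^esub> {}"
      using that residue_genideal[OF I, of "var (Inl None) * f" "{}"]
      by (simp add: Q span_I)
    then have "residue_of I f \<in> Idl\<^bsub>residue_ring_of I\<^esub> {}"
      using reg' Q(2) unfolding regular_sequence_def by (force dest: spec[of _ 0])
    then show ?thesis using residue_genideal[OF I, of f "{}"] by (simp add: span_I)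
  qed
  have y_regular: "f \<in> ideal_span (I \<union> {var (Inl None)})" if "var (Inr None) * f \<in> I" for f
  proof -
    have "var (Inr None) * f \<in> ideal_span (I \<union> {var (Inl None)})"
      using that by (intro idl.span_base) simp
    then have "residue_of I (var (Inr None)) \<otimes>\<^bsub>residue_ring_of I\<^esub> residue_of I f
        \<in> Idl\<^bsub>residue_ring_of I\<^esub> (residue_of I ` {var (Inl None)})"
      unfolding Q(3) residue_genideal[OF I] .
    then have "residue_of I f \<in> Idl\<^bsub>residue_ring_of I\<^esub> (residue_of I ` {var (Inl None)})"
      using reg' Q(2) unfolding regular_sequence_def by (force dest: spec[of _ 1])
    then show ?thesis unfolding residue_genideal[OF I] .
  qed
  have in_I: "f \<in> I" if "f \<in> bihom_piece i j"
    "\<And>p q v w. (p, q) \<in> Z \<Longrightarrow> v \<in> homog_coords p \<Longrightarrow> w \<in> homog_coords q \<Longrightarrow> evaluate (case_sum v w) f = 0" for f i j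
    unfolding I_def bivanishing_ideal_eq using that
    by (intro idl.span_base CollectI conjI) (auto simp: bihomogeneous_def)
  have notin_I: "f \<notin> I" if "(p, q) \<in> Z" "v \<in> homog_coords p" "w \<in> homog_coords q" "evaluate (case_sum v w) f \<noteq> 0"
    for f p q v w
    using bivanishing_evaluate[of f Z p q v w] that by (auto simp: I_def)
  have x_affine: "affine_point p" if P: "(p, q) \<in> Z" for p q
  proof (rule ccontr)
    assume "\<not> affine_point p"
    then have zero: "v None = 0" if "v \<in> homog_coords p" for v using that by (auto simp: affine_point_def)
    obtain f i j where f: "f \<in> bihom_piece i j"
      "\<And>v w. v \<in> homog_coords p \<Longrightarrow> w \<in> homog_coords q \<Longrightarrow> evaluate (case_sum v w) f \<noteq> 0"
      "\<And>p' q' v w. (p', q') \<in> Z - {(p, q)} \<Longrightarrow> v \<in> homog_coords p' \<Longrightarrow> w \<in> homog_coords q'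
        \<Longrightarrow> evaluate (case_sum v w) f = 0" using general_separator[OF fin P] by blast
    have X0: "var (Inl None) \<in> bihom_piece 1 0" by (simp add: bihom_piece_eq var_piece)
    have "var (Inl None) * f \<in> I"
      by (rule in_I[OF bihom_piece_mult[OF X0 f(1)]]) (use f(3) zero in \<open>fastforce\<close>)
    then have "f \<in> I" by (rule x_regular)
    then show False using homog_coords_nonempty[of p] homog_coords_nonempty[of q] f(2) notin_I[OF P] by blast
  qed
  show "affine_point p" using x_affine P by blast
  show "affine_point q"
  proof (rule ccontr)
    assume "\<not> affine_point q"
    then have zero: "w None = 0" if "w \<in> homog_coords q" for w using that by (auto simp: affine_point_def)
    obtain v where v: "v \<in> homog_coords p" using homog_coords_nonempty by blast
    obtain w where w: "w \<in> homog_coords q" using homog_coords_nonempty by blast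
    define separates where "separates = (\<lambda>f. evaluate (case_sum v w) f \<noteq> 0 \<and>
      (\<forall>p' q' v w. (p', q') \<in> Z - {(p, q)} \<longrightarrow> v \<in> homog_coords p' \<longrightarrow> w \<in> homog_coords q'
        \<longrightarrow> evaluate (case_sum v w) f = 0))"
    have none: "\<not> separates f" if "f \<in> bihom_piece i j" for f i j
      using that
    proof (induction i arbitrary: f rule: less_induct)
      case (less i)
      show ?case
      proof
        assume sep: "separates f"
        have Y0: "var (Inr None) \<in> bihom_piece 0 1" by (simp add: bihom_piece_eq var_piece)
        have "var (Inr None) * f \<in> I"
        proof (rule in_I[OF bihom_piece_mult[OF Y0 less.prems]])
          fix p' q' v' w' assume "(p', q') \<in> Z" "v' \<in> homog_coords p'" "w' \<in> homog_coords q'"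
          then show "evaluate (case_sum v' w') (var (Inr None) * f) = 0"
            using sep zero unfolding separates_def by (cases "(p', q') = (p, q)") auto
        qed
        then have "f \<in> ideal_span (I \<union> {var (Inl None)})" by (rule y_regular)
        then obtain h g where hg: "h \<in> I" "f = h + g * var (Inl None)"
          unfolding idl.span_Un idl.span_singleton span_I by auto
        define h' where "h' = hom_component degX i (hom_component degY j h)"
        have h': "h' \<in> I" unfolding h'_def I_def by (rule ideal_bihom_components) (use hg I_def in simp)
        have "f = hom_component degX i (hom_component degY j f)"
          using less.prems hom_component_of_piece[of f degX i i] hom_component_of_piece[of f degY j j]
          by (simp add: bihom_piece_eq)
        also have "\<dots> = h' + hom_component degX i (hom_component degY j (g * var (Inl None)))"
          by (simp add: hg(2) hom_component_add h'_def)
        also have "hom_component degY j (g * var (Inl None)) = hom_component degY j g * var (Inl None)"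
          using degY.hom_component_mult_piece[OF var_piece(3), of j g] by simp
        finally have f: "f = h' + hom_component degX i (hom_component degY j g * var (Inl None))" .
        show False
        proof (cases i)
          case 0
          then have "f = h'" using f degX.hom_component_mult_piece[OF var_piece(2), of i] by simp
          then show False using notin_I[OF P v w] sep h' by (auto simp: separates_def)
        next
          case (Suc k)
          define g' where "g' = hom_component degX k (hom_component degY j g)"
          have f': "f = h' + g' * var (Inl None)"
            using f degX.hom_component_mult_piece[OF var_piece(2), of i "hom_component degY j g"] Suc by (simp add: g'_def)
          have "g' \<in> bihom_piece k j"
            unfolding g'_def bihom_piece_eq using hom_component_in_piece hom_component_other_piece by blast
          moreover have "separates g'"
            unfolding separates_def
          proof (intro conjI allI impI)
            have "evaluate (case_sum v w) h' = 0"
              using bivanishing_evaluate[OF _ P v w] h' by (simp add: I_def)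
            then show "evaluate (case_sum v w) g' \<noteq> 0" using sep f' by (auto simp: separates_def)
          next
            fix p' q' v' w'
            assume Z': "(p', q') \<in> Z - {(p, q)}" and v': "v' \<in> homog_coords p'" and w': "w' \<in> homog_coords q'"
            have "evaluate (case_sum v' w') h' = 0"
              using bivanishing_evaluate[OF _ _ v' w'] h' Z' by (auto simp: I_def)
            moreover have "evaluate (case_sum v' w') f = 0" using sep Z' v' w' unfolding separates_def by blast
            moreover have "v' None \<noteq> 0"
            proof -
              have aff: "affine_point p'" using x_affine Z' by blast
              then obtain c where "c \<noteq> 0" "v' = (\<lambda>i. c * affine_rep p' i)"
                using homog_coords_affine v' by blast
              then show ?thesis using affine_rep(2)[OF aff] by simp
            qed
            ultimately show "evaluate (case_sum v' w') g' = 0" using f' by simp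
          qed
          ultimately show False using less.IH[of k g'] Suc by blast
        qed
      qed
    qed
    obtain f i j where f: "f \<in> bihom_piece i j"
      "\<And>v w. v \<in> homog_coords p \<Longrightarrow> w \<in> homog_coords q \<Longrightarrow> evaluate (case_sum v w) f \<noteq> 0"
      "\<And>p' q' v w. (p', q') \<in> Z - {(p, q)} \<Longrightarrow> v \<in> homog_coords p' \<Longrightarrow> w \<in> homog_coords q'
        \<Longrightarrow> evaluate (case_sum v w) f = 0" using general_separator[OF fin P] by blast
    have "separates f" unfolding separates_def using f(2)[OF v w] f(3) by blast
    then show False using none[OF f(1)] by blast
  qed
qed

(* Read as a simplification rule for products in a ring, this reassociates to the left and loops
   together with associativity. *)
declare idl.scale_scale [simp del] mp.scale_scale [simp del]

section \<open>The Hilbert series of a complete intersection\<close>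

text \<open>The dimensions of the graded pieces of a polynomial ring are found by counting exponent
  vectors.\<close>

definition monomials :: "'v::finite set \<Rightarrow> nat \<Rightarrow> ('v \<Rightarrow>\<^sub>0 nat) set" where
  "monomials A j = {m. keys m \<subseteq> A \<and> tdeg m = j}"

text \<open>A monomial of positive degree either avoids the variable \<open>v\<close> or is divisible by
  it.\<close>

lemma monomials_insert:
  assumes "v \<notin> A"
  shows "monomials (insert v A) 0 = monomials A 0"
    and "monomials (insert v A) (Suc j)
      = monomials A (Suc j) \<union> (\<lambda>m. m + single v 1) ` monomials (insert v A) j"
    and "monomials A (Suc j) \<inter> (\<lambda>m. m + single v 1) ` monomials (insert v A) j = {}"
proof -
  show "monomials (insert v A) 0 = monomials A 0"
    by (auto simp: monomials_def tdeg_def in_keys_iff)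
  show "monomials A (Suc j) \<inter> (\<lambda>m. m + single v 1) ` monomials (insert v A) j = {}"
  proof -
    have "v \<in> keys (m + single v 1)" for m :: "'a \<Rightarrow>\<^sub>0 nat"
      by (simp add: in_keys_iff lookup_add)
    then show ?thesis using assms by (auto simp: monomials_def)
  qed
  show "monomials (insert v A) (Suc j)
      = monomials A (Suc j) \<union> (\<lambda>m. m + single v 1) ` monomials (insert v A) j"
  proof (intro equalityI subsetI)
    fix m assume m: "m \<in> monomials (insert v A) (Suc j)"
    show "m \<in> monomials A (Suc j) \<union> (\<lambda>m. m + single v 1) ` monomials (insert v A) j"
    proof (cases "v \<in> keys m")
      case True
      then have eq: "m = (m - single v 1) + single v 1"
        by (intro poly_mapping_eqI) (auto simp: lookup_add lookup_minus lookup_single when_def in_keys_iff)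
      have "keys (m - single v 1) \<subseteq> keys m"
        by (auto simp: in_keys_iff lookup_minus)
      moreover have "tdeg m = tdeg (m - single v 1) + 1"
        by (subst eq) (simp only: tdeg.deg_add deg_single)
      ultimately have "m - single v 1 \<in> monomials (insert v A) j"
        using m by (auto simp: monomials_def)
      then show ?thesis using eq by blast
    next
      case False
      then show ?thesis using m by (auto simp: monomials_def)
    qed
  next
    fix m assume "m \<in> monomials A (Suc j) \<union> (\<lambda>m. m + single v 1) ` monomials (insert v A) j"
    then show "m \<in> monomials (insert v A) (Suc j)"
    proof
      assume "m \<in> (\<lambda>m. m + single v 1) ` monomials (insert v A) j"
      then obtain l where l: "m = l + single v 1" "keys l \<subseteq> insert v A" "tdeg l = j"
        by (auto simp: monomials_def)
      have "keys m \<subseteq> insert v A" using l(2) keys_add[of l "single v 1"] by (auto simp: l(1))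
      moreover have "tdeg m = Suc j" unfolding l(1) tdeg.deg_add deg_single l(3) by simp
      ultimately show ?thesis by (simp add: monomials_def)
    qed (auto simp: monomials_def)
  qed
qed

lemma finite_monomials: "finite (monomials A j)"
proof -
  have "finite A" by simp
  then show ?thesis
  proof (induction A arbitrary: j rule: finite_induct)
    case empty
    have "monomials {} j \<subseteq> {0}" by (auto simp: monomials_def)
    then show ?case using finite_subset by blast
  next
    case (insert v A)
    show ?case
      by (induction j) (simp_all add: monomials_insert[OF insert(2)] insert.IH)
  qed
qed

lemma monomials_series:
  fixes A :: "'v::finite set"
  shows "(1 - fps_X) ^ card A * Abs_fps (\<lambda>j. int (card (monomials A j))) = 1"
proof -
  have "finite A" by simp
  then show ?thesis
  proof (induction A rule: finite_induct)
    case empty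
    have "monomials ({} :: 'v set) j = (if j = 0 then {0} else {})" for j
      by (auto simp: monomials_def)
    then have "Abs_fps (\<lambda>j. int (card (monomials ({} :: 'v set) j))) = 1"
      by (intro fps_ext) simp
    then show ?case by simp
  next
    case (insert v A)
    have card: "card (monomials (insert v A) (Suc j))
        = card (monomials A (Suc j)) + card (monomials (insert v A) j)" for j
    proof -
      have "card (monomials (insert v A) (Suc j))
          = card (monomials A (Suc j)) + card ((\<lambda>m. m + single v 1) ` monomials (insert v A) j)"
        unfolding monomials_insert(2)[OF insert(2)]
        by (rule card_Un_disjoint) (simp_all add: finite_monomials monomials_insert(3)[OF insert(2), simplified])
      then show ?thesis by (simp add: card_image)
    qed
    have "(1 - fps_X) * Abs_fps (\<lambda>j. int (card (monomials (insert v A) j)))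
        = Abs_fps (\<lambda>j. int (card (monomials A j)))"
    proof (rule fps_ext)
      fix j
      show "((1 - fps_X) * Abs_fps (\<lambda>j. int (card (monomials (insert v A) j)))) $ j
        = Abs_fps (\<lambda>j. int (card (monomials A j))) $ j"
        by (cases j) (simp_all add: left_diff_distrib card monomials_insert(1)[OF insert(2)])
    qed
    moreover have "card (insert v A) = Suc (card A)" using insert(1,2) by simp
    ultimately have "(1 - fps_X) ^ card (insert v A) * Abs_fps (\<lambda>j. int (card (monomials (insert v A) j)))
        = (1 - fps_X) ^ card A * Abs_fps (\<lambda>j. int (card (monomials A j)))"
      by (simp only: power_Suc2 mult.assoc)
    then show ?case using insert.IH by simp
  qed
qed

lemma fps_top_coefficient:
  fixes P Q :: "int fps"
  assumes "P $ s = 1" "\<And>i. i > s \<Longrightarrow> P $ i = 0" "Q $ t = 1" "\<And>i. i > t \<Longrightarrow> Q $ i = 0"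
  shows "(P * Q) $ (s + t) = 1" and "i > s + t \<Longrightarrow> (P * Q) $ i = 0"
proof -
  have "(P * Q) $ (s + t) = (\<Sum>i=0..s + t. if i = s then 1 else 0)"
    unfolding fps_mult_nth
  proof (rule sum.cong)
    fix i
    show "P $ i * Q $ (s + t - i) = (if i = s then 1 else 0)"
      using assms(1,3) assms(2)[of i] assms(4)[of "s + t - i"]
      by (cases i s rule: linorder_cases) auto
  qed simp
  then show "(P * Q) $ (s + t) = 1" by simp
  show "(P * Q) $ i = 0" if "i > s + t"
    unfolding fps_mult_nth
  proof (rule sum.neutral, rule ballI)
    fix j assume "j \<in> {0..i}"
    show "P $ j * Q $ (i - j) = 0"
    proof (cases "j > s")
      case True
      then show ?thesis using assms(2) by simp
    next
      case False
      then have "i - j > t" using that by simp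
      then show ?thesis using assms(4) by simp
    qed
  qed
qed

lemma geometric_product_top:
  fixes e :: "nat \<Rightarrow> nat"
  assumes "\<And>k. k < n \<Longrightarrow> e k \<ge> 1"
  shows "(\<Prod>k<n. \<Sum>i<e k. fps_X ^ i :: int fps) $ (\<Sum>k<n. e k - 1) = 1 \<and>
    (\<forall>i>(\<Sum>k<n. e k - 1). (\<Prod>k<n. \<Sum>i<e k. fps_X ^ i :: int fps) $ i = 0)"
  using assms
proof (induction n)
  case (Suc n)
  have nth: "(\<Sum>i<e n. fps_X ^ i :: int fps) $ j = (if j < e n then 1 else 0)" for j
  proof -
    have "(\<Sum>i<e n. fps_X ^ i :: int fps) $ j = (\<Sum>i<e n. if i = j then 1 else 0)"
      unfolding fps_sum_nth by (rule sum.cong) auto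
    then show ?thesis by simp
  qed
  have top: "(\<Sum>i<e n. fps_X ^ i :: int fps) $ (e n - 1) = 1"
    "\<And>j. j > e n - 1 \<Longrightarrow> (\<Sum>i<e n. fps_X ^ i :: int fps) $ j = 0"
    using Suc.prems[of n] unfolding nth by auto
  have IH: "(\<Prod>k<n. \<Sum>i<e k. fps_X ^ i :: int fps) $ (\<Sum>k<n. e k - 1) = 1"
    "\<And>j. j > (\<Sum>k<n. e k - 1) \<Longrightarrow> (\<Prod>k<n. \<Sum>i<e k. fps_X ^ i :: int fps) $ j = 0"
    using Suc.IH Suc.prems by auto
  show ?case
    using fps_top_coefficient(1)[OF IH top] fps_top_coefficient(2)[OF IH top] by simp
qed simp

lemma span_monomials_eq_piece:
  "bihom_piece 0 j = mp.span ((\<lambda>m. single m (1 :: 'k::field)) ` monomials (range Inr :: (unit option + 'n::finite option) set) j)"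
  (is "_ = mp.span (?s ` ?M)")
proof (intro equalityI subsetI)
  fix f :: "('n, 'k) bipoly" assume f: "f \<in> bihom_piece 0 j"
  have "m \<in> ?M" if "m \<in> keys f" for m
  proof -
    have deg: "degX m = 0" "degY m = j" using f that by (auto simp: bihom_piece_eq piece_def)
    have "lookup m (Inl a) = 0" for a using deg(1) by (simp add: degX_def)
    then have "keys m \<subseteq> range Inr"
      by (metis in_keys_iff obj_sumE rangeI subsetI)
    then show ?thesis using deg by (simp add: monomials_def tdeg_eq)
  qed
  then have "(\<Sum>m\<in>keys f. const (lookup f m) * single m 1) \<in> mp.span (?s ` ?M)"
    by (intro mp.span_sum mp.span_scale mp.span_base) blast
  also have "(\<Sum>m\<in>keys f. const (lookup f m) * single m 1) = f"
    using sum_singles[of f] by (simp add: const_def mult_single)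
  finally show "f \<in> mp.span (?s ` ?M)" .
next
  fix f :: "('n, 'k) bipoly" assume "f \<in> mp.span (?s ` ?M)"
  moreover have "?s ` ?M \<subseteq> bihom_piece 0 j"
  proof (clarify)
    fix m :: "unit option + 'n option \<Rightarrow>\<^sub>0 nat" assume m: "m \<in> ?M"
    have "lookup m (Inl a) = 0" for a
    proof -
      have "Inl a \<notin> keys m" using m by (auto simp: monomials_def)
      then show ?thesis by (simp add: in_keys_iff)
    qed
    then have "degX m = 0" by (simp add: degX_def)
    moreover from this have "degY m = j" using m by (simp add: monomials_def tdeg_eq)
    ultimately show "single m 1 \<in> bihom_piece 0 j" by (auto simp: bihom_piece_eq intro!: piece_single)
  qed
  ultimately show "f \<in> bihom_piece 0 j"
    using mp.span_minimal[OF _ subspace_pieces(3)] by blast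
qed

lemma dim_piece: "mp.dim (bihom_piece 0 j :: ('n::finite, 'k::field) bipoly set)
  = card (monomials (range Inr :: (unit option + 'n option) set) j)"
proof -
  define M where "M = monomials (range Inr :: (unit option + 'n option) set) j"
  have inj: "inj_on (\<lambda>m. single m (1 :: 'k)) M"
    by (rule inj_onI) (metis lookup_single_eq lookup_single_not_eq zero_neq_one)
  have "mp.independent ((\<lambda>m. single m (1 :: 'k)) ` M)"
  proof (rule mp.independent_if_scalars_zero)
    show "finite ((\<lambda>m. single m (1 :: 'k)) ` M)" unfolding M_def using finite_monomials by blast
    fix f :: "('n, 'k) bipoly \<Rightarrow> 'k" and x
    assume eq: "(\<Sum>x\<in>(\<lambda>m. single m (1 :: 'k)) ` M. const (f x) * x) = 0" and "x \<in> (\<lambda>m. single m (1 :: 'k)) ` M"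
    then obtain m where m: "m \<in> M" "x = single m 1" by auto
    have "0 = lookup (\<Sum>x\<in>(\<lambda>m. single m (1 :: 'k)) ` M. const (f x) * x) m" using eq by simp
    also have "\<dots> = (\<Sum>l\<in>M. lookup (const (f (single l 1)) * single l 1) m)"
      by (simp add: sum.reindex[OF inj] lookup_sum)
    also have "\<dots> = (\<Sum>l\<in>M. if l = m then f (single m 1) else 0)"
      by (rule sum.cong) (auto simp: const_def mult_single lookup_single when_def)
    also have "\<dots> = f x" using m by (simp add: M_def finite_monomials)
    finally show "f x = 0" by simp
  qed
  then have "mp.dim (mp.span ((\<lambda>m. single m (1 :: 'k)) ` M)) = card ((\<lambda>m. single m (1 :: 'k)) ` M)"
    by (rule mp.dim_span_eq_card_independent)
  also have "\<dots> = card M" using inj by (rule card_image)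
  finally show ?thesis unfolding span_monomials_eq_piece M_def .
qed

lemma mp_linear_compose:
  assumes "Vector_Spaces.linear (\<lambda>c (f :: ('v, 'k::field) mpoly). const c * f) (\<lambda>c (f :: ('v, 'k) mpoly). const c * f) L"
  shows "Vector_Spaces.linear (\<lambda>c f. const c * f) (\<lambda>c f. const c * f) (\<lambda>f. L (g * f))"
proof -
  have comm: "g * (const c * x) = const c * (g * x)" for c x by (rule mult.left_commute)
  show ?thesis using assms unfolding Vector_Spaces.linear_iff by (simp add: distrib_left comm)
qed

lemma bihom_component:
  assumes "f \<in> bihom_piece i j"
  shows "hom_component degX i (hom_component degY j f) = f"
  using assms hom_component_of_piece[of f degX i i] hom_component_of_piece[of f degY j j] by (simp add: bihom_piece_eq)

text \<open>Multiplication by the next element of a regular sequence is injective modulo the previous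
  ones; comparing dimensions in degree \<open>(0, j)\<close> gives a recursion for Hilbert
  functions.\<close>

lemma dim_step:
  fixes G :: "('n::finite, 'k::field) bipoly"
  assumes gens: "\<And>f. f \<in> A \<Longrightarrow> bihomogeneous f" and G: "G \<in> bihom_piece 0 e"
    and regular: "\<And>h. G * h \<in> ideal_span A \<Longrightarrow> h \<in> ideal_span A"
  shows "int (mp.dim (ideal_span (insert G A) \<inter> bihom_piece 0 j))
    = int (mp.dim (ideal_span A \<inter> bihom_piece 0 j))
      + (if e \<le> j then int (mp.dim (bihom_piece 0 (j - e) :: ('n, 'k) bipoly set))
          - int (mp.dim (ideal_span A \<inter> bihom_piece 0 (j - e))) else 0)"
proof -
  define U where "U = ideal_span A \<inter> bihom_piece 0 j"
  define U' where "U' = ideal_span (insert G A) \<inter> bihom_piece 0 j"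
  have sub_ideal: "mp.subspace (ideal_span B)" for B :: "('n, 'k) bipoly set"
    by (rule mp.subspaceI) (auto intro: idl.span_zero idl.span_add idl.span_scale)
  have sub: "mp.subspace U" "mp.subspace U'"
    unfolding U_def U'_def by (intro mp.subspace_inter sub_ideal subspace_pieces)+
  have "U \<subseteq> U'" unfolding U_def U'_def using idl.span_mono[of A "insert G A"] by blast
  have comp: "hom_component degX i (hom_component degY j h) \<in> ideal_span A" if "h \<in> ideal_span A" for h i j
  proof (rule degX.ideal_homogeneous)
    show "hom_component degY j h \<in> ideal_span A"
      by (rule degY.ideal_homogeneous[OF _ that]) (use gens in \<open>auto simp: bihomogeneous_def bihom_piece_eq\<close>)
  qed (use gens in \<open>auto simp: bihomogeneous_def bihom_piece_eq\<close>)
  have U'_elem: "\<exists>u\<in>U. \<exists>v. f = u + (if e \<le> j then G * v else 0) \<and> v \<in> bihom_piece 0 (j - e)" if f: "f \<in> U'" for f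
  proof -
    obtain g where g: "f - g * G \<in> ideal_span A"
      using f unfolding U'_def idl.span_insert by blast
    define u where "u = hom_component degX 0 (hom_component degY j (f - g * G))"
    define v where "v = hom_component degX 0 (hom_component degY (j - e) g)"
    have "u \<in> U" unfolding U_def u_def bihom_piece_eq
      using comp[OF g] hom_component_in_piece hom_component_other_piece by blast
    moreover have "v \<in> bihom_piece 0 (j - e)"
      unfolding v_def bihom_piece_eq using hom_component_in_piece hom_component_other_piece by blast
    moreover have "hom_component degX 0 (hom_component degY j (g * G)) = (if e \<le> j then G * v else 0)"
    proof -
      have GX: "G \<in> piece degX 0" and GY: "G \<in> piece degY e" using G by (auto simp: bihom_piece_eq)
      show ?thesis
        unfolding degY.hom_component_mult_piece[OF GY] v_def
        by (simp add: degX.hom_component_mult_piece[OF GX] mult.commute[of G])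
    qed
    moreover have "f = hom_component degX 0 (hom_component degY j f)"
      using bihom_component[of f 0 j] f by (simp add: U'_def)
    ultimately show ?thesis
      by (intro bexI[of _ u] exI[of _ v]) (simp_all add: u_def hom_component_diff)
  qed
  have T: "bihom_piece 0 i \<subseteq> mp.span ((\<lambda>m. single m (1 :: 'k)) ` monomials (range Inr :: (unit option + 'n option) set) i)"
    "finite ((\<lambda>m. single m (1 :: 'k)) ` monomials (range Inr :: (unit option + 'n option) set) i)" for i
    by (auto simp: span_monomials_eq_piece finite_monomials)
  have "\<exists>L. Vector_Spaces.linear (\<lambda>c (f :: ('n, 'k) bipoly). const c * f) (\<lambda>c (f :: ('n, 'k) bipoly). const c * f) L
    \<and> (\<forall>x. L x = 0 \<longleftrightarrow> x \<in> U)"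
    by (rule mp.exists_linear_with_kernel[OF sub(1)])
  then obtain L where L: "Vector_Spaces.linear (\<lambda>c (f :: ('n, 'k) bipoly). const c * f) (\<lambda>c (f :: ('n, 'k) bipoly). const c * f) L"
    "\<And>x. L x = 0 \<longleftrightarrow> x \<in> U" by (elim exE conjE) simp
  interpret L: Vector_Spaces.linear "\<lambda>c (f :: ('n, 'k) bipoly). const c * f" "\<lambda>c (f :: ('n, 'k) bipoly). const c * f" L
    by (rule L(1))
  have kernel: "{x \<in> U'. L x = 0} = U" using L(2) \<open>U \<subseteq> U'\<close> by blast
  have dim_U': "mp.dim U' = mp.dim (L ` U') + mp.dim U"
  proof -
    have "U' \<subseteq> mp.span ((\<lambda>m. single m (1 :: 'k)) ` monomials (range Inr :: (unit option + 'n option) set) j)"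
      using T(1)[of j] by (auto simp: U'_def)
    from mpmp.rank_nullity[OF L(1) sub(2) this T(2)] show ?thesis unfolding kernel .
  qed
  show ?thesis
  proof (cases "e \<le> j")
    case True
    have GS: "G * v \<in> bihom_piece 0 j" if "v \<in> bihom_piece 0 (j - e)" for v
      using bihom_piece_mult[OF G that] True by simp
    have G_in: "G \<in> ideal_span (insert G A)" by (intro idl.span_base) simp
    have "L ` U' = (\<lambda>v. L (G * v)) ` bihom_piece 0 (j - e)"
    proof (intro equalityI subsetI)
      fix y assume "y \<in> L ` U'"
      then obtain f where "f \<in> U'" "y = L f" by auto
      then obtain u v where "u \<in> U" "v \<in> bihom_piece 0 (j - e)" "f = u + G * v" "y = L f"
        using U'_elem[of f] True by auto
      then show "y \<in> (\<lambda>v. L (G * v)) ` bihom_piece 0 (j - e)"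
        using L(2)[of u] by (auto simp: L.add)
    next
      fix y assume "y \<in> (\<lambda>v. L (G * v)) ` bihom_piece 0 (j - e)"
      then obtain v where v: "v \<in> bihom_piece 0 (j - e)" "y = L (G * v)" by auto
      have "G * v \<in> U'"
        unfolding U'_def using GS[OF v(1)] idl.span_scale[OF G_in, of v] by (simp add: mult.commute)
      then show "y \<in> L ` U'" using v(2) by blast
    qed
    moreover have "{v \<in> bihom_piece 0 (j - e). L (G * v) = 0} = ideal_span A \<inter> bihom_piece 0 (j - e)"
    proof -
      have "G * v \<in> ideal_span A \<longleftrightarrow> v \<in> ideal_span A" for v
        using regular[of v] idl.span_scale[of v A G] by blast
      then show ?thesis using GS by (auto simp: L(2) U_def)
    qed
    ultimately have "mp.dim (bihom_piece 0 (j - e) :: ('n, 'k) bipoly set)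
        = mp.dim (L ` U') + mp.dim (ideal_span A \<inter> bihom_piece 0 (j - e))"
      using mpmp.rank_nullity[OF mp_linear_compose[OF L(1)] subspace_pieces(3) T[of "j - e"], of G] by simp
    then show ?thesis using dim_U' True by (simp add: U_def U'_def)
  next
    case False
    have "U' \<subseteq> U" using U'_elem False by auto
    then have "U' = U" using \<open>U \<subseteq> U'\<close> by (rule subset_antisym)
    then show ?thesis using False unfolding U_def U'_def by simp
  qed
qed

lemma evaluate_degX_0:
  assumes "f \<in> bihom_piece 0 j"
  shows "evaluate (case_sum v w) f = evaluate (case_sum v' w) f"
proof -
  have "pmono (case_sum v w) m = pmono (case_sum v' w) m" if "m \<in> keys f" for m
  proof -
    have "degX m = 0" using assms that by (auto simp: bihom_piece_eq piece_def)
    then have "left m = 0" by (intro poly_mapping_eqI) (simp add: degX_def lookup_left)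
    then show ?thesis by (simp add: pmono_case_sum)
  qed
  then show ?thesis by (simp add: evaluate_eq_peval peval_def extend_def)
qed

lemma (in affine_points) dim_value_space_snd:
  "fv.dim (value_space (snd ` Z) affine_rep (hom_piece j))
    = mp.dim (bihom_piece 0 j :: ('n, 'k) bipoly set) - mp.dim (bivanishing_ideal Z \<inter> bihom_piece 0 j)"
  and dim_ideal_le: "mp.dim (bivanishing_ideal Z \<inter> bihom_piece 0 j) \<le> mp.dim (bihom_piece 0 j :: ('n, 'k) bipoly set)"
proof -
  define ev where "ev = (\<lambda>(f :: ('n, 'k) bipoly) q. if q \<in> snd ` Z then evaluate (case_sum (\<lambda>_. 1) (affine_rep q)) f else 0)"
  have lin: "Vector_Spaces.linear (\<lambda>c f. const c * f) (\<lambda>c g. (\<lambda>x. c * g x)) ev"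
    unfolding ev_def by (rule linear_values)
  have "ev ` bihom_piece 0 j = value_space (snd ` Z) affine_rep (hom_piece j)"
  proof (intro equalityI subsetI)
    fix g assume "g \<in> ev ` bihom_piece 0 j"
    then obtain f where f: "f \<in> bihom_piece 0 j" "g = ev f" by auto
    obtain f' where "f' \<in> hom_piece j" "\<And>w. evaluate w f' = evaluate (case_sum (\<lambda>_. 1) w) f"
      using sliceY[OF f(1), of "\<lambda>_. 1"] by blast
    then show "g \<in> value_space (snd ` Z) affine_rep (hom_piece j)"
      unfolding value_space_def f(2) ev_def by (intro image_eqI[of _ _ f']) (auto simp: fun_eq_iff)
  next
    fix g assume "g \<in> value_space (snd ` Z) affine_rep (hom_piece j)"
    then obtain f where f: "f \<in> hom_piece j" "g = (\<lambda>q. if q \<in> snd ` Z then evaluate (affine_rep q) f else 0)"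
      by (auto simp: value_space_def)
    show "g \<in> ev ` bihom_piece 0 j"
      by (rule image_eqI[OF _ inY_piece[OF f(1)]]) (simp add: f(2) ev_def evaluate_peval_const fun_eq_iff)
  qed
  moreover have "{f \<in> bihom_piece 0 j. ev f = 0} = bivanishing_ideal Z \<inter> bihom_piece 0 j"
  proof -
    have "ev f = 0 \<longleftrightarrow> f \<in> bivanishing_ideal Z" if f: "f \<in> bihom_piece 0 j" for f
    proof -
      have "evaluate (case_sum (\<lambda>_. 1) (affine_rep (snd P))) f = evaluate (rep2 P) f" for P
        unfolding rep2_def by (rule evaluate_degX_0[OF f])
      then show ?thesis
        unfolding bihom_in_ideal[OF f] ev_def by (auto simp: fun_eq_iff)
    qed
    then show ?thesis by blast
  qed
  moreover have "mp.dim (bihom_piece 0 j :: ('n, 'k) bipoly set)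
      = fv.dim (ev ` bihom_piece 0 j) + mp.dim {f \<in> bihom_piece 0 j. ev f = 0}"
    by (rule mpfv.rank_nullity[OF lin subspace_pieces(3)])
      (auto simp: span_monomials_eq_piece finite_monomials)
  ultimately show "fv.dim (value_space (snd ` Z) affine_rep (hom_piece j))
    = mp.dim (bihom_piece 0 j :: ('n, 'k) bipoly set) - mp.dim (bivanishing_ideal Z \<inter> bihom_piece 0 j)"
    "mp.dim (bivanishing_ideal Z \<inter> bihom_piece 0 j) \<le> mp.dim (bihom_piece 0 j :: ('n, 'k) bipoly set)"
    by simp_all
qed

text \<open>Let \<open>H\<close> be the Hilbert series of the second projection. The recursion gives
  \<open>(1 - t) H = \<Prod> (1 + t + \<dots> + t\<^bsup>e k - 1\<^esup>)\<close>, whose coefficient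
  in the top degree \<open>s + 1\<close> is \<open>1\<close>. So the Hilbert function still
  increases from \<open>s\<close> to \<open>s + 1\<close> and is not yet the number of points in
  degree \<open>s\<close>.\<close>

lemma (in affine_points) complete_intersection_not_separable:
  assumes F: "F \<in> bihom_piece d 0" "d \<ge> 1" and Gs: "length Gs = CARD('n)"
    "\<And>k. k < CARD('n) \<Longrightarrow> Gs ! k \<in> bihom_piece 0 (e k)" "\<And>k. k < CARD('n) \<Longrightarrow> e k \<ge> 1"
    and reg: "regular_sequence type_ring (F # Gs)"
    and ideal: "bivanishing_ideal Z = ideal_span (set (F # Gs))"
    and s: "(\<Sum>k<CARD('n). e k - 1) = Suc s"
  shows "\<exists>q\<in>snd ` Z. \<not> sep (snd ` Z) s q"
proof -
  define J where "J = (\<lambda>k. ideal_span (set (F # take k Gs)))"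
  define h where "h = (\<lambda>k j. int (mp.dim (bihom_piece 0 j :: ('n, 'k) bipoly set))
    - int (mp.dim (J k \<inter> bihom_piece 0 j)))"
  have regular: "x \<in> J k" if "Gs ! k * x \<in> J k" "k < CARD('n)" for k x
  proof -
    have "\<forall>i<length (F # Gs). \<forall>g. (F # Gs) ! i * g \<in> ideal_span (set (take i (F # Gs)))
        \<longrightarrow> g \<in> ideal_span (set (take i (F # Gs)))"
      using reg unfolding regular_sequence_def by (simp add: genideal_eq)
    from this[rule_format, of "Suc k" x] show ?thesis using that Gs(1) by (simp add: J_def)
  qed
  have step: "h (Suc k) j = h k j - (if e k \<le> j then h k (j - e k) else 0)" if k: "k < CARD('n)" for k j
  proof -
    have J_Suc: "J (Suc k) = ideal_span (insert (Gs ! k) (set (F # take k Gs)))"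
      using k Gs(1) unfolding J_def by (simp add: take_Suc_conv_app_nth insert_commute)
    have hom: "bihomogeneous f" if "f \<in> set (F # take k Gs)" for f
    proof (cases "f = F")
      case False
      then have "f \<in> set (take k Gs)" using that by simp
      then obtain l where "l < length (take k Gs)" "take k Gs ! l = f" by (auto simp: in_set_conv_nth)
      then have "l < k" "f = Gs ! l" by auto
      then show ?thesis using Gs(2)[of l] k unfolding bihomogeneous_def by auto
    qed (use F(1) in \<open>auto simp: bihomogeneous_def\<close>)
    have "x \<in> ideal_span (set (F # take k Gs))" if "Gs ! k * x \<in> ideal_span (set (F # take k Gs))" for x
      using regular[OF _ k] that unfolding J_def .
    from dim_step[OF hom Gs(2)[OF k] this, where j = j]
    show ?thesis unfolding h_def J_Suc by (simp add: J_def del: list.set)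
  qed
  have h0: "h 0 j = int (card (monomials (range Inr :: (unit option + 'n option) set) j))" for j
  proof -
    \<comment> \<open>Multiples of \<open>F\<close> have positive degree in \<open>X\<close>.\<close>
    have "J 0 \<inter> bihom_piece 0 j \<subseteq> {0}"
    proof
      fix f assume f: "f \<in> J 0 \<inter> bihom_piece 0 j"
      then obtain u where u: "f = u * F" by (auto simp: J_def idl.span_singleton)
      have "f = hom_component degX 0 f" using f hom_component_of_piece[of f degX 0 0] by (simp add: bihom_piece_eq)
      also have "\<dots> = 0" using degX.hom_component_mult_piece[of F d 0 u] F by (simp add: u bihom_piece_eq)
      finally show "f \<in> {0}" by simp
    qed
    then have "mp.dim (J 0 \<inter> bihom_piece 0 j) = 0"
      using mp.dim_le_card[of "J 0 \<inter> bihom_piece 0 j" "{}"] by simp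
    then show ?thesis by (simp add: h_def dim_piece)
  qed
  define N where "N = CARD('n)"
  have series: "k \<le> N \<Longrightarrow> Abs_fps (h k) = (\<Prod>l<k. 1 - fps_X ^ e l) * Abs_fps (h 0)" for k
  proof (induction k)
    case (Suc k)
    have "Abs_fps (h (Suc k)) = (1 - fps_X ^ e k) * Abs_fps (h k)"
      by (rule fps_ext) (use Suc.prems step[of k] in \<open>auto simp: N_def left_diff_distrib fps_X_power_mult_nth\<close>)
    then show ?case using Suc by (simp add: mult.assoc mult.left_commute)
  qed simp
  define Q where "Q = (\<Prod>l<N. \<Sum>i<e l. fps_X ^ i :: int fps)"
  have card_range: "card (range Inr :: (unit option + 'n option) set) = Suc N"
    by (simp add: card_image N_def)
  have mon: "(1 - fps_X) ^ Suc N * Abs_fps (h 0) = 1"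
    using monomials_series[of "range Inr :: (unit option + 'n option) set"] unfolding card_range h0 .
  have "(1 - fps_X) ^ N * ((1 - fps_X) * Abs_fps (h N))
      = (\<Prod>l<N. 1 - fps_X ^ e l) * ((1 - fps_X) ^ Suc N * Abs_fps (h 0))"
    unfolding series[OF order.refl] by (simp add: ac_simps)
  also have "\<dots> = (\<Prod>l<N. (1 - fps_X) * (\<Sum>i<e l. fps_X ^ i))"
    unfolding mon by (simp only: one_diff_power_eq mult_1_right)
  also have "\<dots> = (1 - fps_X) ^ N * Q"
    unfolding Q_def prod.distrib by simp
  finally have cancel: "(1 - fps_X) ^ N * ((1 - fps_X) * Abs_fps (h N)) = (1 - fps_X) ^ N * Q" .
  have "(1 - fps_X :: int fps) \<noteq> 0"
  proof
    assume "(1 - fps_X :: int fps) = 0"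
    then have "(1 - fps_X :: int fps) $ 0 = 0" by simp
    then show False by simp
  qed
  then have "(1 - fps_X) * Abs_fps (h N) = Q" using cancel by simp
  moreover have "Q $ Suc s = 1"
    using geometric_product_top(1)[of N e] Gs(3) s unfolding Q_def N_def by simp
  ultimately have "((1 - fps_X) * Abs_fps (h N)) $ Suc s = 1" by simp
  then have diff: "h N (Suc s) - h N s = 1" by (simp add: left_diff_distrib)
  have "h N j = int (HF_proj (snd ` Z) j)" for j
    using dim_ideal_le[of j] Gs(1)
    unfolding h_def J_def snd.HF_proj_eq dim_value_space_snd ideal N_def by simp
  then have "HF_proj (snd ` Z) (Suc s) = Suc (HF_proj (snd ` Z) s)" using diff by simp
  moreover have "HF_proj (snd ` Z) (Suc s) \<le> card (snd ` Z)"
    unfolding snd.HF_proj_eq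
    by (rule dim_eq_card_iff(2)[OF value_space_subspace[OF subspace_pieces(2)] _ snd.finite_S])
      (rule value_space_outside)
  ultimately have "HF_proj (snd ` Z) s \<noteq> card (snd ` Z)" by simp
  then show ?thesis using snd.HF_proj_eq_card_iff by blast
qed

section \<open>Separators on products\<close>

text \<open>It suffices to annihilate the values of the forms of degree \<open>D - 1\<close>, because
  multiplication by powers of the coordinate with value \<open>1\<close> embeds the values of forms
  of lower degree.\<close>

lemma (in affine_proj_points) functional_killing_low_degrees:
  assumes "p \<in> S" "\<And>i. i < D \<Longrightarrow> \<not> sep S i p"
  obtains \<phi> where "\<phi> p \<noteq> 0"
    "\<And>f i. i < D \<Longrightarrow> f \<in> hom_piece i \<Longrightarrow> (\<Sum>q\<in>S. \<phi> q * evaluate (affine_rep q) f) = 0"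
proof (cases D)
  case 0
  then show ?thesis using that[of "ind p"] by (simp add: ind_def)
next
  case (Suc j)
  have "ind p \<notin> value_space S affine_rep (hom_piece j)"
    using assms(2)[of j] Suc ind_in_value_space[OF subspace_pieces(2) assms(1)] by blast
  then obtain \<phi> where \<phi>: "\<And>g. g \<in> value_space S affine_rep (hom_piece j) \<Longrightarrow> (\<Sum>x\<in>S. \<phi> x * g x) = 0" "\<phi> p \<noteq> 0"
    using linear_functional_avoiding[OF value_space_subspace[OF subspace_pieces(2)] _ finite_S,
        of S affine_rep j p] value_space_outside[of _ S affine_rep "hom_piece j"] by blast
  show ?thesis
  proof (rule that[of \<phi>, OF \<phi>(2)])
    fix f :: "('m option, 'k) mpoly" and i assume i: "i < D" "f \<in> hom_piece i"
    define g where "g = var None ^ (j - i) * f"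
    have "var None ^ (j - i) \<in> hom_piece (j - i)"
      using tdeg.piece_power[OF var_piece(1)] by (simp add: hom_piece_eq)
    from hom_piece_mult[OF this i(2)] have "g \<in> hom_piece j" using i(1) Suc by (simp add: g_def)
    then have "(\<lambda>q. if q \<in> S then evaluate (affine_rep q) g else 0) \<in> value_space S affine_rep (hom_piece j)"
      by (auto simp: value_space_def)
    from \<phi>(1)[OF this] have "(\<Sum>q\<in>S. \<phi> q * evaluate (affine_rep q) g) = 0" by simp
    moreover have "evaluate (affine_rep q) g = evaluate (affine_rep q) f" if "q \<in> S" for q
      using affine_rep(2)[OF affine[OF that]] by (simp add: g_def)
    ultimately show "(\<Sum>q\<in>S. \<phi> q * evaluate (affine_rep q) f) = 0" by simp
  qed
qed

lemma sep_line_iff: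
  fixes S :: "(unit, 'k::field) proj set"
  assumes "affine_proj_points S" "p \<in> S"
  shows "sep S i p \<longleftrightarrow> card S - 1 \<le> i"
proof -
  interpret affine_proj_points S by fact
  show ?thesis
  proof
    assume "sep S i p"
    then obtain f where f: "f \<in> hom_piece i" "evaluate (affine_rep p) f \<noteq> 0"
      "\<forall>q\<in>S - {p}. evaluate (affine_rep q) f = 0" by (auto simp: separable_def)
    have "f \<noteq> 0" using f(2) by auto
    then have "card (S - {p}) \<le> i"
      using binary_form_zeros[OF f(1)] f(3) finite_S affine by blast
    then show "card S - 1 \<le> i" using finite_S assms(2) by simp
  qed (use sep_mono[OF sep_large[OF assms(2)] assms(2)] in blast)
qed

context affine_points
begin

text \<open>Fixing one block of coordinates in a separator of \<open>P\<close> gives separators of the two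
  components; the product of separators of the components is a separator of \<open>P\<close>.\<close>

lemma bisep_product_iff:
  assumes prod: "Z = fst ` Z \<times> snd ` Z" and P: "P \<in> Z"
  shows "bisep Z i j P \<longleftrightarrow> sep (fst ` Z) i (fst P) \<and> sep (snd ` Z) j (snd P)"
proof
  assume "bisep Z i j P"
  then obtain f where f: "f \<in> bihom_piece i j" "evaluate (rep2 P) f \<noteq> 0"
    "\<forall>Q\<in>Z - {P}. evaluate (rep2 Q) f = 0" by (auto simp: separable_def)
  obtain g where g: "g \<in> hom_piece i"
    "\<And>v. evaluate v g = evaluate (case_sum v (affine_rep (snd P))) f" using sliceX[OF f(1)] by blast
  obtain h where h: "h \<in> hom_piece j"
    "\<And>w. evaluate w h = evaluate (case_sum (affine_rep (fst P)) w) f" using sliceY[OF f(1)] by blast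
  have "evaluate (affine_rep q) g = 0" if "q \<in> fst ` Z - {fst P}" for q
  proof -
    have "(q, snd P) \<in> fst ` Z \<times> snd ` Z" using that P by auto
    then have "(q, snd P) \<in> Z - {P}" using prod that by (cases P) auto
    from bspec[OF f(3) this] show ?thesis by (simp add: g(2) rep2_def)
  qed
  moreover have "evaluate (affine_rep q) h = 0" if "q \<in> snd ` Z - {snd P}" for q
  proof -
    have "(fst P, q) \<in> fst ` Z \<times> snd ` Z" using that P by auto
    then have "(fst P, q) \<in> Z - {P}" using prod that by (cases P) auto
    from bspec[OF f(3) this] show ?thesis by (simp add: h(2) rep2_def)
  qed
  moreover have "evaluate (affine_rep (fst P)) g \<noteq> 0" "evaluate (affine_rep (snd P)) h \<noteq> 0"
    using f(2) by (simp_all add: g(2) h(2) rep2_def)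
  ultimately show "sep (fst ` Z) i (fst P) \<and> sep (snd ` Z) j (snd P)"
    unfolding separable_def using g(1) h(1) by blast
next
  assume "sep (fst ` Z) i (fst P) \<and> sep (snd ` Z) j (snd P)"
  then obtain g h where g: "g \<in> hom_piece i" "evaluate (affine_rep (fst P)) g \<noteq> 0"
    "\<forall>q\<in>fst ` Z - {fst P}. evaluate (affine_rep q) g = 0"
    and h: "h \<in> hom_piece j" "evaluate (affine_rep (snd P)) h \<noteq> 0"
    "\<forall>q\<in>snd ` Z - {snd P}. evaluate (affine_rep q) h = 0" by (auto simp: separable_def)
  obtain f :: "('n, 'k) bipoly" where f: "f \<in> bihom_piece i j"
    "\<And>v w. evaluate (case_sum v w) f = evaluate v g * evaluate w h" using product_form[OF g(1) h(1)] by blast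
  have "evaluate (rep2 Q) f = 0" if "Q \<in> Z - {P}" for Q
  proof -
    have "fst Q \<in> fst ` Z - {fst P} \<or> snd Q \<in> snd ` Z - {snd P}" using that by (auto simp: prod_eq_iff)
    then show ?thesis using g(3) h(3) by (auto simp: rep2_def f(2))
  qed
  then show "bisep Z i j P"
    unfolding separable_def using f g(2) h(2) by (intro bexI[of _ f]) (auto simp: rep2_def)
qed

text \<open>The fibres of a set with the \<open>(\<star>)\<close>-property over the points of the line
  form a chain. For large \<open>j\<close>, a point \<open>(q, q')\<close> has a separator of degree
  \<open>(i, j)\<close> exactly if \<open>i + 1\<close> is at least the number of fibres containing
  \<open>q'\<close>. So the Cayley-Bacharach property makes this number constant, and it is the
  number of all fibres, because the points of the smallest fibre lie in every other one.\<close>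

lemma star_cayley_bacharach_product:
  assumes star: "star_property Z" and CB: "cayley_bacharach Z"
  shows "Z = fst ` Z \<times> snd ` Z"
proof -
  define fib where "fib = (\<lambda>q. {q'. (q, q') \<in> Z})"
  have fin_fib: "finite (fib q)" for q
    by (rule finite_subset[of _ "snd ` Z"]) (use finite_Z in \<open>force simp: fib_def\<close>)+
  define q1 where "q1 = arg_min_on (\<lambda>q. card (fib q)) (fst ` Z)"
  have q1: "q1 \<in> fst ` Z" "\<And>q. q \<in> fst ` Z \<Longrightarrow> card (fib q1) \<le> card (fib q)"
    unfolding q1_def using fst.finite_S fst.nonempty
    by (auto intro: arg_min_if_finite arg_min_least)
  have sub: "fib q1 \<subseteq> fib q" if q: "q \<in> fst ` Z" for q
  proof (rule ccontr)
    assume "\<not> fib q1 \<subseteq> fib q"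
    then obtain a where a: "(q1, a) \<in> Z" "(q, a) \<notin> Z" by (auto simp: fib_def)
    have "fib q \<subseteq> fib q1" using star a unfolding star_property_def fib_def by blast
    moreover have "a \<in> fib q1 - fib q" using a by (simp add: fib_def)
    ultimately have "fib q \<subset> fib q1" by blast
    then have "card (fib q) < card (fib q1)" by (rule psubset_card_mono[OF fin_fib])
    then show False using q1(2)[OF q] by linarith
  qed
  obtain b where "(q1, b) \<in> Z" using q1(1) by force
  then have b: "(q, b) \<in> Z" if "q \<in> fst ` Z" for q using sub[OF that] by (auto simp: fib_def)
  have "(p, q') \<in> Z" if pq: "p \<in> fst ` Z" "q' \<in> snd ` Z" for p q'
  proof -
    obtain q0 where q0: "(q0, q') \<in> Z" using pq(2) by force
    \<comment> \<open>The points of the line whose fibres contain \<open>q'\<close>. A form through all but one of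
      them gives a separator of \<open>(q0, q')\<close>; its degree also suffices for \<open>(q0,
      b)\<close>, whose separators vanish at all other points of the line.\<close>
    define N where "N = {q \<in> fst ` Z. (q, q') \<in> Z}"
    have finN: "finite N" "q0 \<in> N" "N \<subseteq> fst ` Z" using fst.finite_S q0 by (force simp: N_def)+
    obtain f :: "(unit option, 'k) mpoly" where f: "f \<in> hom_piece (card (N - {q0}))"
      "\<And>v. v \<in> homog_coords q0 \<Longrightarrow> evaluate v f \<noteq> 0"
      "\<And>q w. q \<in> N - {q0} \<Longrightarrow> w \<in> homog_coords q \<Longrightarrow> evaluate w f = 0"
      by (rule avoiding_form[of "N - {q0}" q0]) (use finN in auto)
    obtain g :: "('n option, 'k) mpoly" where g: "g \<in> hom_piece (card (snd ` Z - {q'}))"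
      "\<And>v. v \<in> homog_coords q' \<Longrightarrow> evaluate v g \<noteq> 0"
      "\<And>q w. q \<in> snd ` Z - {q'} \<Longrightarrow> w \<in> homog_coords q \<Longrightarrow> evaluate w g = 0"
      by (rule avoiding_form[of "snd ` Z - {q'}" q']) (use snd.finite_S in auto)
    obtain h :: "('n, 'k) bipoly" where h: "h \<in> bihom_piece (card (N - {q0})) (card (snd ` Z - {q'}))"
      "\<And>v w. evaluate (case_sum v w) h = evaluate v f * evaluate w g" using product_form[OF f(1) g(1)] by blast
    have reps: "affine_rep (fst Q) \<in> homog_coords (fst Q)" "affine_rep (snd Q) \<in> homog_coords (snd Q)"
      if "Q \<in> Z" for Q using affine_rep(1) affine[OF that] by auto
    have "bisep Z (card (N - {q0})) (card (snd ` Z - {q'})) (q0, q')"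
      unfolding separable_def
    proof (intro bexI[OF _ h(1)] conjI ballI)
      show "evaluate (rep2 (q0, q')) h \<noteq> 0"
        using f(2) g(2) reps[OF q0] by (simp add: rep2_def h(2))
      fix Q assume Q: "Q \<in> Z - {(q0, q')}"
      have "fst Q \<in> N - {q0} \<or> snd Q \<in> snd ` Z - {q'}" using Q by (cases Q) (force simp: N_def)
      then show "evaluate (rep2 Q) h = 0"
        unfolding rep2_def h(2) mult_eq_0_iff using f(3) g(3) reps[of Q] Q by blast
    qed
    moreover have q0b: "(q0, b) \<in> Z" using b finN by blast
    ultimately have "bisep Z (card (N - {q0})) (card (snd ` Z - {q'})) (q0, b)"
      using CB q0 unfolding cayley_bacharach_iff by blast
    then obtain u where u: "u \<in> bihom_piece (card (N - {q0})) (card (snd ` Z - {q'}))"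
      "evaluate (rep2 (q0, b)) u \<noteq> 0" "\<forall>Q\<in>Z - {(q0, b)}. evaluate (rep2 Q) u = 0"
      by (auto simp: separable_def)
    obtain t where t: "t \<in> hom_piece (card (N - {q0}))"
      "\<And>v. evaluate v t = evaluate (case_sum v (affine_rep b)) u" using sliceX[OF u(1)] by blast
    have "t \<noteq> 0" using t(2)[of "affine_rep q0"] u(2) by (auto simp: rep2_def)
    moreover have "evaluate (affine_rep q) t = 0" if "q \<in> fst ` Z - {q0}" for q
    proof -
      have "(q, b) \<in> Z - {(q0, b)}" using that b by auto
      from bspec[OF u(3) this] show ?thesis by (simp add: t(2) rep2_def)
    qed
    ultimately have "card (fst ` Z - {q0}) \<le> card (N - {q0})"
      using binary_form_zeros[OF t(1), of "fst ` Z - {q0}"] fst.finite_S fst.affine by blast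
    then have "card (fst ` Z) \<le> card N"
    proof -
      have "q0 \<in> fst ` Z" using finN by blast
      then show ?thesis
        using \<open>card (fst ` Z - {q0}) \<le> card (N - {q0})\<close> finN(1,2) fst.finite_S
          card_Suc_Diff1[of N q0] card_Suc_Diff1[of "fst ` Z" q0] by linarith
    qed
    then have "N = fst ` Z" using finN fst.finite_S by (intro card_seteq) auto
    then show "(p, q') \<in> Z" using pq(1) by (auto simp: N_def)
  qed
  then show ?thesis by force
qed

text \<open>On a product of sets the weighted sum of the values of a monomial is a product of two such
  sums.\<close>

lemma weighted_points_product:
  assumes prod: "Z = fst ` Z \<times> snd ` Z"
    and \<phi>1: "\<And>f i. i < D1 \<Longrightarrow> f \<in> hom_piece i \<Longrightarrow> (\<Sum>q\<in>fst ` Z. \<phi>1 q * evaluate (affine_rep q) f) = 0"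
    and \<phi>2: "\<And>f i. i < D2 \<Longrightarrow> f \<in> hom_piece i \<Longrightarrow> (\<Sum>q\<in>snd ` Z. \<phi>2 q * evaluate (affine_rep q) f) = 0"
  shows "weighted_points Z rep2 (\<lambda>P. \<phi>1 (fst P) * \<phi>2 (snd P)) D1 D2"
proof
  show "finite Z" "inj_on rep2 Z" by (rule finite_Z inj_rep2)+
  show "P \<in> Z \<Longrightarrow> rep2 P (Inl None) = 1" "P \<in> Z \<Longrightarrow> rep2 P (Inr None) = 1" for P
    by (simp_all add: rep2_X0 rep2_Y0)
  fix m :: "unit option + 'n option \<Rightarrow>\<^sub>0 nat" assume m: "degX m < D1 \<or> degY m < D2"
  have deg: "degX m = tdeg (left m)" "degY m = tdeg (right m)"
    by (simp_all add: degX_def degY_def tdeg_def lookup_left lookup_right)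
  have mono: "single l 1 \<in> hom_piece (tdeg l)" for l :: "'w::finite option \<Rightarrow>\<^sub>0 nat"
    by (simp add: hom_piece_eq piece_single)
  have "(\<Sum>P\<in>Z. \<phi>1 (fst P) * \<phi>2 (snd P) * pmono (rep2 P) m)
      = (\<Sum>P\<in>fst ` Z \<times> snd ` Z. (\<phi>1 (fst P) * pmono (affine_rep (fst P)) (left m))
          * (\<phi>2 (snd P) * pmono (affine_rep (snd P)) (right m)))"
    using prod by (intro sum.cong) (auto simp: rep2_def pmono_case_sum)
  also have "\<dots> = (\<Sum>q\<in>fst ` Z. \<phi>1 q * pmono (affine_rep q) (left m))
      * (\<Sum>q\<in>snd ` Z. \<phi>2 q * pmono (affine_rep q) (right m))"
    unfolding sum_product by (simp add: sum.cartesian_product case_prod_unfold)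
  also have "\<dots> = 0"
    using m \<phi>1[OF _ mono[of "left m"]] \<phi>2[OF _ mono[of "right m"]] unfolding deg
    by (auto simp: evaluate_single)
  finally show "(\<Sum>P\<in>Z. \<phi>1 (fst P) * \<phi>2 (snd P) * pmono (rep2 P) m) = 0" .
qed

end

section \<open>Jacobian minors\<close>

lemma keys_partial_deriv:
  fixes f :: "('v, 'k::field) mpoly"
  assumes "m \<in> keys (partial_deriv v f)"
  shows "m + single v 1 \<in> keys f"
proof -
  obtain l where l: "l \<in> keys f" "m \<in> keys (single (l - single v 1) (of_nat (lookup l v) * lookup f l))"
    using assms keys_sum[of "\<lambda>m. single (m - single v 1) (of_nat (lookup m v) * lookup f m)" "keys f"]
    unfolding partial_deriv_def by blast
  then have m: "m = l - single v 1" and "(of_nat (lookup l v) :: 'k) \<noteq> 0" by (auto split: if_splits)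
  then have "lookup l v \<noteq> 0" by (cases "lookup l v = 0") auto
  then have "m + single v 1 = l"
    unfolding m by (intro poly_mapping_eqI) (auto simp: lookup_add lookup_minus lookup_single when_def)
  then show ?thesis using l(1) by simp
qed

lemma jacobian_minor_degree:
  fixes F :: "'n::finite option \<Rightarrow> ('n, 'k::field) bipoly"
  assumes F: "\<And>k. F k \<in> bihom_piece (a k) (b k)" and m: "m \<in> keys (jacobian_minor F)"
  shows "degX m + 1 = (\<Sum>k\<in>UNIV. a k)" "degY m + CARD('n) = (\<Sum>k\<in>UNIV. b k)"
proof -
  define M where "M = (\<chi> k c. partial_deriv (jacobian_var c) (F k))"
  have m: "m \<in> keys (det M)" using m by (simp add: jacobian_minor_def M_def)
  have entry: "l + single (jacobian_var c) 1 \<in> keys (F k)" if "l \<in> keys (M $ k $ c)" for l k c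
    using keys_partial_deriv[of l] that by (simp add: M_def)
  have "degX m + (\<Sum>c\<in>UNIV. degX (single (jacobian_var c :: unit option + 'n option) 1)) = (\<Sum>k\<in>UNIV. a k)"
  proof (rule keys_det_degree[OF gradings(2) _ m])
    show "degX l + degX (single (jacobian_var j) 1) = a i" if "l \<in> keys (M $ i $ j)" for i j l
      using entry[OF that] F[of i] unfolding bihom_piece_eq piece_def by (auto simp: degX.deg_add)
  qed
  then show "degX m + 1 = (\<Sum>k\<in>UNIV. a k)" by (simp add: UNIV_option_conv sum.reindex)
  have "degY m + (\<Sum>c\<in>UNIV. degY (single (jacobian_var c :: unit option + 'n option) 1)) = (\<Sum>k\<in>UNIV. b k)"
  proof (rule keys_det_degree[OF gradings(3) _ m])
    show "degY l + degY (single (jacobian_var j) 1) = b i" if "l \<in> keys (M $ i $ j)" for i j l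
      using entry[OF that] F[of i] unfolding bihom_piece_eq piece_def by (auto simp: degY.deg_add)
  qed
  then show "degY m + CARD('n) = (\<Sum>k\<in>UNIV. b k)" by (simp add: UNIV_option_conv sum.reindex)
qed

lemma jacobian_minor_piece:
  fixes F :: "'n::finite option \<Rightarrow> ('n, 'k::field) bipoly"
  assumes F: "\<And>k. F k \<in> bihom_piece (a k) (b k)"
  shows "jacobian_minor F \<in> bihom_piece ((\<Sum>k\<in>UNIV. a k) - 1) ((\<Sum>k\<in>UNIV. b k) - CARD('n))"
  unfolding bihom_piece_eq piece_def
proof (intro IntI CollectI ballI)
  fix m assume m: "m \<in> keys (jacobian_minor F)"
  show "degX m = (\<Sum>k\<in>UNIV. a k) - 1" "degY m = (\<Sum>k\<in>UNIV. b k) - CARD('n)"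
    using jacobian_minor_degree[OF F m] by linarith+
qed

lemma prod_cong_ideal:
  fixes f g :: "'i \<Rightarrow> 'a::comm_ring_1"
  assumes J: "is_ideal J" and fg: "\<And>i. f i - g i \<in> J"
  shows "prod f S - prod g S \<in> J"
proof (induction S rule: infinite_finite_induct)
  case (insert x S)
  have "prod f (insert x S) - prod g (insert x S)
    = prod f S * (f x - g x) + g x * (prod f S - prod g S)"
    unfolding prod.insert[OF insert(1,2)] right_diff_distrib by (simp add: mult.commute)
  then show ?case
    using insert fg idl.subspace_add[OF J] idl.subspace_scale[OF J] by simp
qed (use idl.subspace_0[OF J] in auto)

lemma det_cong_ideal:
  fixes A B :: "'a::comm_ring_1^'n^'n"
  assumes J: "is_ideal J" and AB: "\<And>i j. A $ i $ j - B $ i $ j \<in> J"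
  shows "det A - det B \<in> J"
  unfolding det_def sum_subtractf[symmetric] right_diff_distrib[symmetric]
  by (intro idl.subspace_sum[OF J] idl.subspace_scale[OF J] prod_cong_ideal[OF J] AB)

text \<open>Multilinearity of the determinant, one row after the other: \<open>T\<close> is the set of
  rows that have been replaced by combinations.\<close>

lemma det_combination_in_ideal:
  fixes R :: "'g \<Rightarrow> 'a::comm_ring_1^'n" and u :: "'n::finite \<Rightarrow> 'g \<Rightarrow> 'a"
  assumes J: "is_ideal J" and G: "finite G" and minors: "\<And>r. range r \<subseteq> G \<Longrightarrow> det (\<chi> i. R (r i)) \<in> J"
    and r: "range r \<subseteq> G"
  shows "det (\<chi> i. if i \<in> T then (\<Sum>g\<in>G. u i g *s R g) else R (r i)) \<in> J"
proof -
  have "finite T" by simp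
  then show ?thesis using r
  proof (induction T arbitrary: r rule: finite_induct)
    case empty
    then show ?case using minors by simp
  next
    case (insert k T)
    define c where "c = (\<lambda>i. if i \<in> T then (\<Sum>g\<in>G. u i g *s R g) else R (r i))"
    have "(\<chi> i. if i \<in> insert k T then (\<Sum>g\<in>G. u i g *s R g) else R (r i))
        = (\<chi> i. if i = k then (\<Sum>g\<in>G. u k g *s R g) else c i)"
      by (auto simp: vec_eq_iff c_def)
    then have "det (\<chi> i. if i \<in> insert k T then (\<Sum>g\<in>G. u i g *s R g) else R (r i))
        = (\<Sum>g\<in>G. det (\<chi> i. if i = k then u k g *s R g else c i))"
      using det_linear_row_sum[OF G, of k "\<lambda>i g. u k g *s R g" c] by simp
    also have "\<dots> = (\<Sum>g\<in>G. u k g * det (\<chi> i. if i = k then R g else c i))"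
      by (simp add: det_row_mul[of k _ "\<lambda>_. R _" c])
    also have "\<dots> \<in> J"
    proof (intro idl.subspace_sum[OF J] idl.subspace_scale[OF J])
      fix g assume g: "g \<in> G"
      have "(\<chi> i. if i = k then R g else c i)
          = (\<chi> i. if i \<in> T then (\<Sum>g\<in>G. u i g *s R g) else R ((r(k := g)) i))"
        using insert(2) by (auto simp: vec_eq_iff c_def)
      moreover have "range (r(k := g)) \<subseteq> G" using insert.prems g by auto
      ultimately show "det (\<chi> i. if i = k then R g else c i) \<in> J"
        using insert.IH[of "r(k := g)"] by simp
    qed
    finally show ?case .
  qed
qed

text \<open>By the product rule, the gradient of a combination of the generators is congruent modulo their
  ideal to the same combination of their gradients.\<close>

lemma jacobian_minor_in_different:
  fixes F :: "'n::finite option \<Rightarrow> ('n, 'k::field) bipoly"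
  assumes fin: "finite Fs" and F: "\<And>k. F k \<in> ideal_span Fs"
  shows "jacobian_minor F \<in> ideal_span (ideal_span Fs \<union> {jacobian_minor r | r. range r \<subseteq> Fs})"
    (is "_ \<in> ?J")
proof -
  have J: "is_ideal ?J" by (rule idl.subspace_span)
  have "\<exists>u. F k = (\<Sum>g\<in>Fs. u g * g)" for k
    using ideal_span_image[OF fin, of "F k" "\<lambda>g. g"] F[of k] by simp
  then have "\<forall>k. \<exists>u. F k = (\<Sum>g\<in>Fs. u g * g)" by blast
  then obtain u where "\<forall>k. F k = (\<Sum>g\<in>Fs. u k g * g)" by (rule choice[THEN exE])
  then have u: "\<And>k. F k = (\<Sum>g\<in>Fs. u k g * g)" by blast
  define R where "R = (\<lambda>g :: ('n, 'k) bipoly. (\<chi> c. partial_deriv (jacobian_var c) g))"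
  have "Fs \<noteq> {} \<or> (\<forall>k. F k = 0)" using u by auto
  then show ?thesis
  proof
    assume "\<forall>k. F k = 0"
    then have "F = (\<lambda>_. 0)" by auto
    moreover have "jacobian_minor (\<lambda>_ :: 'n option. 0 :: ('n, 'k) bipoly) = 0"
    proof -
      have "(\<chi> a c. partial_deriv (jacobian_var c) (0 :: ('n, 'k) bipoly))
          = (\<chi> i :: 'n option. (if i = None then 0 else (0 :: ('n, 'k) bipoly ^ 'n option)))"
        by (simp add: vec_eq_iff)
      then show ?thesis unfolding jacobian_minor_def by (simp only: det_row_0)
    qed
    ultimately show ?thesis by (simp add: idl.span_zero)
  next
    assume "Fs \<noteq> {}"
    then obtain g0 where g0: "g0 \<in> Fs" by blast
    have minors: "det (\<chi> i. R (r i)) \<in> ?J" if "range r \<subseteq> Fs" for r :: "'n option \<Rightarrow> ('n, 'k) bipoly"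
    proof -
      have "det (\<chi> i. R (r i)) = jacobian_minor r"
        unfolding jacobian_minor_def R_def by simp
      then show ?thesis using that by (auto intro!: idl.span_base)
    qed
    have "det (\<chi> i. \<Sum>g\<in>Fs. u i g *s R g) \<in> ?J"
      using det_combination_in_ideal[OF J fin minors, where r = "\<lambda>_. g0" and T = UNIV and u = u] g0 by simp
    moreover have "jacobian_minor F - det (\<chi> i. \<Sum>g\<in>Fs. u i g *s R g) \<in> ?J"
      unfolding jacobian_minor_def[of F]
    proof (rule det_cong_ideal[OF J])
      fix i j
      have "partial_deriv (jacobian_var j) (F i)
          = (\<Sum>g\<in>Fs. u i g * partial_deriv (jacobian_var j) g) + (\<Sum>g\<in>Fs. partial_deriv (jacobian_var j) (u i g) * g)"
        unfolding u[of i] partial_deriv_sum partial_deriv_mult sum.distrib by (rule add.commute)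
      moreover have "(\<Sum>g\<in>Fs. partial_deriv (jacobian_var j) (u i g) * g) \<in> ?J"
        by (intro idl.span_sum idl.span_scale idl.span_base) (auto intro: idl.span_base)
      ultimately show "(\<chi> a c. partial_deriv (jacobian_var c) (F a)) $ i $ j
          - (\<chi> i. \<Sum>g\<in>Fs. u i g *s R g) $ i $ j \<in> ?J"
        by (simp add: R_def)
    qed
    ultimately show ?thesis using idl.span_add by fastforce
  qed
qed

section \<open>The cone over a set of points\<close>

lemma infinite_nonzero: "infinite (UNIV - {0 :: 'k::field_char_0})"
  by (simp add: infinite_UNIV_char_0)

text \<open>As a function of the factor \<open>s\<close>, the value at the scaled point is a polynomial
  whose coefficients are the values of the homogeneous components at the point.\<close>

lemma hom_component_zero_of_scalings:
  fixes y :: "'v::finite \<Rightarrow> 'k::field_char_0" and g :: "('v, 'k) mpoly"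
  assumes c: "\<And>s m. pmono (c s) m = s ^ \<delta> m"
    and zero: "\<And>s. s \<noteq> 0 \<Longrightarrow> evaluate (\<lambda>x. c s x * y x) g = 0"
  shows "evaluate y (hom_component \<delta> d g) = 0"
proof -
  define q where "q = (\<Sum>i\<in>\<delta> ` keys g. Polynomial.monom (evaluate y (hom_component \<delta> i g)) i)"
  have "poly q s = evaluate (\<lambda>x. c s x * y x) g" for s
  proof -
    have "evaluate (\<lambda>x. c s x * y x) (hom_component \<delta> i g) = s ^ i * evaluate y (hom_component \<delta> i g)" for i
      by (rule evaluate_scaled) (auto simp: c keys_hom_component)
    then have "evaluate (\<lambda>x. c s x * y x) (\<Sum>i\<in>\<delta> ` keys g. hom_component \<delta> i g) = poly q s"
      by (simp add: evaluate_sum q_def poly_sum poly_monom mult.commute)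
    then show ?thesis using sum_hom_component[of g \<delta>] by simp
  qed
  then have "UNIV - {0} \<subseteq> {s. poly q s = 0}" using zero by auto
  then have "q = 0" using infinite_nonzero finite_subset poly_roots_finite by blast
  then have "0 = Polynomial.coeff q d" by simp
  also have "\<dots> = (\<Sum>i\<in>\<delta> ` keys g. if i = d then evaluate y (hom_component \<delta> d g) else 0)"
    unfolding q_def coeff_sum by (rule sum.cong) auto
  also have "\<dots> = evaluate y (hom_component \<delta> d g)"
  proof (cases "d \<in> \<delta> ` keys g")
    case False
    then have "hom_component \<delta> d g = 0"
      by (intro poly_mapping_eqI) (auto simp: lookup_hom_component when_def in_keys_iff)
    then show ?thesis by simp
  qed simp
  finally show ?thesis by simp
qed

context affine_points
begin

text \<open>The vanishing ideal contains only polynomials whose bihomogeneous components all vanish on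
  \<open>Z\<close>. To describe it as the set of polynomials vanishing on a set, the two blocks of
  coordinates have to be rescaled independently.\<close>

definition cone :: "(unit option + 'n option \<Rightarrow> 'k) set" where
  "cone = {case_sum (\<lambda>a. s * affine_rep (fst P) a) (\<lambda>b. t * affine_rep (snd P) b) | s t P.
    s \<noteq> 0 \<and> t \<noteq> 0 \<and> P \<in> Z}"

end

locale affine_points_char_0 = affine_points Z for Z :: "('n::finite, 'k::field_char_0) bipoint set"
begin

lemma ideal_eq_vanishing_on_cone:
  "bivanishing_ideal Z = {g. \<forall>z\<in>cone. evaluate z g = 0}"
proof (intro equalityI subsetI)
  fix g assume g: "g \<in> bivanishing_ideal Z"
  show "g \<in> {g. \<forall>z\<in>cone. evaluate z g = 0}"
  proof (intro CollectI ballI)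
    fix z assume "z \<in> cone"
    then obtain s t P where z: "s \<noteq> 0" "t \<noteq> 0" "P \<in> Z"
      "z = case_sum (\<lambda>a. s * affine_rep (fst P) a) (\<lambda>b. t * affine_rep (snd P) b)" by (auto simp: cone_def)
    have "(\<lambda>a. s * affine_rep (fst P) a) \<in> homog_coords (fst P)"
      "(\<lambda>b. t * affine_rep (snd P) b) \<in> homog_coords (snd P)"
      using affine[OF z(3)] z(1,2) by (auto intro!: homog_coords_scaled affine_rep)
    then show "evaluate z g = 0"
      using bivanishing_evaluate[OF g, of "fst P" "snd P"] z(3,4) by simp
  qed
next
  fix g assume g: "g \<in> {g. \<forall>z\<in>cone. evaluate z g = 0}"
  have comp: "evaluate (rep2 P) (hom_component degY j (hom_component degX i g)) = 0" if P: "P \<in> Z" for i j P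
  proof (rule hom_component_zero_of_scalings[where c = "\<lambda>t. case_sum (\<lambda>_. 1) (\<lambda>_. t)"])
    fix t :: 'k assume t: "t \<noteq> 0"
    have eq: "(\<lambda>x. case_sum (\<lambda>_. 1) (\<lambda>_. t) x * rep2 P x)
        = case_sum (affine_rep (fst P)) (\<lambda>b. t * affine_rep (snd P) b)"
      by (auto simp: rep2_def fun_eq_iff split: sum.split)
    show "evaluate (\<lambda>x. case_sum (\<lambda>_. 1) (\<lambda>_. t) x * rep2 P x) (hom_component degX i g) = 0"
      unfolding eq
    proof (rule hom_component_zero_of_scalings[where c = "\<lambda>s. case_sum (\<lambda>_. s) (\<lambda>_. 1)"])
      fix s :: 'k assume s: "s \<noteq> 0"
      have "(\<lambda>x. case_sum (\<lambda>_. s) (\<lambda>_. 1) x * case_sum (affine_rep (fst P)) (\<lambda>b. t * affine_rep (snd P) b) x)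
          = case_sum (\<lambda>a. s * affine_rep (fst P) a) (\<lambda>b. t * affine_rep (snd P) b)"
        by (auto simp: fun_eq_iff split: sum.split)
      moreover have "case_sum (\<lambda>a. s * affine_rep (fst P) a) (\<lambda>b. t * affine_rep (snd P) b) \<in> cone"
        unfolding cone_def using s t P by blast
      ultimately show "evaluate (\<lambda>x. case_sum (\<lambda>_. s) (\<lambda>_. 1) x
          * case_sum (affine_rep (fst P)) (\<lambda>b. t * affine_rep (snd P) b) x) g = 0"
        using g by simp
    qed (simp add: pmono_two_const)
  qed (simp add: pmono_two_const)
  have "hom_component degY j (hom_component degX i g) \<in> bivanishing_ideal Z" for i j
  proof -
    have "hom_component degY j (hom_component degX i g) \<in> bihom_piece i j"
      unfolding bihom_piece_eq using hom_component_in_piece hom_component_other_piece by blast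
    from bihom_in_ideal[OF this] show ?thesis using comp by blast
  qed
  then have sumY: "(\<Sum>j\<in>degY ` keys (hom_component degX i g). hom_component degY j (hom_component degX i g)) \<in> bivanishing_ideal Z" for i
    by (intro idl.subspace_sum[OF is_ideal_bivanishing])
  have "hom_component degX i g \<in> bivanishing_ideal Z" for i
    using sumY[of i] unfolding sum_hom_component[of "hom_component degX i g" degY, symmetric] .
  then have "(\<Sum>i\<in>degX ` keys g. hom_component degX i g) \<in> bivanishing_ideal Z"
    by (intro idl.subspace_sum[OF is_ideal_bivanishing])
  then show "g \<in> bivanishing_ideal Z" unfolding sum_hom_component[of g degX, symmetric] .
qed

text \<open>Along the cone the Jacobian determinant is changed by nonzero factors only, so its matrix
  remains invertible and the differentials take arbitrary values on directions in the affine
  coordinates.\<close>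

lemma regular_if_jacobian_nonzero:
  assumes F: "\<And>k. F k \<in> bihom_piece (a k) (b k)" "\<And>k. a k + b k \<ge> 1"
    and ideal: "bivanishing_ideal Z = ideal_span (range F)"
    and J: "\<And>P. P \<in> Z \<Longrightarrow> evaluate (rep2 P) (jacobian_minor F) \<noteq> 0"
    and k: "k \<notin> A" "F k * h \<in> ideal_span (F ` A)"
  shows "h \<in> ideal_span (F ` A)"
proof -
  interpret independent_differentials cone F "\<lambda>k. a k + b k"
  proof
    fix i
    show "F i \<in> piece tdeg (a i + b i)"
      using F(1)[of i] by (auto simp: bihom_piece_eq piece_def tdeg_eq)
    show "a i + b i \<ge> 1" by (rule F(2))
    show "ideal_span (range F) = {g. \<forall>z\<in>cone. evaluate z g = 0}"
      using ideal ideal_eq_vanishing_on_cone by simp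
  next
    fix z and l :: "'n option \<Rightarrow> 'k"
    assume "z \<in> cone"
    then obtain s t P where z: "s \<noteq> 0" "t \<noteq> 0" "P \<in> Z"
      "z = case_sum (\<lambda>a. s * affine_rep (fst P) a) (\<lambda>b. t * affine_rep (snd P) b)" by (auto simp: cone_def)
    define M where "M = (\<chi> i c. evaluate z (partial_deriv (jacobian_var c) (F i)))"
    have "det M = evaluate z (jacobian_minor F)" by (simp add: M_def evaluate_jacobian_minor)
    also have "\<dots> \<noteq> 0"
      unfolding z(4) evaluate_bihom_scaled[OF jacobian_minor_piece[OF F(1)]]
      using z(1,2) J[OF z(3)] by (simp add: rep2_def)
    finally have "invertible M" by (simp add: invertible_det_nz)
    then obtain M' where inv: "M ** M' = mat 1" unfolding invertible_def by blast
    define x where "x = M' *v (\<chi> i. l i)"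
    define v where "v = (\<lambda>y. \<Sum>c\<in>UNIV. if y = jacobian_var c then x $ c else 0)"
    have inj: "jacobian_var c = jacobian_var c' \<longleftrightarrow> c = c'" for c c' :: "'n option"
      by (cases c; cases c') auto
    have v: "v (jacobian_var c) = x $ c" "v (Inl None) = 0" "v (Inr None) = 0" for c
    proof -
      show "v (jacobian_var c) = x $ c" by (simp add: v_def inj)
      have "Inl None \<noteq> jacobian_var c" "Inr None \<noteq> jacobian_var c" for c :: "'n option"
        by (cases c; simp)+
      then show "v (Inl None) = 0" "v (Inr None) = 0" by (simp_all add: v_def)
    qed
    have "(\<Sum>y\<in>UNIV. v y * evaluate z (partial_deriv y (F i))) = l i" for i
    proof -
      have "(\<Sum>y\<in>UNIV. v y * evaluate z (partial_deriv y (F i))) = (M *v x) $ i"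
        unfolding sum_variables v by (simp add: M_def matrix_vector_mult_def mult.commute)
      also have "M *v x = (\<chi> i. l i)"
        by (simp add: x_def matrix_vector_mul_assoc inv)
      finally show ?thesis by simp
    qed
    then show "\<exists>v. \<forall>i. (\<Sum>x\<in>UNIV. v x * evaluate z (partial_deriv x (F i))) = l i" by blast
  qed
  show ?thesis by (rule regular[OF k])
qed

lemma ideal_eq_if_bihom_subset:
  assumes F: "\<And>k. F k \<in> bivanishing_ideal Z"
    and sub: "\<And>f i j. f \<in> bihom_piece i j \<Longrightarrow> (\<And>P. P \<in> Z \<Longrightarrow> evaluate (rep2 P) f = 0)
      \<Longrightarrow> f \<in> ideal_span (range F)"
  shows "bivanishing_ideal Z = ideal_span (range F)"
proof
  show "ideal_span (range F) \<subseteq> bivanishing_ideal Z"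
    using F by (intro idl.span_minimal[OF _ is_ideal_bivanishing]) auto
  show "bivanishing_ideal Z \<subseteq> ideal_span (range F)"
    unfolding bivanishing_ideal_eq
  proof (rule idl.span_minimal[OF _ idl.subspace_span], clarify)
    fix f assume f: "bihomogeneous f"
      "\<forall>(p, q)\<in>Z. \<forall>v\<in>homog_coords p. \<forall>w\<in>homog_coords q. evaluate (case_sum v w) f = 0"
    then obtain i j where ij: "f \<in> bihom_piece i j" by (auto simp: bihomogeneous_def)
    show "f \<in> ideal_span (range F)"
      using sub[OF ij] f(2) unfolding vanishing_on_reps[OF ij] by blast
  qed
qed

text \<open>The value of \<open>f\<close> at \<open>P\<close> depends only on its component of degree
  \<open>(D1, D2)\<close>. To this component only minors of at most this degree contribute, so one
  of them does not vanish at \<open>P\<close>.\<close>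

lemma nonvanishing_minor:
  assumes Fs: "\<And>g. g \<in> Fs \<Longrightarrow> g \<in> bihom_piece (a g) (b g)"
    and f: "f \<in> bihom_piece D1 D2" "f \<in> ideal_span (bivanishing_ideal Z \<union> {jacobian_minor r | r. range r \<subseteq> Fs})"
    and P: "P \<in> Z" "evaluate (rep2 P) f \<noteq> 0"
  obtains r Q where "range r \<subseteq> Fs" "Q \<in> Z" "evaluate (rep2 Q) (jacobian_minor r) \<noteq> 0"
    "(\<Sum>k\<in>UNIV. a (r k)) \<le> D1 + 1" "(\<Sum>k\<in>UNIV. b (r k)) \<le> D2 + CARD('n)"
proof (rule ccontr)
  note minor = that
  assume "\<not> thesis"
  then have small: "evaluate (rep2 Q) (jacobian_minor r) = 0"
    if "range r \<subseteq> Fs" "Q \<in> Z" "(\<Sum>k\<in>UNIV. a (r k)) \<le> D1 + 1" "(\<Sum>k\<in>UNIV. b (r k)) \<le> D2 + CARD('n)" for r Q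
    using that minor by blast
  have "\<forall>i\<le>D1. \<forall>j\<le>D2. evaluate (rep2 P) (hom_component degX i (hom_component degY j f)) = 0"
    using f(2)
  proof (induction rule: idl.span_induct_alt)
    case (step c x y)
    have "evaluate (rep2 P) (hom_component degX i (hom_component degY j (c * x))) = 0" if ij: "i \<le> D1" "j \<le> D2" for i j
    proof (cases "x \<in> bivanishing_ideal Z")
      case True
      then have "c * x \<in> bivanishing_ideal Z" by (rule idl.subspace_scale[OF is_ideal_bivanishing])
      then show ?thesis using ideal_evaluate[OF ideal_bihom_components P(1)] by blast
    next
      case False
      then obtain r where r: "range r \<subseteq> Fs" "x = jacobian_minor r" using step(1) by blast
      have rk: "r k \<in> bihom_piece (a (r k)) (b (r k))" for k using Fs r(1) by blast
      define s where "s = (\<Sum>k\<in>UNIV. a (r k)) - 1"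
      define t where "t = (\<Sum>k\<in>UNIV. b (r k)) - CARD('n)"
      have x: "x \<in> piece degX s" "x \<in> piece degY t"
        using jacobian_minor_piece[OF rk] unfolding r(2) s_def t_def bihom_piece_eq by auto
      show ?thesis
      proof (cases "x = 0 \<or> j < t \<or> i < s")
        case True
        then show ?thesis
          by (auto simp: degY.hom_component_mult_piece[OF x(2)] degX.hom_component_mult_piece[OF x(1)])
      next
        case False
        then obtain m where m: "m \<in> keys (jacobian_minor r)" using r(2) by fastforce
        have "(\<Sum>k\<in>UNIV. a (r k)) = s + 1" "(\<Sum>k\<in>UNIV. b (r k)) = t + CARD('n)"
          using jacobian_minor_degree[of r "\<lambda>k. a (r k)" "\<lambda>k. b (r k)", OF rk m]
          unfolding s_def t_def by linarith+
        then have "evaluate (rep2 P) x = 0"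
          unfolding r(2) using False ij by (intro small r(1) P(1)) auto
        then show ?thesis
          by (simp add: degY.hom_component_mult_piece[OF x(2)] degX.hom_component_mult_piece[OF x(1)])
      qed
    qed
    then show ?case using step by (simp add: hom_component_add)
  qed simp
  then have "evaluate (rep2 P) (hom_component degX D1 (hom_component degY D2 f)) = 0" by blast
  then show False using P(2) bihom_component[OF f(1)] by simp
qed

end

section \<open>From the different to a complete intersection\<close>

lemma evaluate_degY_0:
  assumes "f \<in> bihom_piece i 0"
  shows "evaluate (case_sum v w) f = evaluate (case_sum v w') f"
proof -
  have "pmono (case_sum v w) m = pmono (case_sum v w') m" if "m \<in> keys f" for m
  proof -
    have "degY m = 0" using assms that by (auto simp: bihom_piece_eq piece_def)
    then have "right m = 0" by (intro poly_mapping_eqI) (simp add: degY_def lookup_right)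
    then show ?thesis by (simp add: pmono_case_sum)
  qed
  then show ?thesis by (simp add: evaluate_eq_peval peval_def extend_def)
qed

context affine_points_char_0
begin

text \<open>After fixing suitable values of \<open>Y\<close>, the form becomes a nonzero binary form that
  vanishes at all points of the projection to the line.\<close>

lemma line_generator_degree:
  assumes F: "f \<in> bihom_piece a 0" "f \<noteq> 0" "\<And>P. P \<in> Z \<Longrightarrow> evaluate (rep2 P) f = 0"
  shows "card (fst ` Z) \<le> a"
proof -
  obtain z where z: "evaluate z f \<noteq> 0" using evaluate_all_zero F(2) by blast
  define w where "w = (\<lambda>b. z (Inr b))"
  obtain g where g: "g \<in> hom_piece a" "\<And>v. evaluate v g = evaluate (case_sum v w) f"
    using sliceX[OF F(1)] by blast
  have "case_sum (\<lambda>a. z (Inl a)) w = z" by (auto simp: w_def fun_eq_iff split: sum.split)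
  then have "g \<noteq> 0" using z g(2)[of "\<lambda>a. z (Inl a)"] by auto
  moreover have "evaluate (affine_rep q) g = 0" if q: "q \<in> fst ` Z" for q
  proof -
    obtain P where "P \<in> Z" "q = fst P" using q by auto
    then have "evaluate (affine_rep q) g = evaluate (rep2 P) f"
      unfolding g(2) rep2_def using evaluate_degY_0[OF F(1)] by simp
    then show ?thesis using F(3) \<open>P \<in> Z\<close> by simp
  qed
  ultimately show ?thesis using binary_form_zeros[OF g(1)] fst.finite_S fst.affine by blast
qed

definition line_form :: "('n, 'k) bipoly" where
  "line_form = (\<Prod>q\<in>fst ` Z. var (Inl (Some ())) - const (affine_rep q (Some ())) * var (Inl None))"

lemma line_form:
  "line_form \<in> bihom_piece (card (fst ` Z)) 0" "line_form \<noteq> 0"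
  "P \<in> Z \<Longrightarrow> evaluate (rep2 P) line_form = 0"
proof -
  have X: "var (Inl (Some ())) - const c * var (Inl None) \<in> piece degX 1"
    "var (Inl (Some ())) - const c * var (Inl None) \<in> piece degY 0" for c :: 'k
    by (intro piece_diff degX.piece_const_mult degY.piece_const_mult; simp add: var_piece)+
  show "line_form \<in> bihom_piece (card (fst ` Z)) 0"
  proof -
    have "line_form \<in> piece degX (\<Sum>q\<in>fst ` Z. 1)"
      unfolding line_form_def by (rule degX.piece_prod) (rule X)
    moreover have "line_form \<in> piece degY (\<Sum>q\<in>fst ` Z. 0)"
      unfolding line_form_def by (rule degY.piece_prod) (rule X)
    ultimately show ?thesis by (simp add: bihom_piece_eq)
  qed
  obtain t where t: "t \<notin> (\<lambda>q. affine_rep q (Some ())) ` fst ` Z"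
    using ex_new_if_finite[OF infinite_UNIV_char_0, of "(\<lambda>q. affine_rep q (Some ())) ` fst ` Z"]
      fst.finite_S by blast
  have "evaluate (case_sum (\<lambda>a. if a = None then 1 else t) (\<lambda>_. 0)) line_form
      = (\<Prod>q\<in>fst ` Z. t - affine_rep q (Some ()))"
    by (simp add: line_form_def evaluate_prod)
  also have "\<dots> \<noteq> 0" using t fst.finite_S by auto
  finally show "line_form \<noteq> 0" by auto
  show "evaluate (rep2 P) line_form = 0" if "P \<in> Z"
    unfolding line_form_def evaluate_prod
  proof (rule prod_zero[OF fst.finite_S], rule bexI)
    show "fst P \<in> fst ` Z" using that by simp
    show "evaluate (rep2 P) (var (Inl (Some ())) - const (affine_rep (fst P) (Some ())) * var (Inl None)) = 0"
      using rep2_X0[OF that] by (simp add: rep2_def)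
  qed
qed

text \<open>The product \<open>line_form\<close> of the linear forms of the points of the line lies in the
  ideal and has degree \<open>0\<close> in \<open>Y\<close>. So some generator has degree
  \<open>0\<close> in \<open>Y\<close>; it vanishes on the points of the line and uses up all of the
  available degree in \<open>X\<close>, so that the other generators have degree \<open>0\<close> in
  \<open>X\<close>.\<close>

lemma complete_intersection_of_generators:
  fixes F :: "'n option \<Rightarrow> ('n, 'k) bipoly"
  assumes F: "\<And>k. F k \<in> bihom_piece (a k) (b k)"
    and ideal: "bivanishing_ideal Z = ideal_span (range F)"
    and J: "\<And>P. P \<in> Z \<Longrightarrow> evaluate (rep2 P) (jacobian_minor F) \<noteq> 0"
    and a: "(\<Sum>k\<in>UNIV. a k) \<le> card (fst ` Z)"
  shows "\<exists>ds. (\<forall>d\<in>set ds. d \<ge> 1) \<and> complete_intersection Z (card (fst ` Z)) ds"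
proof -
  define d where "d = card (fst ` Z)"
  have d: "d \<ge> 1"
    unfolding d_def using fst.finite_S fst.nonempty by (simp add: Suc_le_eq card_gt_0_iff)
  have vanish: "evaluate (rep2 P) (F k) = 0" if "P \<in> Z" for k P
  proof (rule ideal_evaluate[OF _ that])
    show "F k \<in> bivanishing_ideal Z" unfolding ideal by (simp add: idl.span_base)
  qed
  obtain P0 where P0: "P0 \<in> Z" using nonempty by blast
  have nz: "F k \<noteq> 0" for k
  proof
    assume Fk: "F k = 0"
    have "det (\<chi> i c. evaluate (rep2 P0) (partial_deriv (jacobian_var c) (F i))) = 0"
      by (rule det_zero_row(1)[of k]) (simp add: row_def vec_eq_iff Fk)
    then show False using J[OF P0] by (simp add: evaluate_jacobian_minor)
  qed
  have pos: "b k \<ge> 1" if "a k = 0" for k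
  proof (rule ccontr)
    assume "\<not> b k \<ge> 1"
    then have "b k = 0" by simp
    then have "F k \<in> bihom_piece 0 0" using F[of k] that by simp
    then have "card (fst ` Z) \<le> 0" by (rule line_generator_degree[OF _ nz vanish])
    then show False using d by (simp add: d_def)
  qed
  have "\<exists>k. b k = 0"
  proof (rule ccontr)
    assume "\<not> (\<exists>k. b k = 0)"
    then have bk: "\<not> b k \<le> 0" for k :: "'n option" by simp
    have "line_form \<in> bivanishing_ideal Z"
      using bihom_in_ideal[OF line_form(1)] line_form(3) by blast
    then obtain u where u: "line_form = (\<Sum>k\<in>UNIV. u k * F k)"
      using ideal_span_image[of UNIV line_form F] unfolding ideal by auto
    have "line_form = (\<Sum>k\<in>UNIV. (if b k \<le> 0 then hom_component degY (0 - b k) (u k) else 0) * F k)"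
      by (rule degY.homogeneous_combination[OF _ u]) (use line_form(1) F in \<open>auto simp: bihom_piece_eq\<close>)
    also have "\<dots> = 0"
      using bk by (intro sum.neutral ballI) (simp only: if_False mult_zero_left)
    finally show False using line_form(2) by blast
  qed
  then obtain k0 where k0: "b k0 = 0" by blast
  have "d \<le> a k0"
    unfolding d_def by (rule line_generator_degree[OF _ nz vanish]) (use F[of k0] k0 in auto)
  moreover have "(\<Sum>k\<in>UNIV. a k) = a k0 + (\<Sum>k\<in>UNIV - {k0}. a k)" by (simp add: sum.remove)
  ultimately have a_k0: "a k0 = d" and "(\<Sum>k\<in>UNIV - {k0}. a k) = 0"
    using a unfolding d_def by linarith+
  then have a_0: "a k = 0" if "k \<noteq> k0" for k using that by auto
  have deg_pos: "a k + b k \<ge> 1" for k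
    using d a_k0 a_0[of k] pos[of k] by (cases "k = k0") auto
  obtain ks where ks: "set ks = UNIV - {k0}" "distinct ks"
    using finite_distinct_list[of "UNIV - {k0}"] by auto
  have len: "length ks = CARD('n)"
    using distinct_card[OF ks(2)] by (simp add: ks(1) card_Diff_singleton)
  have set_F: "set (F k0 # map F ks) = range F" using ks(1) by auto
  have "complete_intersection Z d (map b ks)"
    unfolding complete_intersection_def
  proof (intro conjI exI)
    show "length (map b ks) = CARD('n)" "length (map F ks) = length (map b ks)" by (simp_all add: len)
    show "F k0 \<in> bihom_piece d 0" using F[of k0] a_k0 k0 by simp
    show "\<forall>j<length (map b ks). map F ks ! j \<in> bihom_piece 0 (map b ks ! j)"
    proof (intro allI impI)
      fix j assume j: "j < length (map b ks)"
      then have "ks ! j \<noteq> k0" using ks(1) nth_mem[of j ks] by auto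
      then show "map F ks ! j \<in> bihom_piece 0 (map b ks ! j)"
        using F[of "ks ! j"] a_0[of "ks ! j"] j by simp
    qed
    show "bivanishing_ideal Z = Idl\<^bsub>type_ring\<^esub> (set (F k0 # map F ks))"
      unfolding genideal_eq set_F by (rule ideal)
    show "regular_sequence type_ring (F k0 # map F ks)"
      unfolding regular_sequence_def genideal_eq
    proof (intro conjI allI ballI impI)
      show "ideal_span (set (F k0 # map F ks)) \<noteq> carrier type_ring"
        unfolding set_F ideal[symmetric] using one_notin_ideal by auto
      fix i g assume i: "i < length (F k0 # map F ks)"
        and g: "(F k0 # map F ks) ! i \<otimes>\<^bsub>type_ring\<^esub> g \<in> ideal_span (set (take i (F k0 # map F ks)))"
      define ls where "ls = k0 # ks"
      have ls: "distinct ls" "F k0 # map F ks = map F ls" "i < length ls" using ks i by (auto simp: ls_def)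
      have notin: "ls ! i \<notin> set (take i ls)"
        using ls(1,3) by (auto simp: in_set_conv_nth nth_eq_iff_index_eq)
      have "F (ls ! i) * g \<in> ideal_span (F ` set (take i ls))"
        using g ls(3) unfolding ls(2) by (simp add: take_map)
      then have "g \<in> ideal_span (F ` set (take i ls))"
        by (rule regular_if_jacobian_nonzero[OF F deg_pos ideal _ notin, rotated]) (rule J)
      then show "g \<in> ideal_span (set (take i (F k0 # map F ks)))"
        unfolding ls(2) by (simp add: take_map)
    qed simp
  qed
  moreover have "\<forall>e\<in>set (map b ks). e \<ge> 1" using ks(1) a_0 pos by auto
  ultimately show ?thesis unfolding d_def by blast
qed

text \<open>The set is a product, and by the Cayley-Bacharach property all points of the second projection
  share the separator degree of a worst one, which is \<open>r\<close>. This yields weights for the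
  degrees \<open>(d - 1, r)\<close> that do not vanish at a point where a minor of small degree is
  nonzero; the constant of \<open>exists_determinant_constant\<close> is then nonzero too, and can
  be divided out.\<close>

lemma complete_intersection_if_different_nonzero:
  assumes star: "star_property Z" and CB: "cayley_bacharach Z" and gens: "bihom_generators Z Fs"
    and diff: "HF_module Z (kaehler_different Z Fs) (card (fst ` Z) - 1) (regularity_index (snd ` Z)) \<noteq> 0"
  shows "\<exists>ds. (\<forall>d\<in>set ds. d \<ge> 1) \<and> complete_intersection Z (card (fst ` Z)) ds"
proof -
  define d where "d = card (fst ` Z)"
  define r where "r = regularity_index (snd ` Z)"
  have d: "d \<ge> 1"
    unfolding d_def using fst.finite_S fst.nonempty by (simp add: Suc_le_eq card_gt_0_iff)
  have prod: "Z = fst ` Z \<times> snd ` Z" by (rule star_cayley_bacharach_product[OF star CB])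
  have ideal_Fs: "bivanishing_ideal Z = ideal_span Fs"
    using gens by (simp add: bihom_generators_def genideal_eq)
  have "\<exists>i j. g \<in> bihom_piece i j" if "g \<in> Fs" for g
    using gens that by (auto simp: bihom_generators_def bihomogeneous_def)
  then obtain a b where ab: "\<And>g. g \<in> Fs \<Longrightarrow> g \<in> bihom_piece (a g) (b g)" by metis
  obtain f P where f: "f \<in> bihom_piece (d - 1) r"
    "f \<in> ideal_span (bivanishing_ideal Z \<union> {jacobian_minor r | r. range r \<subseteq> Fs})" "P \<in> Z" "evaluate (rep2 P) f \<noteq> 0"
    using diff unfolding different_nonzero_iff d_def r_def by blast
  obtain F P0 where F: "range F \<subseteq> Fs" "P0 \<in> Z" "evaluate (rep2 P0) (jacobian_minor F) \<noteq> 0"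
    "(\<Sum>k\<in>UNIV. a (F k)) \<le> d - 1 + 1" "(\<Sum>k\<in>UNIV. b (F k)) \<le> r + CARD('n)"
    by (rule nonvanishing_minor[OF ab f])
  have F_piece: "F k \<in> bihom_piece (a (F k)) (b (F k))" for k using ab F(1) by blast
  have F_ideal: "F k \<in> bivanishing_ideal Z" for k
    unfolding ideal_Fs using F(1) by (intro idl.span_base) auto
  have below1: "\<not> sep (fst ` Z) i (fst P0)" if "i < d - 1" for i
    using sep_line_iff[OF fst.affine_proj_points_axioms, of "fst P0" i] F(2) that by (auto simp: d_def)
  have below2: "\<not> sep (snd ` Z) i (snd P0)" if i: "i < r" for i
  proof
    assume sep: "sep (snd ` Z) i (snd P0)"
    obtain q where q: "q \<in> snd ` Z" "\<not> sep (snd ` Z) i q"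
      using snd.regularity_index_below i unfolding r_def by blast
    have Q: "(fst P0, q) \<in> Z"
    proof -
      have "(fst P0, q) \<in> fst ` Z \<times> snd ` Z" using F(2) q(1) by auto
      then show ?thesis using prod by simp
    qed
    have "bisep Z (d - 1) i P0"
      unfolding bisep_product_iff[OF prod F(2)] d_def using sep fst.sep_large F(2) by blast
    then have "bisep Z (d - 1) i (fst P0, q)"
      using CB Q F(2) unfolding cayley_bacharach_iff by blast
    then show False using q(2) unfolding bisep_product_iff[OF prod Q] by simp
  qed
  obtain \<phi>1 where \<phi>1: "\<phi>1 (fst P0) \<noteq> 0"
    "\<And>f i. i < d - 1 \<Longrightarrow> f \<in> hom_piece i \<Longrightarrow> (\<Sum>q\<in>fst ` Z. \<phi>1 q * evaluate (affine_rep q) f) = 0"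
    by (rule fst.functional_killing_low_degrees[of "fst P0" "d - 1"]) (use F(2) below1 in auto)
  obtain \<phi>2 where \<phi>2: "\<phi>2 (snd P0) \<noteq> 0"
    "\<And>f i. i < r \<Longrightarrow> f \<in> hom_piece i \<Longrightarrow> (\<Sum>q\<in>snd ` Z. \<phi>2 q * evaluate (affine_rep q) f) = 0"
    by (rule snd.functional_killing_low_degrees[of "snd P0" r]) (use F(2) below2 in auto)
  interpret weighted_points Z rep2 "\<lambda>P. \<phi>1 (fst P) * \<phi>2 (snd P)" "d - 1" r
    by (rule weighted_points_product[OF prod \<phi>1(2) \<phi>2(2)])
  have vanish: "evaluate (rep2 P) (F k) = 0" if "P \<in> Z" for k P
    by (rule ideal_evaluate[OF F_ideal that])
  obtain c where c: "\<And>P. P \<in> Z \<Longrightarrow> \<phi>1 (fst P) * \<phi>2 (snd P) * evaluate (rep2 P) (jacobian_minor F) = c"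
    "\<And>f i j. f \<in> bihom_piece i j \<Longrightarrow> (\<And>P. P \<in> Z \<Longrightarrow> evaluate (rep2 P) f = 0) \<Longrightarrow> const c * f \<in> ideal_span (range F)"
    "(\<Sum>k\<in>UNIV. a (F k)) < d - 1 + 1 \<or> (\<Sum>k\<in>UNIV. b (F k)) < r + CARD('n) \<Longrightarrow> c = 0"
    using exists_determinant_constant[OF F_piece vanish F(4,5)] by blast
  have "c \<noteq> 0" using c(1)[OF F(2)] \<phi>1(1) \<phi>2(1) F(3) by auto
  have in_span: "f \<in> ideal_span (range F)" if "f \<in> bihom_piece i j" "\<And>P. P \<in> Z \<Longrightarrow> evaluate (rep2 P) f = 0" for f i j
  proof -
    have "const (inverse c) * (const c * f) \<in> ideal_span (range F)"
      using c(2)[OF that] by (rule idl.span_scale)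
    moreover have "const (inverse c) * (const c * f) = f"
      using \<open>c \<noteq> 0\<close> by (simp add: mult.assoc[symmetric] flip: const_simps(4))
    ultimately show ?thesis by simp
  qed
  have ideal: "bivanishing_ideal Z = ideal_span (range F)"
    by (rule ideal_eq_if_bihom_subset[OF F_ideal in_span])
  show ?thesis
  proof (rule complete_intersection_of_generators[OF F_piece ideal])
    show "evaluate (rep2 P) (jacobian_minor F) \<noteq> 0" if "P \<in> Z" for P
      using c(1)[OF that] \<open>c \<noteq> 0\<close> by auto
    show "(\<Sum>k\<in>UNIV. a (F k)) \<le> card (fst ` Z)" using F(4) d by (simp add: d_def)
  qed
qed

end

section \<open>From a complete intersection to the different\<close>

context affine_points_char_0
begin

lemma evaluate_range_combination:
  assumes "\<And>k. evaluate z (F k) = 0" "f \<in> ideal_span (range F)"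
  shows "evaluate z f = 0"
  using assms(2)
proof (induction rule: idl.span_induct_alt)
  case (step c x y)
  then show ?case using assms(1) by auto
qed simp

text \<open>If \<open>p\<close> and \<open>q\<close> belong to the projections, then all generators vanish
  at \<open>(p, q)\<close>, because each of them involves only one block of coordinates. If
  \<open>(p, q)\<close> were not in \<open>Z\<close>, a form vanishing on \<open>Z\<close> but not
  at \<open>(p, q)\<close> would contradict this.\<close>

lemma product_of_separated_generators:
  fixes F :: "'n option \<Rightarrow> ('n, 'k) bipoly"
  assumes F: "\<And>k. F k \<in> bihom_piece (a k) (b k)" "\<And>k. a k = 0 \<or> b k = 0"
    and ideal: "bivanishing_ideal Z = ideal_span (range F)"
  shows "Z = fst ` Z \<times> snd ` Z"
proof -
  have vanish: "evaluate (rep2 P) (F k) = 0" if "P \<in> Z" for k P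
    by (rule ideal_evaluate[OF _ that]) (simp add: ideal idl.span_base)
  have "(p, q) \<in> Z" if pq: "p \<in> fst ` Z" "q \<in> snd ` Z" for p q
  proof (rule ccontr)
    assume notin: "(p, q) \<notin> Z"
    obtain P Q where PQ: "P \<in> Z" "p = fst P" "Q \<in> Z" "q = snd Q" using pq by auto
    have zero: "evaluate (rep2 (p, q)) (F k) = 0" for k
    proof (cases "b k = 0")
      case True
      then have "evaluate (rep2 (p, q)) (F k) = evaluate (rep2 P) (F k)"
        unfolding rep2_def PQ(2) fst_conv snd_conv
        by (intro evaluate_degY_0[of "F k" "a k"]) (metis F(1))
      then show ?thesis using vanish[OF PQ(1)] by simp
    next
      case False
      then have "a k = 0" using F(2)[of k] by simp
      then have "evaluate (rep2 (p, q)) (F k) = evaluate (rep2 Q) (F k)"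
        unfolding rep2_def PQ(4) fst_conv snd_conv
        by (intro evaluate_degX_0[of "F k" "b k"]) (metis F(1))
      then show ?thesis using vanish[OF PQ(3)] by simp
    qed
    obtain f i j where f: "f \<in> bihom_piece i j"
      "\<And>v w. v \<in> homog_coords p \<Longrightarrow> w \<in> homog_coords q \<Longrightarrow> evaluate (case_sum v w) f \<noteq> 0"
      "\<And>p' q' v w. (p', q') \<in> insert (p, q) Z - {(p, q)} \<Longrightarrow> v \<in> homog_coords p' \<Longrightarrow> w \<in> homog_coords q'
        \<Longrightarrow> evaluate (case_sum v w) f = 0"
      using general_separator[of "insert (p, q) Z" p q] finite_Z by blast
    have "evaluate (rep2 R) f = 0" if R: "R \<in> Z" for R
    proof -
      have "(fst R, snd R) \<in> insert (p, q) Z - {(p, q)}" using R notin by auto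
      then show ?thesis
        unfolding rep2_def by (rule f(3)[OF _ affine_rep(1) affine_rep(1)]) (use affine[OF R] in auto)
    qed
    then have "f \<in> ideal_span (range F)" using bihom_in_ideal[OF f(1)] ideal by blast
    then have "evaluate (rep2 (p, q)) f = 0" by (rule evaluate_range_combination[OF zero])
    moreover have "evaluate (rep2 (p, q)) f \<noteq> 0"
      unfolding rep2_def fst_conv snd_conv
      by (intro f(2) affine_rep(1) fst.affine[OF pq(1)] snd.affine[OF pq(2)])
    ultimately show False by blast
  qed
  then show ?thesis by force
qed

text \<open>The vanishing ideal contains, for each affine coordinate, a form whose only nonvanishing
  partial derivative among those for the affine coordinates at the given point is the one for this coordinate: the product
  of a linear form with a separator. Writing these forms in terms of the generators inverts the
  Jacobian matrix.\<close>

lemma jacobian_nonzero_if_generators: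
  fixes F :: "'n option \<Rightarrow> ('n, 'k) bipoly"
  assumes ideal: "bivanishing_ideal Z = ideal_span (range F)" and P: "P \<in> Z"
  shows "evaluate (rep2 P) (jacobian_minor F) \<noteq> 0"
proof -
  have PZ: "(fst P, snd P) \<in> Z" using P by simp
  obtain s i j where s: "s \<in> bihom_piece i j"
    "\<And>v w. v \<in> homog_coords (fst P) \<Longrightarrow> w \<in> homog_coords (snd P) \<Longrightarrow> evaluate (case_sum v w) s \<noteq> 0"
    "\<And>p' q' v w. (p', q') \<in> Z - {(fst P, snd P)} \<Longrightarrow> v \<in> homog_coords p' \<Longrightarrow> w \<in> homog_coords q'
      \<Longrightarrow> evaluate (case_sum v w) s = 0"
    using general_separator[OF finite_Z PZ] by blast
  have sP: "evaluate (rep2 P) s \<noteq> 0"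
    unfolding rep2_def by (intro s(2) affine_rep(1)) (use affine[OF P] in auto)
  have sQ: "evaluate (rep2 Q) s = 0" if Q: "Q \<in> Z" "Q \<noteq> P" for Q
  proof -
    have "(fst Q, snd Q) \<in> Z - {(fst P, snd P)}" using Q by (auto simp: prod_eq_iff)
    then show ?thesis
      unfolding rep2_def by (rule s(3)[OF _ affine_rep(1) affine_rep(1)]) (use affine[OF Q(1)] in auto)
  qed
  define base :: "'n option \<Rightarrow> unit option + 'n option"
    where "base = (\<lambda>c. case c of None \<Rightarrow> Inl None | Some _ \<Rightarrow> Inr None)"
  have base: "rep2 P (base c) = 1" "jacobian_var c' \<noteq> base c" for c c'
    using rep2_X0[OF P] rep2_Y0[OF P] by (cases c; cases c'; simp add: base_def)+
  define l where "l = (\<lambda>c. var (jacobian_var c) - const (rep2 P (jacobian_var c)) * var (base c))"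
  have l_piece: "\<exists>i j. l c \<in> bihom_piece i j" for c
  proof (cases c)
    case None
    have "l c \<in> bihom_piece 1 0"
      unfolding l_def base_def bihom_piece_eq None
      by (auto intro!: piece_diff degX.piece_const_mult degY.piece_const_mult simp: var_piece)
    then show ?thesis by blast
  next
    case (Some e)
    have "l c \<in> bihom_piece 0 1"
      unfolding l_def base_def bihom_piece_eq Some
      by (auto intro!: piece_diff degX.piece_const_mult degY.piece_const_mult simp: var_piece)
    then show ?thesis by blast
  qed
  have lP: "evaluate (rep2 P) (l c) = 0" for c by (simp add: l_def base)
  have "l c * s \<in> ideal_span (range F)" for c
  proof -
    obtain i' j' where "l c \<in> bihom_piece i' j'" using l_piece by blast
    from bihom_piece_mult[OF this s(1)] have "l c * s \<in> bivanishing_ideal Z \<longleftrightarrow> (\<forall>Q\<in>Z. evaluate (rep2 Q) (l c * s) = 0)"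
      by (rule bihom_in_ideal)
    moreover have "evaluate (rep2 Q) (l c * s) = 0" if "Q \<in> Z" for Q
      using lP sQ[OF that] by (cases "Q = P") auto
    ultimately show ?thesis using ideal by blast
  qed
  then have "\<forall>c. \<exists>u. l c * s = (\<Sum>k\<in>UNIV. u k * F k)"
    using ideal_span_image[of UNIV _ F] by auto
  then obtain u where "\<forall>c. l c * s = (\<Sum>k\<in>UNIV. u c k * F k)" by (rule choice[THEN exE])
  then have u: "\<And>c. l c * s = (\<Sum>k\<in>UNIV. u c k * F k)" by blast
  have FP: "evaluate (rep2 P) (F k) = 0" for k
    by (rule ideal_evaluate[OF _ P]) (simp add: ideal idl.span_base)
  define U where "U = (\<chi> c k. evaluate (rep2 P) (u c k))"
  define M where "M = (\<chi> k c. evaluate (rep2 P) (partial_deriv (jacobian_var c) (F k)))"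
  define E where "E = (\<chi> c c'. if c = c' then evaluate (rep2 P) s else 0 :: 'k ^ 'n option ^ 'n option)"
  have inj: "jacobian_var c = jacobian_var c' \<longleftrightarrow> c = c'" for c c' :: "'n option"
    by (cases c; cases c') auto
  have "U ** M = E"
  proof -
    have "(\<Sum>k\<in>UNIV. evaluate (rep2 P) (u c k) * evaluate (rep2 P) (partial_deriv (jacobian_var c') (F k)))
        = (if c = c' then evaluate (rep2 P) s else 0)" for c c'
    proof -
      have "(\<Sum>k\<in>UNIV. evaluate (rep2 P) (u c k) * evaluate (rep2 P) (partial_deriv (jacobian_var c') (F k)))
          = evaluate (rep2 P) (partial_deriv (jacobian_var c') (\<Sum>k\<in>UNIV. u c k * F k))"
        by (simp add: partial_deriv_sum partial_deriv_mult evaluate_sum FP)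
      also have "\<dots> = evaluate (rep2 P) (partial_deriv (jacobian_var c') (l c * s))" by (simp add: u)
      also have "\<dots> = evaluate (rep2 P) (partial_deriv (jacobian_var c') (l c)) * evaluate (rep2 P) s"
        by (simp add: partial_deriv_mult lP)
      also have "partial_deriv (jacobian_var c') (l c) = (if c = c' then 1 else 0)"
      proof -
        have "partial_deriv v (f - g) = partial_deriv v f - partial_deriv v g" for v and f g :: "('n, 'k) bipoly"
          using partial_deriv_add[of v "f - g" g] by simp
        then show ?thesis using base(2)[of c' c] by (simp add: l_def partial_deriv_mult inj eq_commute)
      qed
      finally show ?thesis by simp
    qed
    then show ?thesis by (simp add: U_def M_def E_def matrix_matrix_mult_def vec_eq_iff)
  qed
  then have "det U * det M = det E" using det_mul[of U M] by simp
  also have "det E = (\<Prod>c\<in>UNIV. E $ c $ c)" by (rule det_diagonal) (simp add: E_def)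
  also have "\<dots> \<noteq> 0" using sP by (simp add: E_def)
  finally show ?thesis by (auto simp: evaluate_jacobian_minor M_def)
qed

text \<open>With \<open>s = \<Sum> (d'\<^sub>j - 1)\<close> the Jacobian determinant \<open>J\<close> has
  degree \<open>(d - 1, s)\<close> and vanishes at no point. Weights that do not vanish at a point
  and annihilate all degrees at most \<open>s\<close> would give the constant \<open>0\<close>,
  hence \<open>J = 0\<close> at this point. So every point of the second projection has a separator
  of degree \<open>s\<close>. For a point without separators of degree \<open>s - 1\<close> there
  are weights annihilating the degrees below \<open>s\<close>; their constant is nonzero, so they
  vanish nowhere, and no point has a separator of degree less than \<open>s\<close>.\<close>

lemma cayley_bacharach_and_different:
  assumes gens: "bihom_generators Z Fs" and ds: "\<forall>d\<in>set ds. d \<ge> 1"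
    and CI: "complete_intersection Z (card (fst ` Z)) ds"
  shows "cayley_bacharach Z"
    and "HF_module Z (kaehler_different Z Fs) (card (fst ` Z) - 1) (regularity_index (snd ` Z)) \<noteq> 0"
proof -
  define d where "d = card (fst ` Z)"
  have d: "d \<ge> 1"
    unfolding d_def using fst.finite_S fst.nonempty by (simp add: Suc_le_eq card_gt_0_iff)
  obtain F0 Gs where len: "length ds = CARD('n)" "length Gs = CARD('n)"
    and F0: "F0 \<in> bihom_piece d 0" and Gs: "\<And>k. k < CARD('n) \<Longrightarrow> Gs ! k \<in> bihom_piece 0 (ds ! k)"
    and reg: "regular_sequence type_ring (F0 # Gs)"
    and ideal0: "bivanishing_ideal Z = ideal_span (set (F0 # Gs))"
    using CI unfolding complete_intersection_def genideal_eq d_def by metis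
  have ds1: "ds ! k \<ge> 1" if "k < CARD('n)" for k using ds len(1) that by simp
  obtain idx where idx: "bij_betw idx (UNIV :: 'n set) {..<CARD('n)}"
    using ex_bij_betw_finite_nat[of "UNIV :: 'n set"] by (auto simp: atLeast0LessThan)
  have idx_less: "idx j < CARD('n)" for j using idx by (auto simp: bij_betw_def)
  define F where "F = (\<lambda>c. case c of None \<Rightarrow> F0 | Some j \<Rightarrow> Gs ! idx j)"
  define a where "a = (\<lambda>c :: 'n option. case c of None \<Rightarrow> d | Some _ \<Rightarrow> 0)"
  define b where "b = (\<lambda>c :: 'n option. case c of None \<Rightarrow> 0 | Some j \<Rightarrow> ds ! idx j)"
  define s where "s = (\<Sum>k<CARD('n). ds ! k - 1)"
  have F: "F c \<in> bihom_piece (a c) (b c)" for c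
    using F0 Gs[OF idx_less] by (cases c) (auto simp: F_def a_def b_def)
  have range_F: "range F = set (F0 # Gs)"
  proof -
    have "range F = insert F0 ((\<lambda>j. Gs ! idx j) ` UNIV)"
      by (auto simp: F_def UNIV_option_conv image_image)
    also have "(\<lambda>j. Gs ! idx j) ` UNIV = (!) Gs ` {..<CARD('n)}"
      using idx by (metis bij_betw_def image_image)
    also have "\<dots> = set Gs" using len(2) by (auto simp: set_conv_nth)
    finally show ?thesis by simp
  qed
  have ideal: "bivanishing_ideal Z = ideal_span (range F)" unfolding range_F by (rule ideal0)
  have sum_a: "(\<Sum>c\<in>UNIV. a c) = d" by (simp add: a_def UNIV_option_conv sum.reindex)
  have sum_b: "(\<Sum>c\<in>UNIV. b c) = s + CARD('n)"
  proof -
    have "(\<Sum>c\<in>UNIV. b c) = (\<Sum>j\<in>UNIV. ds ! idx j)" by (simp add: b_def UNIV_option_conv sum.reindex)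
    also have "\<dots> = (\<Sum>k<CARD('n). ds ! k)" by (rule sum.reindex_bij_betw[OF idx])
    also have "\<dots> = (\<Sum>k<CARD('n). (ds ! k - 1) + 1)" by (rule sum.cong) (use ds1 in fastforce)+
    also have "\<dots> = s + CARD('n)" unfolding s_def sum.distrib by simp
    finally show ?thesis .
  qed
  have prod: "Z = fst ` Z \<times> snd ` Z"
    by (rule product_of_separated_generators[OF F _ ideal]) (auto simp: a_def b_def split: option.split)
  have vanish: "evaluate (rep2 P) (F k) = 0" if "P \<in> Z" for k P
    by (rule ideal_evaluate[OF _ that]) (simp add: ideal idl.span_base)
  have J: "evaluate (rep2 P) (jacobian_minor F) \<noteq> 0" if "P \<in> Z" for P
    by (rule jacobian_nonzero_if_generators[OF ideal that])
  have below1: "\<not> sep (fst ` Z) i p" if "p \<in> fst ` Z" "i < d - 1" for i p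
    using sep_line_iff[OF fst.affine_proj_points_axioms, of p i] that by (auto simp: d_def)
  \<comment> \<open>The common setting of both applications: \<open>D = Suc s\<close> makes the constant zero, and
    \<open>D = s\<close> makes the weights nonzero everywhere.\<close>
  have functionals: "\<exists>\<phi>1 \<phi>2 c. \<phi>1 (fst P) \<noteq> 0 \<and> \<phi>2 (snd P) \<noteq> 0 \<and>
      (\<forall>f i. i < D \<longrightarrow> f \<in> hom_piece i \<longrightarrow> (\<Sum>q\<in>snd ` Z. \<phi>2 q * evaluate (affine_rep q) f) = 0) \<and>
      (\<forall>Q\<in>Z. \<phi>1 (fst Q) * \<phi>2 (snd Q) * evaluate (rep2 Q) (jacobian_minor F) = c) \<and> (s < D \<longrightarrow> c = 0)"
    if P: "P \<in> Z" and D: "s \<le> D" "\<And>i. i < D \<Longrightarrow> \<not> sep (snd ` Z) i (snd P)" for P D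
  proof -
    obtain \<phi>1 where \<phi>1: "\<phi>1 (fst P) \<noteq> 0"
      "\<And>f i. i < d - 1 \<Longrightarrow> f \<in> hom_piece i \<Longrightarrow> (\<Sum>q\<in>fst ` Z. \<phi>1 q * evaluate (affine_rep q) f) = 0"
      by (rule fst.functional_killing_low_degrees[of "fst P" "d - 1"]) (use P below1 in auto)
    obtain \<phi>2 where \<phi>2: "\<phi>2 (snd P) \<noteq> 0"
      "\<And>f i. i < D \<Longrightarrow> f \<in> hom_piece i \<Longrightarrow> (\<Sum>q\<in>snd ` Z. \<phi>2 q * evaluate (affine_rep q) f) = 0"
      by (rule snd.functional_killing_low_degrees[of "snd P" D]) (use P D in auto)
    interpret weighted_points Z rep2 "\<lambda>P. \<phi>1 (fst P) * \<phi>2 (snd P)" "d - 1" D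
      by (rule weighted_points_product[OF prod \<phi>1(2) \<phi>2(2)])
    have bounds: "(\<Sum>c\<in>UNIV. a c) \<le> d - 1 + 1" "(\<Sum>c\<in>UNIV. b c) \<le> D + CARD('n)"
      using sum_a sum_b d D(1) by auto
    obtain c where c: "\<And>Q. Q \<in> Z \<Longrightarrow> \<phi>1 (fst Q) * \<phi>2 (snd Q) * evaluate (rep2 Q) (jacobian_minor F) = c"
      "\<And>f i j. f \<in> bihom_piece i j \<Longrightarrow> (\<And>P. P \<in> Z \<Longrightarrow> evaluate (rep2 P) f = 0) \<Longrightarrow> const c * f \<in> ideal_span (range F)"
      "(\<Sum>c\<in>UNIV. a c) < d - 1 + 1 \<or> (\<Sum>c\<in>UNIV. b c) < D + CARD('n) \<Longrightarrow> c = 0"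
      using exists_determinant_constant[OF F vanish bounds] by blast
    have "s < D \<longrightarrow> c = 0" using c(3) sum_b by simp
    then show ?thesis using \<phi>1(1) \<phi>2 c(1) by blast
  qed
  have sep_s: "sep (snd ` Z) s (snd P)" if P: "P \<in> Z" for P
  proof (rule ccontr)
    assume "\<not> sep (snd ` Z) s (snd P)"
    then have "\<not> sep (snd ` Z) i (snd P)" if "i < Suc s" for i
      using snd.sep_mono[of i "snd P" s] P that by auto
    then obtain \<phi>1 \<phi>2 c where "\<phi>1 (fst P) \<noteq> 0" "\<phi>2 (snd P) \<noteq> 0"
      "\<forall>Q\<in>Z. \<phi>1 (fst Q) * \<phi>2 (snd Q) * evaluate (rep2 Q) (jacobian_minor F) = c" "c = 0"
      using functionals[OF P, of "Suc s"] by auto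
    then show False using J[OF P] P by auto
  qed
  have not_sep: "\<not> sep (snd ` Z) i (snd Q)" if Q: "Q \<in> Z" and i: "i < s" for Q i
  proof
    assume sep: "sep (snd ` Z) i (snd Q)"
    obtain t where t: "s = Suc t" using i by (cases s) auto
    obtain q where q: "q \<in> snd ` Z" "\<not> sep (snd ` Z) t q"
      using complete_intersection_not_separable[OF F0 d len(2) Gs ds1 reg ideal0, of t] t
      unfolding s_def by blast
    obtain P where P: "P \<in> Z" "q = snd P" using q(1) by auto
    have "\<not> sep (snd ` Z) j (snd P)" if "j < s" for j
      using snd.sep_mono[of j q t] q P that t by auto
    then obtain \<phi>1 \<phi>2 c where \<phi>: "\<phi>1 (fst P) \<noteq> 0" "\<phi>2 (snd P) \<noteq> 0"
      "\<forall>f i. i < s \<longrightarrow> f \<in> hom_piece i \<longrightarrow> (\<Sum>q\<in>snd ` Z. \<phi>2 q * evaluate (affine_rep q) f) = 0"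
      "\<forall>Q\<in>Z. \<phi>1 (fst Q) * \<phi>2 (snd Q) * evaluate (rep2 Q) (jacobian_minor F) = c"
      using functionals[OF P(1), of s] by blast
    have "\<phi>1 (fst P) * \<phi>2 (snd P) * evaluate (rep2 P) (jacobian_minor F) = c" using \<phi>(4) P(1) by blast
    then have "c \<noteq> 0" using \<phi>(1,2) J[OF P(1)] by auto
    moreover have "\<phi>1 (fst Q) * \<phi>2 (snd Q) * evaluate (rep2 Q) (jacobian_minor F) = c" using \<phi>(4) Q by blast
    ultimately have "\<phi>2 (snd Q) \<noteq> 0" by auto
    obtain f where f: "f \<in> hom_piece i" "evaluate (affine_rep (snd Q)) f \<noteq> 0"
      "\<forall>q\<in>snd ` Z - {snd Q}. evaluate (affine_rep q) f = 0" using sep by (auto simp: separable_def)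
    have "(\<Sum>q\<in>snd ` Z. \<phi>2 q * evaluate (affine_rep q) f)
        = \<phi>2 (snd Q) * evaluate (affine_rep (snd Q)) f + (\<Sum>q\<in>snd ` Z - {snd Q}. \<phi>2 q * evaluate (affine_rep q) f)"
      using Q by (intro sum.remove snd.finite_S) auto
    also have "(\<Sum>q\<in>snd ` Z - {snd Q}. \<phi>2 q * evaluate (affine_rep q) f) = 0"
      using f(3) by (intro sum.neutral) auto
    finally show False using \<phi>(3) i f(1,2) \<open>\<phi>2 (snd Q) \<noteq> 0\<close> by auto
  qed
  have sep_iff: "sep (snd ` Z) j (snd P) \<longleftrightarrow> s \<le> j" if "P \<in> Z" for P j
    using sep_s[OF that] not_sep[OF that, of j] snd.sep_mono[of s "snd P" j] that by fastforce
  have "bisep Z i j P \<longleftrightarrow> d - 1 \<le> i \<and> s \<le> j" if "P \<in> Z" for P i j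
    unfolding bisep_product_iff[OF prod that] sep_iff[OF that] d_def
    using sep_line_iff[OF fst.affine_proj_points_axioms] that by simp
  then show "cayley_bacharach Z" unfolding cayley_bacharach_iff by blast
  have r: "regularity_index (snd ` Z) = s"
  proof (rule antisym)
    show "regularity_index (snd ` Z) \<le> s"
    proof (rule ccontr)
      assume "\<not> regularity_index (snd ` Z) \<le> s"
      then obtain q where "q \<in> snd ` Z" "\<not> sep (snd ` Z) s q"
        using snd.regularity_index_below[of s] by auto
      then show False using sep_s by auto
    qed
    obtain P where P: "P \<in> Z" using nonempty by blast
    show "s \<le> regularity_index (snd ` Z)"
      using snd.regularity_index_sep[of "snd P"] sep_iff[OF P] P by auto
  qed
  show "HF_module Z (kaehler_different Z Fs) (card (fst ` Z) - 1) (regularity_index (snd ` Z)) \<noteq> 0"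
  proof -
    obtain P where P: "P \<in> Z" using nonempty by blast
    show ?thesis
      unfolding different_nonzero_iff r
    proof (intro bexI conjI)
      have ideal_Fs: "bivanishing_ideal Z = ideal_span Fs"
        using gens by (simp add: bihom_generators_def genideal_eq)
      show "jacobian_minor F \<in> ideal_span (bivanishing_ideal Z \<union> {jacobian_minor r |r. range r \<subseteq> Fs})"
        unfolding ideal_Fs
      proof (rule jacobian_minor_in_different)
        show "finite Fs" using gens by (simp add: bihom_generators_def)
        show "F k \<in> ideal_span Fs" for k
          unfolding ideal_Fs[symmetric] ideal by (simp add: idl.span_base)
      qed
      show "jacobian_minor F \<in> bihom_piece (card (fst ` Z) - 1) s"
        using jacobian_minor_piece[OF F, of "\<lambda>c. c"] unfolding sum_a sum_b d_def by simp
      show "evaluate (rep2 P) (jacobian_minor F) \<noteq> 0" by (rule J[OF P])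
      show "P \<in> Z" by (rule P)
    qed
  qed
qed

end

section \<open>The characterization of complete intersections\<close>

theorem theorem1p3:
  fixes \<X> :: "('n::finite, 'k::field_char_0) bipoint set"
    and Fs :: "('n, 'k) bipoly set"
  assumes "finite \<X>" and "\<X> \<noteq> {}"
    and "star_property \<X>"
    and "coordinates_regular \<X>"
    and "bihom_generators \<X> Fs"
  shows "(\<exists>ds. (\<forall>d\<in>set ds. d \<ge> 1) \<and> complete_intersection \<X> (card (fst ` \<X>)) ds) \<longleftrightarrow>
    cayley_bacharach \<X> \<and>
    HF_module \<X> (kaehler_different \<X> Fs) (card (fst ` \<X>) - 1) (regularity_index (snd ` \<X>)) \<noteq> 0"
proof -
  interpret affine_points_char_0 \<X>
  proof
    show "finite \<X>" "\<X> \<noteq> {}" by fact+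
    show "affine_point (fst P) \<and> affine_point (snd P)" if "P \<in> \<X>" for P
      using coordinates_regular_affine[OF assms(1,4), of "fst P" "snd P"] that by simp
  qed
  show ?thesis
    using cayley_bacharach_and_different[OF assms(5)]
      complete_intersection_if_different_nonzero[OF assms(3) _ assms(5)] by blast
qed

end
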